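(* Let $\phi\in\mathcal{K}$ and let $f=h+\overline{g}$ be a locally univalent and sense-preserving harmonic mapping in $\mathbb{D}$ such that, for some real numbers $\mu$ and $\nu$, the function $h+e^{-2i\mu}g$ belongs to $\mathcal{K}$ and $$\big((h+e^{-2i\mu}g)*\phi\big)(z)=\int_0^z \frac{d\xi}{1-2\xi e^{i\mu}\cos\nu+\xi^2e^{2i\mu}},\quad z\in\mathbb{D}.$$ Then the convolution $f\tilde{*}\phi$ belongs to $\mathcal{K}_H$.
   Context: $\mathbb{D}=\{z\in\mathbb{C}:|z|<1\}$. Every complex-valued harmonic function on $\mathbb{D}$ is written $f=h+\overline{g}$ with $h,g$ analytic in $\mathbb{D}$, and is assumed normalized: $h(0)=h'(0)-1=g(0)=0$. Such $f$ is locally univalent and sense-preserving iff $|g'|<|h'|$ on $\mathbb{D}$. $\mathcal{K}$ is the class of analytic univalent functions $\psi$ on $\mathbb{D}$ with $\psi(0)=\psi'(0)-1=0$ and $\psi(\mathbb{D})$ convex. $\mathcal{K}_H$ is the class of all univalent harmonic functions $f=h+\overline{g}$ on $\mathbb{D}$, with $h,g$ analytic in $\mathbb{D}$ and normalized by $h(0)=h'(0)-1=g(0)=0$, mapping $\mathbb{D}$ onto a convex domain. For analytic $\phi_1(z)=\sum_{n\ge0} a_nz^n$, $\phi_2(z)=\sum_{n\ge0} b_nz^n$ the convolution is $(\phi_1*\phi_2)(z)=\sum_{n\ge0} a_nb_nz^n$. For harmonic $f=h+\overline{g}$ and analytic $\phi$, $f\tilde{*}\phi:=h*\phi+\overline{g*\phi}$.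 *)

theory Defs
  imports "HOL-Complex_Analysis.Complex_Analysis"
begin

abbreviation unit_disc :: "complex set" (\<open>\<D>\<close>) where
  "\<D> \<equiv> ball 0 1"

text \<open>
  All functions are total functions on the complex plane; only their values on the
  unit disc are relevant.
\<close>

definition class_K :: "(complex \<Rightarrow> complex) set" (\<open>\<K>\<close>) where
  "\<K> = {\<psi>. \<psi> holomorphic_on \<D> \<and> inj_on \<psi> \<D> \<and>
            \<psi> 0 = 0 \<and> deriv \<psi> 0 = 1 \<and> convex (\<psi> ` \<D>)}"

text \<open>
  The normalized decomposition \<open>f = h + cnj g\<close> of a harmonic function on the disc.  The
  condition \<open>g 0 = 0\<close> makes \<open>h\<close> and \<open>g\<close> unique on the disc.
\<close>

definition harmonic_decomp ::
    "(complex \<Rightarrow> complex) \<Rightarrow> (complex \<Rightarrow> complex) \<Rightarrow> (complex \<Rightarrow> complex) \<Rightarrow> bool" where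
  "harmonic_decomp f h g \<longleftrightarrow>
     h holomorphic_on \<D> \<and> g holomorphic_on \<D> \<and>
     h 0 = 0 \<and> deriv h 0 = 1 \<and> g 0 = 0 \<and>
     (\<forall>z\<in>\<D>. f z = h z + cnj (g z))"

definition class_KH :: "(complex \<Rightarrow> complex) set" (\<open>\<K>\<^sub>H\<close>) where
  "\<K>\<^sub>H = {f. (\<exists>h g. harmonic_decomp f h g) \<and> inj_on f \<D> \<and>
             open (f ` \<D>) \<and> convex (f ` \<D>)}"

definition locally_univalent_on :: "complex set \<Rightarrow> (complex \<Rightarrow> complex) \<Rightarrow> bool" where
  "locally_univalent_on S f \<longleftrightarrow>
     (\<forall>z\<in>S. \<exists>U. open U \<and> z \<in> U \<and> U \<subseteq> S \<and> inj_on f U)"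

text \<open>
  The real Jacobian determinant \<open>u\<^sub>x v\<^sub>y - u\<^sub>y v\<^sub>x\<close> of \<open>f = u + \<i> v\<close>, written as
  \<open>Im (cnj f\<^sub>x * f\<^sub>y)\<close>.
\<close>

definition jacobian :: "(complex \<Rightarrow> complex) \<Rightarrow> complex \<Rightarrow> real" where
  "jacobian f z =
     Im (cnj (frechet_derivative f (at z) 1) * frechet_derivative f (at z) \<i>)"

definition sense_preserving_on :: "complex set \<Rightarrow> (complex \<Rightarrow> complex) \<Rightarrow> bool" where
  "sense_preserving_on S f \<longleftrightarrow> (\<forall>z\<in>S. f differentiable (at z) \<and> jacobian f z > 0)"

definition conv ::
    "(complex \<Rightarrow> complex) \<Rightarrow> (complex \<Rightarrow> complex) \<Rightarrow> complex \<Rightarrow> complex" (infixl \<open>\<star>\<close> 70) where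
  "(\<phi>\<^sub>1 \<star> \<phi>\<^sub>2) z =
     (\<Sum>n. fps_nth (fps_expansion \<phi>\<^sub>1 0) n * fps_nth (fps_expansion \<phi>\<^sub>2 0) n * z ^ n)"

text \<open>The convolution of the harmonic function \<open>h + cnj g\<close> with the analytic function \<open>\<phi>\<close>.\<close>

definition harmonic_conv ::
    "(complex \<Rightarrow> complex) \<Rightarrow> (complex \<Rightarrow> complex) \<Rightarrow> (complex \<Rightarrow> complex) \<Rightarrow> complex \<Rightarrow> complex" where
  "harmonic_conv h g \<phi> z = (h \<star> \<phi>) z + cnj ((g \<star> \<phi>) z)"

end

theory Submission
  imports Defs
begin

text \<open>
  Write \<open>H = h \<star> \<phi>\<close>, \<open>G = g \<star> \<phi>\<close> and \<open>\<epsilon> = exp (-2 \<i> \<mu>)\<close>.  After a rotation by \<open>exp (\<i> \<mu>)\<close> the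
  hypothesis says that \<open>X = H + \<epsilon> G\<close> is the conformal map with derivative
  \<open>1 / (1 - 2 z cos \<nu> + z\<^sup>2)\<close>, whose image is a vertical strip or half-plane.  With \<open>Y = H - \<epsilon> G\<close>
  the convolution \<open>H + cnj G\<close> becomes \<open>Re X + \<i> Im Y\<close>.  Two facts finish the proof.

  The quotient \<open>Y' / X'\<close> has positive real part.  Before the convolution this holds because
  \<open>\<bar>g'\<bar> < \<bar>h'\<bar>\<close>, and convolution with a convex function preserves it: this is the theorem of
  Ruscheweyh and Sheil-Small, \<open>Re_conv_multiplier_positive\<close>, that
  \<open>(\<phi> \<star> z k' P) / (\<phi> \<star> z k')\<close> has positive real part whenever \<open>\<phi>\<close> and \<open>k\<close> are convex and
  \<open>Re P > 0\<close>.  Its proof is built on a pairing of functions with positive real part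
  (\<open>conv_positive_multiplier\<close>), which reduces a general multiplier to the half-plane maps
  \<open>(1 + \<zeta> z) / (1 - \<zeta> z)\<close>, and on two consequences of convexity.  First, the Schwarz lemma shows that
  \<open>\<phi>\<close> maps no three points of a circle around \<open>0\<close> to a line (\<open>circle_image_no_three_on_line\<close>).
  Since convolution with \<open>1 / (1 - x z)\<close> only evaluates \<open>\<phi>\<close> at \<open>x z\<close>, this settles the case where
  \<open>z k'\<close> is replaced by \<open>z / ((1 - x z) (1 - y z))\<close>.  Second, the height of the boundary curve of
  \<open>k\<close> over a supporting line rises and then falls, which means that
  \<open>k' (1 - c z) (1 - x z)\<close> lies in a half-plane for a suitable \<open>x\<close>
  (\<open>Re_convex_deriv_times_quadratic_nonneg\<close>).  This exhibits \<open>z k' (1 - c z) / (1 - y z)\<close> as a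
  half-plane valued multiple of the two-pole kernel, so its convolution with \<open>\<phi>\<close> has no zero in the
  punctured disc.  Letting \<open>c\<close> run over the circle, the quotient belonging to a half-plane map never
  becomes imaginary, and as it starts at \<open>1\<close> it stays in the right half-plane.

  A map \<open>Re X + \<i> Im Y\<close> with \<open>Re (Y' / X') > 0\<close> and \<open>X\<close> onto a vertically invariant domain is univalent
  with convex image (\<open>harmonic_shear_convex\<close>).  In the coordinate \<open>w = X z\<close> it moves each vertical
  line into itself and increases along it, which gives injectivity.  The upper end of the image on
  the line \<open>Re w = s\<close> is a concave function of \<open>s\<close> (and the lower end convex), by the maximum principle
  on tall rectangles with a quadratic barrier.
\<close>

section \<open>Harmonic shears over vertically invariant domains\<close>

lemma Im_strictly_increasing_vertically:
  assumes \<Psi>: "\<Psi> holomorphic_on W" "open W" and pos: "\<And>w. w \<in> W \<Longrightarrow> Re (deriv \<Psi> w) > 0"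
    and vert: "\<And>w t. w \<in> W \<Longrightarrow> w + \<i> * of_real t \<in> W"
    and w: "w \<in> W" and t: "a < b"
  shows "Im (\<Psi> (w + \<i> * of_real a)) < Im (\<Psi> (w + \<i> * of_real b))"
proof (rule DERIV_pos_imp_increasing[OF t])
  fix t
  have "((\<lambda>z. \<Psi> (w + \<i> * z)) has_field_derivative deriv \<Psi> (w + \<i> * of_real t) * \<i>) (at (of_real t))"
  proof -
    have "(\<Psi> has_field_derivative deriv \<Psi> (w + \<i> * of_real t)) (at (w + \<i> * of_real t))"
      by (rule holomorphic_derivI[OF \<Psi> vert[OF w]])
    moreover have "((\<lambda>z. w + \<i> * z) has_field_derivative \<i>) (at (of_real t))"
      by (auto intro!: derivative_eq_intros)
    ultimately show ?thesis
      using DERIV_chain2[of \<Psi> "deriv \<Psi> (w + \<i> * of_real t)" "\<lambda>z. w + \<i> * z" "of_real t" \<i> UNIV] by simp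
  qed
  then have "((\<lambda>t. \<Psi> (w + \<i> * of_real t)) has_vector_derivative deriv \<Psi> (w + \<i> * of_real t) * \<i>) (at t)"
    by (rule has_vector_derivative_real_field)
  then have "((\<lambda>t. Im (\<Psi> (w + \<i> * of_real t))) has_vector_derivative Im (deriv \<Psi> (w + \<i> * of_real t) * \<i>)) (at t)"
    by (rule bounded_linear.has_vector_derivative[OF bounded_linear_Im])
  then have "((\<lambda>t. Im (\<Psi> (w + \<i> * of_real t))) has_real_derivative Re (deriv \<Psi> (w + \<i> * of_real t))) (at t)"
    by (simp add: has_real_derivative_iff_has_vector_derivative)
  then show "\<exists>y. ((\<lambda>t. Im (\<Psi> (w + \<i> * of_real t))) has_real_derivative y) (at t) \<and> 0 < y"
    using pos[OF vert[OF w]] by blast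
qed

text \<open>
  Suppose that \<open>w1\<close>, \<open>w2\<close> lie on different vertical lines.  On the half-strip between them, above
  both points, the imaginary part of \<open>\<Psi>\<close> exceeds the affine interpolation of \<open>y1\<close>, \<open>y2\<close> by a fixed \<open>\<delta>\<close> on the
  two sides and is bounded below relative to it, by monotonicity.  The harmonic barrier
  \<open>\<epsilon> ((Re w - s)\<^sup>2 - (Im w - T)\<^sup>2)\<close>, with \<open>s\<close> the middle abscissa, outweighs the lower bound on top and bottom of a rectangle
  around height \<open>T\<close> that is tall enough, while it costs at most \<open>\<delta> / 2\<close> on the sides.
\<close>

lemma upper_envelope_concave:
  assumes \<Psi>: "\<Psi> holomorphic_on W" "open W" and W: "convex W"
    and pos: "\<And>w. w \<in> W \<Longrightarrow> Re (deriv \<Psi> w) > 0"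
    and vert: "\<And>w t. w \<in> W \<Longrightarrow> w + \<i> * of_real t \<in> W"
    and w: "w1 \<in> W" "w2 \<in> W" and y: "y1 < Im (\<Psi> w1)" "y2 < Im (\<Psi> w2)"
    and uv: "0 \<le> u" "0 \<le> v" "u + v = 1"
  shows "\<exists>w\<in>W. Re w = u * Re w1 + v * Re w2 \<and> Im (\<Psi> w) > u * y1 + v * y2"
proof -
  have above: "Im (\<Psi> w) \<le> Im (\<Psi> w')" if "w \<in> W" "Re w' = Re w" "Im w \<le> Im w'" for w w'
  proof (cases "Im w = Im w'")
    case True
    then have "w = w'" using that by (simp add: complex_eq_iff)
    then show ?thesis by simp
  next
    case False
    have "w' = w + \<i> * of_real (Im w' - Im w)" using that by (simp add: complex_eq_iff)
    then show ?thesis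
      using Im_strictly_increasing_vertically[OF \<Psi> pos vert that(1), of 0 "Im w' - Im w"] that False by simp
  qed
  have column: "w' \<in> W" if "w \<in> W" "Re w' = Re w" for w w'
  proof -
    have "w' = w + \<i> * of_real (Im w' - Im w)" using that by (simp add: complex_eq_iff)
    then show ?thesis using vert[OF that(1)] by metis
  qed
  have strict: "\<exists>w\<in>W. Re w = u * Re w1 + v * Re w2 \<and> Im (\<Psi> w) > u * y1 + v * y2"
    if w: "w1 \<in> W" "w2 \<in> W" and y: "y1 < Im (\<Psi> w1)" "y2 < Im (\<Psi> w2)"
      and uv: "0 \<le> u" "0 \<le> v" "u + v = 1" and less: "Re w1 < Re w2" for w1 w2 y1 y2 u v
  proof -
    define s1 s2 \<tau> where "s1 = Re w1" and "s2 = Re w2" and "\<tau> = max (Im w1) (Im w2)"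
    have s: "s1 < s2" using less by (simp add: s1_def s2_def)
    define \<delta> where "\<delta> = min (Im (\<Psi> w1) - y1) (Im (\<Psi> w2) - y2)"
    have \<delta>: "\<delta> > 0" "y1 + \<delta> \<le> Im (\<Psi> w1)" "y2 + \<delta> \<le> Im (\<Psi> w2)" using y by (auto simp: \<delta>_def)
    define m where "m = (y2 - y1) / (s2 - s1)"
    define line where "line x = y1 + m * (x - s1)" for x
    have line: "line s1 = y1" "line s2 = y2" using s by (simp_all add: line_def m_def)
    have strip: "z \<in> W" if "s1 \<le> Re z" "Re z \<le> s2" for z
    proof -
      define \<theta> where "\<theta> = (Re z - s1) / (s2 - s1)"
      have "0 \<le> \<theta>" "\<theta> \<le> 1" using that s by (auto simp: \<theta>_def)
      then have "(1 - \<theta>) *\<^sub>R w1 + \<theta> *\<^sub>R w2 \<in> W" using convexD[OF W w, of "1 - \<theta>" \<theta>] by simp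
      moreover have "\<theta> * (s2 - s1) = Re z - s1" using s by (simp add: \<theta>_def)
      then have "Re z = Re ((1 - \<theta>) *\<^sub>R w1 + \<theta> *\<^sub>R w2)"
        unfolding s1_def s2_def by (simp add: algebra_simps)
      ultimately show ?thesis using column by blast
    qed
    have cont: "continuous_on W \<Psi>" by (rule holomorphic_on_imp_continuous_on[OF \<Psi>(1)])
    obtain B where B: "\<And>x. x \<in> {s1..s2} \<Longrightarrow> line x - Im (\<Psi> (Complex x \<tau>)) \<le> B"
    proof -
      have "continuous_on {s1..s2} (\<lambda>x. \<Psi> (of_real x + \<i> * of_real \<tau>))"
        by (rule continuous_on_compose2[OF cont]) (auto intro!: continuous_intros strip)
      then have "continuous_on {s1..s2} (\<lambda>x. line x - Im (\<Psi> (of_real x + \<i> * of_real \<tau>)))"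
        unfolding line_def by (intro continuous_intros)
      then have "continuous_on {s1..s2} (\<lambda>x. line x - Im (\<Psi> (Complex x \<tau>)))"
        by (simp only: Complex_eq)
      then have "\<exists>x0\<in>{s1..s2}. \<forall>x\<in>{s1..s2}. line x - Im (\<Psi> (Complex x \<tau>)) \<le> line x0 - Im (\<Psi> (Complex x0 \<tau>))"
        using s by (intro continuous_attains_sup) simp_all
      then obtain x0 where "\<forall>x\<in>{s1..s2}. line x - Im (\<Psi> (Complex x \<tau>)) \<le> line x0 - Im (\<Psi> (Complex x0 \<tau>))"
        by blast
      then show ?thesis using that by blast
    qed
    define B' where "B' = max B 0"
    \<comment> \<open>\<open>\<epsilon>\<close> makes the barrier cost \<open>\<delta> / 2\<close> at horizontal distance \<open>d\<close>; since \<open>R \<ge> 1\<close>, the choice of \<open>R\<close> gives \<open>\<epsilon> R\<^sup>2 \<ge> B' + \<delta>\<close>\<close>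
    define d \<epsilon> R where "d = (s2 - s1) / 2" and "\<epsilon> = \<delta> / (2 * d\<^sup>2)" and "R = 1 + (B' + \<delta>) / \<epsilon>"
    have d: "d > 0" using s by (simp add: d_def)
    have \<epsilon>: "\<epsilon> > 0" "\<epsilon> * d\<^sup>2 = \<delta> / 2" using \<delta> d by (simp_all add: \<epsilon>_def)
    have B': "B' \<ge> 0" "B \<le> B'" by (simp_all add: B'_def)
    have R: "R \<ge> 1" "\<epsilon> * R\<^sup>2 \<ge> B' + \<delta>"
    proof -
      show R1: "R \<ge> 1" using B' \<delta> \<epsilon> by (simp add: R_def)
      have "\<epsilon> * R\<^sup>2 \<ge> \<epsilon> * R" using R1 \<epsilon> by (simp add: power2_eq_square)
      moreover have "\<epsilon> * R = \<epsilon> + (B' + \<delta>)"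
        unfolding R_def distrib_left using \<epsilon>(1) by simp
      ultimately show "\<epsilon> * R\<^sup>2 \<ge> B' + \<delta>" using \<epsilon> by simp
    qed
    define T0 c0 where "T0 = \<tau> + R" and "c0 = Complex ((s1 + s2) / 2) T0"
    define J where "J z = \<i> * \<Psi> z + of_real y1 + of_real m * (z - of_real s1) + of_real \<epsilon> * (z - c0)\<^sup>2" for z
    have ReJ: "Re (J z) = line (Re z) - Im (\<Psi> z) + \<epsilon> * ((Re z - (s1 + s2) / 2)\<^sup>2 - (Im z - T0)\<^sup>2)" for z
      by (simp add: J_def line_def c0_def power2_eq_square)
    define S where "S = cbox (Complex s1 \<tau>) (Complex s2 (T0 + R))"
    have S_W: "S \<subseteq> W" using strip by (auto simp: S_def in_cbox_complex_iff)
    have frontier_le: "Re (J z) \<le> - \<delta> / 2" if z: "z \<in> frontier S" for z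
    proof -
      have zS: "s1 \<le> Re z" "Re z \<le> s2" "\<tau> \<le> Im z" "Im z \<le> T0 + R"
        and edge: "Re z = s1 \<or> Re z = s2 \<or> Im z = \<tau> \<or> Im z = T0 + R"
        using z by (auto simp: S_def frontier_cbox in_cbox_complex_iff in_box_complex_iff)
      have "(Re z - (s1 + s2) / 2)\<^sup>2 \<le> d\<^sup>2"
        using zS by (intro power2_le_iff_abs_le[THEN iffD2]) (auto simp: d_def field_simps abs_le_iff)
      then have quad: "\<epsilon> * (Re z - (s1 + s2) / 2)\<^sup>2 \<le> \<delta> / 2"
        using \<epsilon> mult_left_mono[of _ _ \<epsilon>] by fastforce
      consider "Re z = s1" | "Re z = s2" | "\<bar>Im z - T0\<bar> = R"
        using edge R by (auto simp: T0_def)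
      then show ?thesis
      proof cases
        case 1
        have "Im (\<Psi> w1) \<le> Im (\<Psi> z)" using above[OF w(1), of z] 1 zS by (simp add: s1_def \<tau>_def)
        moreover have "\<epsilon> * (Im z - T0)\<^sup>2 \<ge> 0" using \<epsilon> by simp
        ultimately show ?thesis using \<delta> quad line 1 unfolding ReJ right_diff_distrib by simp
      next
        case 2
        have "Im (\<Psi> w2) \<le> Im (\<Psi> z)" using above[OF w(2), of z] 2 zS by (simp add: s2_def \<tau>_def)
        moreover have "\<epsilon> * (Im z - T0)\<^sup>2 \<ge> 0" using \<epsilon> by simp
        ultimately show ?thesis using \<delta> quad line 2 unfolding ReJ right_diff_distrib by simp
      next
        case 3
        have "Complex (Re z) \<tau> \<in> W" using strip zS by simp
        then have "Im (\<Psi> (Complex (Re z) \<tau>)) \<le> Im (\<Psi> z)" using zS by (intro above) auto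
        moreover have "line (Re z) - Im (\<Psi> (Complex (Re z) \<tau>)) \<le> B" using B zS by simp
        moreover have "\<epsilon> * (Im z - T0)\<^sup>2 \<ge> B' + \<delta>" using R(2) 3 by (metis power2_abs)
        ultimately show ?thesis using \<delta> quad B' unfolding ReJ right_diff_distrib by simp
      qed
    qed
    define \<xi> where "\<xi> = Complex (u * s1 + v * s2) T0"
    have x: "s1 \<le> u * s1 + v * s2" "u * s1 + v * s2 \<le> s2"
    proof -
      have "u = 1 - v" "v = 1 - u" using uv by simp_all
      then have "u * s1 + v * s2 = s1 + v * (s2 - s1)" "u * s1 + v * s2 = s2 - u * (s2 - s1)"
        by algebra+
      moreover have "0 \<le> v * (s2 - s1)" "0 \<le> u * (s2 - s1)" using uv s by simp_all
      ultimately show "s1 \<le> u * s1 + v * s2" "u * s1 + v * s2 \<le> s2" by linarith+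
    qed
    have "\<xi> \<in> S" using x R by (simp add: S_def \<xi>_def in_cbox_complex_iff T0_def)
    have "Re (J \<xi>) \<le> - \<delta> / 2"
    proof (rule maximum_real_frontier[OF _ _ _ _ \<open>\<xi> \<in> S\<close>])
      have J_hol: "J holomorphic_on W" unfolding J_def by (intro holomorphic_intros \<Psi>)
      show "J holomorphic_on interior S"
        by (rule holomorphic_on_subset[OF J_hol]) (use S_W interior_subset in blast)
      show "continuous_on (closure S) J"
        using holomorphic_on_imp_continuous_on[OF holomorphic_on_subset[OF J_hol S_W]] by (simp add: S_def)
      show "bounded S" by (simp add: S_def bounded_cbox)
    qed (use frontier_le in auto)
    moreover have "\<epsilon> * (Re \<xi> - (s1 + s2) / 2)\<^sup>2 \<ge> 0" using \<epsilon> by simp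
    ultimately have "line (u * s1 + v * s2) < Im (\<Psi> \<xi>)"
      using \<delta> unfolding ReJ by (simp add: \<xi>_def)
    moreover have "line (u * s1 + v * s2) = u * y1 + v * y2"
    proof -
      have u: "u = 1 - v" using uv by simp
      have "line (u * s1 + v * s2) = y1 + v * (m * (s2 - s1))"
        unfolding line_def u by (simp add: algebra_simps)
      also have "m * (s2 - s1) = y2 - y1" using s by (simp add: m_def)
      finally show ?thesis unfolding u by (simp add: algebra_simps)
    qed
    ultimately show ?thesis
      using \<open>\<xi> \<in> S\<close> S_W by (intro bexI[of _ \<xi>]) (auto simp: \<xi>_def s1_def s2_def)
  qed
  consider "Re w1 < Re w2" | "Re w2 < Re w1" | "Re w1 = Re w2" by linarith
  then show ?thesis
  proof cases
    case 1
    then show ?thesis using strict w y uv by blast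
  next
    case 2
    then show ?thesis using strict[of w2 w1 y2 y1 v u] w y uv by (simp add: add.commute)
  next
    case 3
    define z where "z = Complex (Re w1) (max (Im w1) (Im w2))"
    have "Im (\<Psi> w1) \<le> Im (\<Psi> z)" "Im (\<Psi> w2) \<le> Im (\<Psi> z)"
      using 3 w by (auto intro!: above simp: z_def)
    then have "y1 < Im (\<Psi> z)" "y2 < Im (\<Psi> z)" using y by auto
    then have "u * y1 + v * y2 < Im (\<Psi> z)" using convex_bound_lt[of y1 "Im (\<Psi> z)" y2 u v] uv by simp
    moreover have "Re z = u * Re w1 + v * Re w2"
      using 3 uv by (simp add: z_def distrib_right[symmetric])
    moreover have "z \<in> W" by (rule column[OF w(1)]) (simp add: z_def)
    ultimately show ?thesis by blast
  qed
qed

text \<open>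
  A point of a segment between two image points has to be hit on its vertical line.  The values
  taken there form an interval; by \<open>upper_envelope_concave\<close> it reaches above the point, and by the same
  lemma applied to \<open>- \<Psi> (- w)\<close> it reaches below.
\<close>

lemma vertical_shear_convex:
  assumes \<Psi>: "\<Psi> holomorphic_on W" "open W" and W: "convex W"
    and pos: "\<And>w. w \<in> W \<Longrightarrow> Re (deriv \<Psi> w) > 0"
    and vert: "\<And>w t. w \<in> W \<Longrightarrow> w + \<i> * of_real t \<in> W"
  defines "f \<equiv> \<lambda>w. Complex (Re w) (Im (\<Psi> w))"
  shows "inj_on f W" "open (f ` W)" "convex (f ` W)"
proof -
  show inj: "inj_on f W"
  proof (rule inj_onI)
    fix w w' assume ww: "w \<in> W" "w' \<in> W" "f w = f w'"
    then have re: "Re w = Re w'" and im: "Im (\<Psi> w) = Im (\<Psi> w')" by (auto simp: f_def)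
    have "w' = w + \<i> * of_real (Im w' - Im w)" "w = w + \<i> * of_real 0" using re by (simp_all add: complex_eq_iff)
    then have "Im w' - Im w = 0"
      using Im_strictly_increasing_vertically[OF \<Psi> pos vert ww(1), of 0 "Im w' - Im w"]
        Im_strictly_increasing_vertically[OF \<Psi> pos vert ww(1), of "Im w' - Im w" 0] im
      by (metis less_irrefl linorder_neqE)
    then show "w = w'" using re by (simp add: complex_eq_iff)
  qed
  have cont: "continuous_on W \<Psi>" by (rule holomorphic_on_imp_continuous_on[OF \<Psi>(1)])
  have "continuous_on W f"
    unfolding f_def Complex_eq by (intro continuous_intros cont)
  then show "open (f ` W)" using invariance_of_domain[of W f] \<Psi>(2) inj by blast
  show "convex (f ` W)"
  proof (rule convexI)
    fix p q and u v :: real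
    assume "p \<in> f ` W" "q \<in> f ` W" and uv: "0 \<le> u" "0 \<le> v" "u + v = 1"
    then obtain w1 w2 where w: "w1 \<in> W" "w2 \<in> W" "p = f w1" "q = f w2" by auto
    define s y where "s = u * Re w1 + v * Re w2" and "y = u * Im (\<Psi> w1) + v * Im (\<Psi> w2)"
    have up: "Im (\<Psi> w) < Im (\<Psi> (w + \<i>))" and down: "Im (\<Psi> (w - \<i>)) < Im (\<Psi> w)" if "w \<in> W" for w
      using Im_strictly_increasing_vertically[OF \<Psi> pos vert that, of 0 1]
        Im_strictly_increasing_vertically[OF \<Psi> pos vert that, of "-1" 0] by simp_all
    have shift: "w + \<i> \<in> W" "w - \<i> \<in> W" if "w \<in> W" for w
      using vert[OF that, of 1] vert[OF that, of "-1"] by simp_all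
    obtain a where a: "a \<in> W" "Re a = s" "Im (\<Psi> a) > y"
      using upper_envelope_concave[OF \<Psi> W pos vert shift(1)[OF w(1)] shift(1)[OF w(2)] up[OF w(1)] up[OF w(2)] uv]
      by (auto simp: s_def y_def)
    obtain b where b: "b \<in> W" "Re b = s" "Im (\<Psi> b) < y"
    proof -
      define \<Psi>' where "\<Psi>' z = - \<Psi> (- z)" for z
      have neg: "z \<in> uminus ` W \<longleftrightarrow> - z \<in> W" for z by (auto simp: image_iff) (metis minus_minus)
      have hol: "\<Psi>' holomorphic_on uminus ` W"
        unfolding \<Psi>'_def
        by (intro holomorphic_intros holomorphic_on_compose_gen[OF _ \<Psi>(1), of uminus, unfolded o_def]) auto
      have d: "deriv \<Psi>' z = deriv \<Psi> (- z)" if "- z \<in> W" for z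
      proof (rule DERIV_imp_deriv)
        have "(\<Psi> has_field_derivative deriv \<Psi> (- z)) (at (- z))" by (rule holomorphic_derivI[OF \<Psi> that])
        moreover have "(uminus has_field_derivative - 1) (at z)" by (auto intro!: derivative_eq_intros)
        ultimately have "((\<lambda>z. \<Psi> (- z)) has_field_derivative deriv \<Psi> (- z) * - 1) (at z)"
          using DERIV_chain2[of \<Psi> "deriv \<Psi> (- z)" uminus z "-1" UNIV] by simp
        then show "(\<Psi>' has_field_derivative deriv \<Psi> (- z)) (at z)"
          unfolding \<Psi>'_def[abs_def] using DERIV_minus by fastforce
      qed
      have "\<exists>z\<in>uminus ` W. Re z = u * Re (- (w1 - \<i>)) + v * Re (- (w2 - \<i>)) \<and>
        Im (\<Psi>' z) > u * (- Im (\<Psi> w1)) + v * (- Im (\<Psi> w2))"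
      proof (rule upper_envelope_concave[OF hol])
        show "open (uminus ` W)" using \<Psi>(2) by (rule open_negations)
        show "convex (uminus ` W)" using W by (rule convex_negations)
        show "Re (deriv \<Psi>' z) > 0" if "z \<in> uminus ` W" for z using that pos by (auto simp: d)
        show "z + \<i> * of_real t \<in> uminus ` W" if "z \<in> uminus ` W" for z t
          using vert[of "- z" "- t"] that unfolding neg by simp
        show "- (w1 - \<i>) \<in> uminus ` W" "- (w2 - \<i>) \<in> uminus ` W" using shift(2) w by blast+
        show "- Im (\<Psi> w1) < Im (\<Psi>' (- (w1 - \<i>)))" "- Im (\<Psi> w2) < Im (\<Psi>' (- (w2 - \<i>)))"
          using down w by (simp_all add: \<Psi>'_def)
      qed (use uv in auto)
      then obtain z where "- z \<in> W" "Re (- z) = s" "Im (\<Psi> (- z)) < y"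
        unfolding neg Bex_def by (auto simp: s_def y_def \<Psi>'_def)
      then show ?thesis using that by blast
    qed
    have seg: "closed_segment b a \<subseteq> W" using W a b by (simp add: closed_segment_subset)
    have "connected ((\<lambda>z. Im (\<Psi> z)) ` closed_segment b a)"
      by (intro connected_continuous_image continuous_intros continuous_on_subset[OF cont seg]) simp
    then have "is_interval ((\<lambda>z. Im (\<Psi> z)) ` closed_segment b a)" by (simp add: is_interval_connected_1)
    moreover have "Im (\<Psi> b) \<in> (\<lambda>z. Im (\<Psi> z)) ` closed_segment b a" "Im (\<Psi> a) \<in> (\<lambda>z. Im (\<Psi> z)) ` closed_segment b a"
      by (auto intro!: imageI)
    ultimately have "y \<in> (\<lambda>z. Im (\<Psi> z)) ` closed_segment b a"
      using a(3) b(3) unfolding is_interval_1 by (meson less_imp_le)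
    then obtain z where z: "z \<in> closed_segment b a" "Im (\<Psi> z) = y" by auto
    obtain \<theta> where "z = (1 - \<theta>) *\<^sub>R b + \<theta> *\<^sub>R a" using z(1) unfolding in_segment by blast
    then have "Re z = (1 - \<theta>) * s + \<theta> * s" using a(2) b(2) by simp
    then have "Re z = s" by (simp add: algebra_simps)
    moreover have "z \<in> W" using z(1) seg by blast
    moreover have "u *\<^sub>R p + v *\<^sub>R q = Complex s y" by (simp add: w f_def s_def y_def complex_eq_iff)
    ultimately show "u *\<^sub>R p + v *\<^sub>R q \<in> f ` W" using z(2) by (auto simp: f_def image_iff intro!: bexI[of _ z])
  qed
qed

lemma harmonic_shear_convex:
  assumes X: "X holomorphic_on \<D>" "inj_on X \<D>" and \<Phi>: "\<Phi> holomorphic_on \<D>"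
    and vert: "\<And>z t. z \<in> \<D> \<Longrightarrow> X z + \<i> * of_real t \<in> X ` \<D>"
    and pos: "\<And>z. z \<in> \<D> \<Longrightarrow> Re (deriv \<Phi> z / deriv X z) > 0"
  defines "F \<equiv> \<lambda>z. Complex (Re (X z)) (Im (\<Phi> z))"
  shows "inj_on F \<D>" "open (F ` \<D>)" "convex (F ` \<D>)"
proof -
  define W where "W = X ` \<D>"
  obtain k where k: "k holomorphic_on W" "\<And>z. z \<in> \<D> \<Longrightarrow> deriv X z * deriv k (X z) = 1" "\<And>z. z \<in> \<D> \<Longrightarrow> k (X z) = z"
    using holomorphic_has_inverse[OF X(1) _ X(2)] unfolding W_def by (metis open_ball)
  have oW: "open W" unfolding W_def by (rule open_mapping_thm3[OF X(1) _ X(2)]) simp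
  have vertW: "w + \<i> * of_real t \<in> W" if "w \<in> W" for w t using that vert by (auto simp: W_def)
  have contX: "continuous_on \<D> X" by (rule holomorphic_on_imp_continuous_on[OF X(1)])
  have "connected ((\<lambda>z. Re (X z)) ` \<D>)" by (intro connected_continuous_image continuous_intros contX) auto
  then have int: "is_interval ((\<lambda>z. Re (X z)) ` \<D>)" by (simp add: is_interval_connected_1)
  have cW: "convex W"
  proof (rule convexI)
    fix p q and u v :: real
    assume pq: "p \<in> W" "q \<in> W" and uv: "0 \<le> u" "0 \<le> v" "u + v = 1"
    have "convex ((\<lambda>z. Re (X z)) ` \<D>)" using int by (simp add: is_interval_convex_1)
    moreover have "Re p \<in> (\<lambda>z. Re (X z)) ` \<D>" "Re q \<in> (\<lambda>z. Re (X z)) ` \<D>" using pq by (auto simp: W_def)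
    ultimately have "u *\<^sub>R Re p + v *\<^sub>R Re q \<in> (\<lambda>z. Re (X z)) ` \<D>" using uv by (rule convexD)
    then obtain z where z: "z \<in> \<D>" "Re (X z) = Re (u *\<^sub>R p + v *\<^sub>R q)" by auto
    then have "u *\<^sub>R p + v *\<^sub>R q = X z + \<i> * of_real (Im (u *\<^sub>R p + v *\<^sub>R q) - Im (X z))"
      by (simp add: complex_eq_iff)
    then show "u *\<^sub>R p + v *\<^sub>R q \<in> W" using vert[OF z(1)] unfolding W_def by metis
  qed
  define \<Psi> where "\<Psi> = \<Phi> \<circ> k"
  have kD: "k ` W \<subseteq> \<D>" using k(3) by (auto simp: W_def)
  have \<Psi>: "\<Psi> holomorphic_on W" unfolding \<Psi>_def by (rule holomorphic_on_compose_gen[OF k(1) \<Phi> kD])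
  have d\<Psi>: "Re (deriv \<Psi> w) > 0" if "w \<in> W" for w
  proof -
    from that obtain z where z: "z \<in> \<D>" "w = X z" unfolding W_def by blast
    have "deriv \<Psi> w = deriv \<Phi> (k w) * deriv k w"
      unfolding \<Psi>_def using z k(3)[OF z(1)] that
      by (intro deriv_chain holomorphic_on_imp_differentiable_at[OF k(1) oW] holomorphic_on_imp_differentiable_at[OF \<Phi>]) auto
    also have "\<dots> = deriv \<Phi> z / deriv X z"
    proof -
      have "deriv X z \<noteq> 0" using k(2)[OF z(1)] by auto
      then have "deriv k (X z) = 1 / deriv X z" using k(2)[OF z(1)] by (simp add: field_simps)
      then show ?thesis using z k(3) by simp
    qed
    finally show ?thesis using pos[OF z(1)] by simp
  qed
  note shear = vertical_shear_convex[OF \<Psi> oW cW d\<Psi> vertW]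
  have F: "F z = Complex (Re (X z)) (Im (\<Psi> (X z)))" if "z \<in> \<D>" for z
    using k(3)[OF that] by (simp add: F_def \<Psi>_def)
  have "F ` \<D> = (\<lambda>w. Complex (Re w) (Im (\<Psi> w))) ` W"
    unfolding W_def image_image using F by (intro image_cong) auto
  then show "open (F ` \<D>)" "convex (F ` \<D>)" using shear(2,3) by simp_all
  show "inj_on F \<D>"
  proof (rule inj_onI)
    fix a b assume ab: "a \<in> \<D>" "b \<in> \<D>" "F a = F b"
    then have "Complex (Re (X a)) (Im (\<Psi> (X a))) = Complex (Re (X b)) (Im (\<Psi> (X b)))"
      by (simp only: F[symmetric])
    moreover have "X a \<in> W" "X b \<in> W" using ab by (simp_all add: W_def)
    ultimately have "X a = X b" using inj_onD[OF shear(1), of "X a" "X b"] by blast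
    then show "a = b" using X(2) ab by (auto dest: inj_onD)
  qed
qed

section \<open>The strip and half-plane maps\<close>

text \<open>
  \<open>S\<close> is \<open>sinh (\<sigma> \<tau>) / \<sigma>\<close>, or \<open>\<tau>\<close> itself in the parabolic case \<open>\<sigma> = 0\<close>.  The complex parameter \<open>\<tau>\<close>
  allows differentiation in the complex sense; only real parameters matter later.
\<close>

lemma hyperbolic_solution:
  fixes \<sigma> :: real
  obtains S C :: "complex \<Rightarrow> complex" where
    "\<And>\<tau>. (S has_field_derivative C \<tau>) (at \<tau>)"
    "\<And>\<tau>. (C has_field_derivative of_real (\<sigma>\<^sup>2) * S \<tau>) (at \<tau>)"
    "S 0 = 0" "C 0 = 1"
    "\<And>t. \<exists>a b. S (of_real t) = of_real a \<and> C (of_real t) = of_real b \<and> b\<^sup>2 - \<sigma>\<^sup>2 * a\<^sup>2 = 1"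
proof (cases "\<sigma> = 0")
  case True
  show ?thesis
    by (rule that[of "\<lambda>\<tau>. \<tau>" "\<lambda>\<tau>. 1"])
      (auto simp: True intro!: derivative_eq_intros exI[of _ "_ :: real"] exI[of _ "1 :: real"])
next
  case False
  have sinh: "sinh (of_real x :: complex) = of_real (sinh x)" and cosh: "cosh (of_real x :: complex) = of_real (cosh x)" for x :: real
    by (simp_all add: sinh_field_def cosh_field_def exp_of_real[symmetric])
  show ?thesis
  proof (rule that[of "\<lambda>\<tau>. sinh (of_real \<sigma> * \<tau>) / of_real \<sigma>" "\<lambda>\<tau>. cosh (of_real \<sigma> * \<tau>)"])
    fix \<tau> :: complex and t :: real
    show "((\<lambda>\<tau>. sinh (of_real \<sigma> * \<tau>) / of_real \<sigma>) has_field_derivative cosh (of_real \<sigma> * \<tau>)) (at \<tau>)"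
      using False by (auto intro!: derivative_eq_intros)
    show "((\<lambda>\<tau>. cosh (of_real \<sigma> * \<tau>)) has_field_derivative of_real (\<sigma>\<^sup>2) * (sinh (of_real \<sigma> * \<tau>) / of_real \<sigma>)) (at \<tau>)"
      using False by (auto intro!: derivative_eq_intros simp: power2_eq_square)
    show "\<exists>a b. sinh (of_real \<sigma> * of_real t) / of_real \<sigma> = complex_of_real a \<and> cosh (of_real \<sigma> * of_real t) = complex_of_real b \<and> b\<^sup>2 - \<sigma>\<^sup>2 * a\<^sup>2 = 1"
    proof (intro exI conjI)
      show "sinh (of_real \<sigma> * of_real t) / of_real \<sigma> = complex_of_real (sinh (\<sigma> * t) / \<sigma>)"
        using sinh[of "\<sigma> * t"] by simp
      show "cosh (of_real \<sigma> * of_real t) = complex_of_real (cosh (\<sigma> * t))" using cosh[of "\<sigma> * t"] by simp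
      show "(cosh (\<sigma> * t))\<^sup>2 - \<sigma>\<^sup>2 * (sinh (\<sigma> * t) / \<sigma>)\<^sup>2 = 1"
        using False by (simp add: power_divide cosh_square_eq)
    qed
  qed simp_all
qed

lemma quadratic_factors:
  "1 - 2 * of_real (cos \<nu>) * z + z\<^sup>2 = (1 - z * cis \<nu>) * (1 - z * cis (- \<nu>))"
proof -
  have "cis \<nu> + cis (- \<nu>) = 2 * of_real (cos \<nu>)" "cis \<nu> * cis (- \<nu>) = 1"
    by (simp_all add: complex_eq_iff cis_mult)
  then show ?thesis by (simp add: power2_eq_square algebra_simps) (metis distrib_left)
qed

lemma quadratic_nonzero:
  assumes "z \<in> \<D>"
  shows "1 - 2 * of_real (cos \<nu>) * z + z\<^sup>2 \<noteq> 0"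
proof -
  have "z * cis \<theta> \<noteq> 1" for \<theta>
  proof
    assume "z * cis \<theta> = 1"
    then have "norm (z * cis \<theta>) = 1" by simp
    then show False using assms by (simp add: norm_mult)
  qed
  then show ?thesis unfolding quadratic_factors by simp
qed

text \<open>
  The vector field \<open>\<i> / X'\<close> is \<open>\<i> (1 - 2 z cos \<nu> + z\<^sup>2)\<close>, which is tangent to the unit circle.  Its flow consists of
  Moebius automorphisms of the disc, and along a flow line \<open>X\<close> moves straight up with unit speed.
\<close>

lemma strip_map_range_vertical_invariant:
  assumes X: "\<And>z. z \<in> \<D> \<Longrightarrow> (X has_field_derivative 1 / (1 - 2 * of_real (cos \<nu>) * z + z\<^sup>2)) (at z)"
    and z: "z \<in> \<D>"
  shows "X z + \<i> * of_real t \<in> X ` \<D>"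
proof -
  define c where "c = complex_of_real (cos \<nu>)"
  obtain S C :: "complex \<Rightarrow> complex" where
    SC: "\<And>\<tau>. (S has_field_derivative C \<tau>) (at \<tau>)"
      "\<And>\<tau>. (C has_field_derivative of_real ((sin \<nu>)\<^sup>2) * S \<tau>) (at \<tau>)" "S 0 = 0" "C 0 = 1"
    and SC_real: "\<And>t. \<exists>a b. S (of_real t) = of_real a \<and> C (of_real t) = of_real b \<and> b\<^sup>2 - (sin \<nu>)\<^sup>2 * a\<^sup>2 = 1"
    using hyperbolic_solution[of "sin \<nu>"] by blast
  have sin_c: "of_real ((sin \<nu>)\<^sup>2) = 1 - c\<^sup>2"
    by (simp add: c_def sin_squared_eq)
  \<comment> \<open>\<open>(N, M)\<close> is the vector \<open>(z, 1)\<close> moved by the one-parameter group whose generator has the rows \<open>(- \<i> c, \<i>)\<close> and \<open>(- \<i>, \<i> c)\<close>\<close>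
  define N where "N \<tau> = (C \<tau> - \<i> * c * S \<tau>) * z + \<i> * S \<tau>" for \<tau>
  define M where "M \<tau> = - \<i> * S \<tau> * z + C \<tau> + \<i> * c * S \<tau>" for \<tau>
  have dN: "(N has_field_derivative - \<i> * c * N \<tau> + \<i> * M \<tau>) (at \<tau>)"
    and dM: "(M has_field_derivative - \<i> * N \<tau> + \<i> * c * M \<tau>) (at \<tau>)" for \<tau>
    unfolding N_def[abs_def] M_def[abs_def]
    by (auto intro!: derivative_eq_intros SC simp del: of_real_power simp: sin_c)
      (simp_all add: algebra_simps power2_eq_square)
  have disc: "norm (N (of_real t)) < norm (M (of_real t))" for t
  proof -
    obtain a b where ab: "S (of_real t) = of_real a" "C (of_real t) = of_real b" "b\<^sup>2 - (sin \<nu>)\<^sup>2 * a\<^sup>2 = 1"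
      using SC_real by blast
    have id: "(norm (M (of_real t)))\<^sup>2 - (norm (N (of_real t)))\<^sup>2 = (b\<^sup>2 - (sin \<nu>)\<^sup>2 * a\<^sup>2) * (1 - (norm z)\<^sup>2)"
      unfolding N_def M_def ab c_def sin_squared_eq cmod_power2
      by (simp add: power2_eq_square algebra_simps)
    have "(norm z)\<^sup>2 < 1" using z by (simp add: power_less_one_iff)
    then have "(norm (N (of_real t)))\<^sup>2 < (norm (M (of_real t)))\<^sup>2" using id ab(3) by simp
    then show ?thesis by (rule power2_less_imp_less) simp
  qed
  have M0: "M (of_real t) \<noteq> 0" for t using disc[of t] by auto
  define \<gamma> where "\<gamma> \<tau> = N \<tau> / M \<tau>" for \<tau>
  have \<gamma>_disc: "\<gamma> (of_real t) \<in> \<D>" for t using disc[of t] M0[of t] by (simp add: \<gamma>_def norm_divide)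
  have d\<gamma>: "(\<gamma> has_field_derivative \<i> * (1 - 2 * c * \<gamma> (of_real t) + (\<gamma> (of_real t))\<^sup>2)) (at (of_real t))" for t
    unfolding \<gamma>_def[abs_def]
    using M0[of t]
    by (auto intro!: derivative_eq_intros dN dM simp: field_simps power2_eq_square)
  have flow: "((\<lambda>t. X (\<gamma> (of_real t)) - \<i> * of_real t) has_vector_derivative 0) (at t)" for t
  proof -
    have "((\<lambda>\<tau>. X (\<gamma> \<tau>)) has_field_derivative 1 / (1 - 2 * c * \<gamma> (of_real t) + (\<gamma> (of_real t))\<^sup>2) * (\<i> * (1 - 2 * c * \<gamma> (of_real t) + (\<gamma> (of_real t))\<^sup>2))) (at (of_real t))"
      by (rule DERIV_chain2[OF X[OF \<gamma>_disc, folded c_def] d\<gamma>])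
    then have "((\<lambda>\<tau>. X (\<gamma> \<tau>)) has_field_derivative \<i>) (at (of_real t))"
      using quadratic_nonzero[OF \<gamma>_disc[of t], of \<nu>] unfolding c_def by simp
    then have "((\<lambda>\<tau>. X (\<gamma> \<tau>) - \<i> * \<tau>) has_field_derivative \<i> - \<i> * 1) (at (of_real t))"
      by (intro DERIV_diff DERIV_cmult DERIV_ident)
    then show ?thesis using has_vector_derivative_real_field by fastforce
  qed
  obtain k where k: "\<And>t. X (\<gamma> (of_real t)) - \<i> * of_real t = k"
    using has_vector_derivative_zero_constant[of UNIV "\<lambda>t. X (\<gamma> (of_real t)) - \<i> * of_real t"] flow by auto
  have "\<gamma> (of_real 0) = z" by (simp add: \<gamma>_def N_def M_def SC)
  then have "X z = k" using k[of 0] by simp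
  then have "X z + \<i> * of_real t = X (\<gamma> (of_real t))" using k[of t] by (simp add: algebra_simps)
  then show ?thesis using \<gamma>_disc by blast
qed

text \<open>
  If \<open>sin \<nu> = 0\<close> then \<open>X\<close> is, up to an additive constant, a Moebius transformation; otherwise
  \<open>exp (2 \<i> sin \<nu> X)\<close> is one up to a constant factor.
\<close>

lemma strip_map_inj:
  assumes X: "\<And>z. z \<in> \<D> \<Longrightarrow> (X has_field_derivative 1 / (1 - 2 * of_real (cos \<nu>) * z + z\<^sup>2)) (at z)"
  shows "inj_on X \<D>"
proof -
  define a b where "a = cis (- \<nu>)" and "b = cis \<nu>"
  have q: "1 - 2 * of_real (cos \<nu>) * z + z\<^sup>2 = (1 - z * b) * (1 - z * a)" for z
    unfolding a_def b_def by (rule quadratic_factors)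
  have nz: "1 - z * a \<noteq> 0" "1 - z * b \<noteq> 0" if "z \<in> \<D>" for z
    using quadratic_nonzero[OF that, of \<nu>] unfolding q by auto
  have X': "(X has_field_derivative 1 / ((1 - z * b) * (1 - z * a))) (at z within \<D>)" if "z \<in> \<D>" for z
    using X[OF that] unfolding q by (rule has_field_derivative_at_within)
  show ?thesis
  proof (cases "a = b")
    case True
    have d: "((\<lambda>z. X z - z / (1 - z * b)) has_field_derivative 0) (at z within \<D>)" if "z \<in> \<D>" for z
      using nz[OF that] X'[OF that] True
      by (auto intro!: derivative_eq_intros simp: field_simps power2_eq_square)
    obtain k where k: "\<And>z. z \<in> \<D> \<Longrightarrow> X z - z / (1 - z * b) = k"
      using has_field_derivative_zero_constant[OF convex_ball d] by blast
    show ?thesis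
    proof (rule inj_onI)
      fix z w assume zw: "z \<in> \<D>" "w \<in> \<D>" "X z = X w"
      then have "z / (1 - z * b) = w / (1 - w * b)" using k[of z] k[of w] by (simp add: algebra_simps)
      then show "z = w" using nz(2)[OF zw(1)] nz(2)[OF zw(2)] by (simp add: field_simps)
    qed
  next
    case False
    define E where "E z = (1 - z * a) / (1 - z * b)" for z
    have dE: "(E has_field_derivative (b - a) / (1 - z * b)\<^sup>2) (at z within \<D>)" if "z \<in> \<D>" for z
      unfolding E_def[abs_def] using nz[OF that]
      by (auto intro!: derivative_eq_intros simp: field_simps power2_eq_square)
    have d: "((\<lambda>z. E z * exp (- (b - a) * X z)) has_field_derivative 0) (at z within \<D>)" if "z \<in> \<D>" for z
    proof -
      have "((\<lambda>z. E z * exp (- (b - a) * X z)) has_field_derivative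
        (b - a) / (1 - z * b)\<^sup>2 * exp (- (b - a) * X z) + exp (- (b - a) * X z) * (- (b - a) * (1 / ((1 - z * b) * (1 - z * a)))) * E z) (at z within \<D>)"
        by (rule DERIV_mult[OF dE[OF that] DERIV_chain2[OF DERIV_exp DERIV_cmult[OF X'[OF that]]]])
      moreover have "(b - a) / (1 - z * b)\<^sup>2 * exp (- (b - a) * X z) + exp (- (b - a) * X z) * (- (b - a) * (1 / ((1 - z * b) * (1 - z * a)))) * E z = 0"
      proof -
        have "d / p\<^sup>2 * e + e * (- d * (1 / (p * q))) * (q / p) = 0" if "p \<noteq> 0" "q \<noteq> 0" for d p q e :: complex
          using that by (simp add: field_simps power2_eq_square)
        from this[OF nz(2,1)[OF that]] show ?thesis unfolding E_def .
      qed
      ultimately show ?thesis by simp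
    qed
    obtain k where k: "\<And>z. z \<in> \<D> \<Longrightarrow> E z * exp (- (b - a) * X z) = k"
      using has_field_derivative_zero_constant[OF convex_ball d] by blast
    show ?thesis
    proof (rule inj_onI)
      fix z w assume zw: "z \<in> \<D>" "w \<in> \<D>" "X z = X w"
      then have "E z = E w" using k[of z] k[of w] by (metis exp_not_eq_zero mult_right_cancel)
      then have "(1 - z * a) * (1 - w * b) = (1 - w * a) * (1 - z * b)"
        using nz(2)[OF zw(1)] nz(2)[OF zw(2)] by (simp add: E_def divide_simps)
      then have "(z - w) * (b - a) = 0" by (simp add: algebra_simps)
      then show "z = w" using False by simp
    qed
  qed
qed

section \<open>Convex functions on circles\<close>

text \<open>
  The convex combination stays in the convex image of \<open>\<phi>\<close>, so it can be pulled back through \<open>\<phi>\<close>.  The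
  pull-back fixes \<open>0\<close>, hence the Schwarz lemma applies to it.
\<close>

lemma convex_combination_subordination:
  assumes "\<phi> \<in> \<K>" and b: "norm b \<le> 1" and t: "0 \<le> t" "t \<le> 1"
  obtains g where "g holomorphic_on \<D>" "g 0 = 0" "\<And>z. z \<in> \<D> \<Longrightarrow> norm (g z) < 1"
    "\<And>z. z \<in> \<D> \<Longrightarrow> \<phi> (g z) = of_real (1 - t) * \<phi> (b * z) + of_real t * \<phi> z"
proof -
  from assms have hol: "\<phi> holomorphic_on \<D>" and inj: "inj_on \<phi> \<D>" and 0: "\<phi> 0 = 0"
    and cvx: "convex (\<phi> ` \<D>)" by (auto simp: class_K_def)
  obtain k where k: "k holomorphic_on (\<phi> ` \<D>)" "\<And>z. z \<in> \<D> \<Longrightarrow> k (\<phi> z) = z"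
    using holomorphic_has_inverse[OF hol _ inj] by (metis open_ball)
  define F where "F z = of_real (1 - t) * \<phi> (b * z) + of_real t * \<phi> z" for z
  have bz: "b * z \<in> \<D>" if "z \<in> \<D>" for z
  proof -
    have "norm b * norm z \<le> 1 * norm z" by (rule mult_right_mono) (use b in auto)
    then show ?thesis using that by (simp add: norm_mult)
  qed
  have F_in: "F z \<in> \<phi> ` \<D>" if "z \<in> \<D>" for z
    using convexD[OF cvx, of "\<phi> (b * z)" "\<phi> z" "1 - t" t] that bz[OF that] t
    by (simp add: F_def scaleR_conv_of_real)
  have F_hol: "F holomorphic_on \<D>"
    unfolding F_def
    by (intro holomorphic_intros hol holomorphic_on_compose_gen[OF _ hol, unfolded o_def])
      (use bz in auto)
  have kin: "k w \<in> \<D>" "\<phi> (k w) = w" if "w \<in> \<phi> ` \<D>" for w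
    using that k(2) by auto
  show ?thesis
  proof (rule that)
    show "(k \<circ> F) holomorphic_on \<D>"
      by (rule holomorphic_on_compose_gen[OF F_hol k(1)]) (use F_in in auto)
    show "(k \<circ> F) 0 = 0" using k(2)[of 0] 0 by (simp add: F_def)
    show "norm ((k \<circ> F) z) < 1" if "z \<in> \<D>" for z
      using kin(1)[OF F_in[OF that]] by simp
    show "\<phi> ((k \<circ> F) z) = of_real (1 - t) * \<phi> (b * z) + of_real t * \<phi> z" if "z \<in> \<D>" for z
      using kin(2)[OF F_in[OF that]] by (simp add: F_def)
  qed
qed

text \<open>
  Study's theorem.  Of two points the one of smaller modulus can be written as \<open>b\<close> times the other with
  \<open>\<bar>b\<bar> \<le> 1\<close>, and the Schwarz lemma bounds the preimage of a convex combination of their images by the larger modulus.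
\<close>

lemma convex_image_smaller_disc:
  assumes \<phi>: "\<phi> \<in> \<K>" and r: "r \<le> 1"
  shows "convex (\<phi> ` ball 0 r)"
proof (rule convexI)
  fix p q and u v :: real
  assume p: "p \<in> \<phi> ` ball 0 r" and q: "q \<in> \<phi> ` ball 0 r" and uv: "0 \<le> u" "0 \<le> v" "u + v = 1"
  have main: "of_real (1 - t) * \<phi> w1 + of_real t * \<phi> w2 \<in> \<phi> ` ball 0 r"
    if w: "w1 \<in> ball 0 r" "w2 \<in> ball 0 r" "norm w1 \<le> norm w2" and t: "0 \<le> t" "t \<le> 1" for w1 w2 t
  proof (cases "w2 = 0")
    case True
    then have "of_real (1 - t) * \<phi> w1 + of_real t * \<phi> w2 = \<phi> 0"
      using w(3) \<phi> by (simp add: class_K_def)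
    then show ?thesis using True w(2) by auto
  next
    case False
    have "norm (w1 / w2) \<le> 1" using w(3) False by (simp add: norm_divide)
    then obtain g where g: "g holomorphic_on \<D>" "g 0 = 0" "\<And>z. z \<in> \<D> \<Longrightarrow> norm (g z) < 1"
      "\<And>z. z \<in> \<D> \<Longrightarrow> \<phi> (g z) = of_real (1 - t) * \<phi> (w1 / w2 * z) + of_real t * \<phi> z"
      using convex_combination_subordination[OF \<phi> _ t] by metis
    have w2: "w2 \<in> \<D>" using w(2) r by simp
    have "norm (g w2) \<le> norm w2"
      using Schwarz_Lemma(1)[OF g(1,2)] g(3) w2 by simp
    then have "g w2 \<in> ball 0 r" using w(2) by simp
    moreover have "\<phi> (g w2) = of_real (1 - t) * \<phi> w1 + of_real t * \<phi> w2"
      using g(4)[OF w2] False by simp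
    ultimately show ?thesis by (metis imageI)
  qed
  from p q obtain w1 w2 where w: "p = \<phi> w1" "q = \<phi> w2" "w1 \<in> ball 0 r" "w2 \<in> ball 0 r" by auto
  have u: "u = 1 - v" "v = 1 - u" using uv by auto
  show "u *\<^sub>R p + v *\<^sub>R q \<in> \<phi> ` ball 0 r"
  proof (cases "norm w1 \<le> norm w2")
    case True
    then show ?thesis using main[OF w(3,4) True, of v] uv w(1,2) u(1)
      by (simp add: scaleR_conv_of_real)
  next
    case False
    then show ?thesis using main[OF w(4,3), of u] uv w(1,2) u(2)
      by (simp add: scaleR_conv_of_real add.commute)
  qed
qed

text \<open>
  Equality in the Schwarz lemma would make the pull-back a rotation \<open>z \<mapsto> c z\<close>.  Comparing derivatives
  at \<open>0\<close> then writes the unimodular number \<open>c\<close> as a proper convex combination of two different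
  unimodular numbers, against the strict convexity of the disc.
\<close>

lemma circle_image_not_between:
  assumes \<phi>: "\<phi> \<in> \<K>" and t: "0 < t" "t < 1"
    and n: "norm w1 = r" "norm w2 = r" "norm w3 = r" "r < 1" and ne: "w1 \<noteq> w3"
  shows "\<phi> w2 \<noteq> of_real (1 - t) * \<phi> w1 + of_real t * \<phi> w3"
proof
  assume eq: "\<phi> w2 = of_real (1 - t) * \<phi> w1 + of_real t * \<phi> w3"
  have w3: "w3 \<noteq> 0" "w3 \<in> \<D>" using n ne by auto
  define b where "b = w1 / w3"
  have b: "norm b = 1" "b \<noteq> 1" using n ne w3 by (auto simp: b_def norm_divide)
  have K: "\<phi> holomorphic_on \<D>" "inj_on \<phi> \<D>" "\<phi> 0 = 0" "deriv \<phi> 0 = 1" using \<phi> by (auto simp: class_K_def)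
  obtain g where g: "g holomorphic_on \<D>" "g 0 = 0" "\<And>z. z \<in> \<D> \<Longrightarrow> norm (g z) < 1"
    "\<And>z. z \<in> \<D> \<Longrightarrow> \<phi> (g z) = of_real (1 - t) * \<phi> (b * z) + of_real t * \<phi> z"
    using convex_combination_subordination[OF \<phi>, of b t] b t by (metis less_imp_le order_refl)
  have "\<phi> (g w3) = \<phi> w2" using g(4)[OF w3(2)] eq w3 by (simp add: b_def)
  then have "g w3 = w2"
    using K(2) g(3)[OF w3(2)] n w3 by (auto simp: inj_on_def)
  then have "\<exists>\<alpha>. (\<forall>z. norm z < 1 \<longrightarrow> g z = \<alpha> * z) \<and> norm \<alpha> = 1"
    using g(3) n w3 by (intro Schwarz_Lemma(3)[OF g(1,2), of 0] disjI1 exI[of _ w3]) auto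
  then obtain c where c: "\<And>z. norm z < 1 \<Longrightarrow> g z = c * z" "norm c = 1" by auto
  have d: "((\<lambda>z. \<phi> (a * z)) has_field_derivative a) (at 0)" for a
  proof -
    have "(\<phi> has_field_derivative 1) (at (a * 0))"
      using holomorphic_derivI[OF K(1), of 0] K(4) by simp
    moreover have "((\<lambda>z. a * z) has_field_derivative a) (at 0)"
      by (auto intro!: derivative_eq_intros)
    ultimately show ?thesis
      using DERIV_chain2[of \<phi> 1 "\<lambda>z. a * z" 0 a UNIV] by simp
  qed
  have "((\<lambda>z. of_real (1 - t) * \<phi> (b * z) + of_real t * \<phi> (1 * z)) has_field_derivative
      of_real (1 - t) * b + of_real t * 1) (at 0)"
    by (rule DERIV_add[OF DERIV_cmult[OF d] DERIV_cmult[OF d]])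
  moreover have "((\<lambda>z. of_real (1 - t) * \<phi> (b * z) + of_real t * \<phi> (1 * z)) has_field_derivative c) (at 0)"
    by (rule has_field_derivative_transform_within_open[OF d[of c], of \<D>]) (use g(4) c(1) in auto)
  ultimately have cb: "c = of_real (1 - t) * b + of_real t" using DERIV_unique by force
  have "norm (of_real (1 - t) * b + of_real t) < 1"
  proof -
    have "of_real (1 - t) * b + of_real t \<in> open_segment b 1"
      using b t by (auto simp: in_segment scaleR_conv_of_real)
    then have "norm ((1 - t) *\<^sub>R b + t *\<^sub>R 1) < 1"
      using dist_decreases_open_segment[of _ b 1 0] b by (fastforce simp: scaleR_conv_of_real)
    then show ?thesis by (simp add: scaleR_conv_of_real)
  qed
  then show False using cb c(2) by simp
qed

text \<open>
  Lines are given as level sets of \<open>Re (d * _)\<close>, since that is how they arise below; of three points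
  on a line one lies between the two others.
\<close>

lemma circle_image_no_three_on_line:
  assumes \<phi>: "\<phi> \<in> \<K>" and d: "d \<noteq> 0" and n: "norm w1 = r" "norm w2 = r" "norm w3 = r" "r < 1"
    and ne: "w1 \<noteq> w2" "w1 \<noteq> w3" "w2 \<noteq> w3"
    and eq: "Re (d * \<phi> w1) = Re (d * \<phi> w2)" "Re (d * \<phi> w2) = Re (d * \<phi> w3)"
  shows False
proof -
  have inj: "inj_on \<phi> \<D>" using \<phi> by (simp add: class_K_def)
  have combine: "B = of_real (1 - t) * A + of_real t * C"
    if "Re A = Re B" "Re B = Re C" "Im B = (1 - t) * Im A + t * Im C" for A B C :: complex and t
    using that by (simp add: complex_eq_iff algebra_simps)
  have between: False
    if "norm a = r" "norm b = r" "norm c = r" "a \<noteq> c"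
      and e: "Re (d * \<phi> a) = Re (d * \<phi> b)" "Re (d * \<phi> b) = Re (d * \<phi> c)"
      and o: "Im (d * \<phi> a) < Im (d * \<phi> b)" "Im (d * \<phi> b) < Im (d * \<phi> c)" for a b c
  proof -
    define t where "t = (Im (d * \<phi> b) - Im (d * \<phi> a)) / (Im (d * \<phi> c) - Im (d * \<phi> a))"
    have t: "0 < t" "t < 1" using o by (auto simp: t_def)
    have "Im (d * \<phi> b) = (1 - t) * Im (d * \<phi> a) + t * Im (d * \<phi> c)"
    proof -
      have "t * (Im (d * \<phi> c) - Im (d * \<phi> a)) = Im (d * \<phi> b) - Im (d * \<phi> a)"
        using o by (simp add: t_def)
      then show ?thesis by (simp add: algebra_simps)
    qed
    then have "d * \<phi> b = of_real (1 - t) * (d * \<phi> a) + of_real t * (d * \<phi> c)"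
      using combine e by metis
    then have "d * \<phi> b = d * (of_real (1 - t) * \<phi> a + of_real t * \<phi> c)"
      by (simp add: algebra_simps)
    then have "\<phi> b = of_real (1 - t) * \<phi> a + of_real t * \<phi> c" using d by simp
    then show False using circle_image_not_between[OF \<phi> t] that n by metis
  qed
  have neq: "Im (d * \<phi> a) \<noteq> Im (d * \<phi> b)"
    if "norm a = r" "norm b = r" "a \<noteq> b" "Re (d * \<phi> a) = Re (d * \<phi> b)" for a b
  proof
    assume "Im (d * \<phi> a) = Im (d * \<phi> b)"
    then have "d * \<phi> a = d * \<phi> b" using that by (intro complex_eqI)
    then show False using d that n inj by (auto simp: inj_on_def)
  qed
  have "Im (d * \<phi> w1) \<noteq> Im (d * \<phi> w2)" "Im (d * \<phi> w1) \<noteq> Im (d * \<phi> w3)" "Im (d * \<phi> w2) \<noteq> Im (d * \<phi> w3)"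
    using neq[OF n(1,2) ne(1) eq(1)] neq[OF n(1,3) ne(2)] neq[OF n(2,3) ne(3) eq(2)] eq by simp_all
  then show False using between n ne eq by (metis linorder_less_linear)
qed

section \<open>Convolution as a bounded functional\<close>

lemma Re_of_real_times: "Re (of_real a * z) = a * Re z"
  by simp

abbreviation taylor :: "(complex \<Rightarrow> complex) \<Rightarrow> nat \<Rightarrow> complex" where
  "taylor f n \<equiv> fps_nth (fps_expansion f 0) n"

lemma has_taylor_expansion:
  assumes "f holomorphic_on \<D>"
  shows "f has_fps_expansion fps_expansion f 0"
  using assms by (intro has_fps_expansion_fps_expansion[of \<D>]) auto

lemma taylor_sums:
  assumes "f holomorphic_on ball 0 R" "norm z < R"
  shows "(\<lambda>n. taylor f n * z ^ n) sums f z"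
proof -
  have "R > 0" using assms(2) norm_ge_zero[of z] by linarith
  then have "f has_fps_expansion fps_expansion f 0"
    using assms(1) by (intro has_fps_expansion_fps_expansion[of "ball 0 R"]) auto
  from has_fps_expansion_imp_sums_complex[OF this, of "ereal R" z] show ?thesis using assms by simp
qed

lemma taylor_norm_summable:
  fixes z :: complex
  assumes "f holomorphic_on ball 0 R" "norm z < R"
  shows "summable (\<lambda>n. norm (taylor f n) * norm z ^ n)"
proof -
  obtain r where r: "norm z < r" "r < R" using dense assms(2) by blast
  have "summable (\<lambda>n. taylor f n * of_real r ^ n)"
    using taylor_sums[OF assms(1), of "of_real r"] r norm_ge_zero[of z] by (auto simp: sums_iff)
  from powser_insidea[OF this, of z] show ?thesis
    using r norm_ge_zero[of z] by (simp add: norm_mult norm_power)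
qed

lemma taylor_cong:
  assumes "\<And>z. z \<in> \<D> \<Longrightarrow> f z = g z"
  shows "taylor f n = taylor g n"
proof -
  have "fps_expansion f 0 = fps_expansion g 0"
    by (rule fps_expansion_cong) (use assms in \<open>auto simp: eventually_nhds intro!: exI[of _ \<D>]\<close>)
  then show ?thesis by simp
qed

lemma taylor_eqI:
  assumes "\<And>z. z \<in> \<D> \<Longrightarrow> (\<lambda>n. c n * z ^ n) sums f z"
  shows "taylor f n = c n"
proof -
  have "f has_fps_expansion Abs_fps c"
    by (rule has_fps_expansionI) (use assms in \<open>auto simp: eventually_nhds intro!: exI[of _ \<D>]\<close>)
  then show ?thesis by (simp add: fps_expansion_eqI)
qed

lemma taylor_eq_imp_holomorphic:
  assumes "\<And>z. z \<in> \<D> \<Longrightarrow> (\<lambda>n. c n * z ^ n) sums f z"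
  shows "f holomorphic_on \<D>"
  using power_series_holomorphic[of 0 1 c f] assms by simp

lemma taylor_add:
  assumes "f holomorphic_on \<D>" "g holomorphic_on \<D>"
  shows "taylor (\<lambda>z. f z + g z) n = taylor f n + taylor g n"
  using fps_expansion_eqI[OF has_fps_expansion_add[OF assms[THEN has_taylor_expansion]]] by simp

lemma taylor_diff:
  assumes "f holomorphic_on \<D>" "g holomorphic_on \<D>"
  shows "taylor (\<lambda>z. f z - g z) n = taylor f n - taylor g n"
  using fps_expansion_eqI[OF has_fps_expansion_diff[OF assms[THEN has_taylor_expansion]]] by simp

lemma taylor_cmult:
  assumes "f holomorphic_on \<D>"
  shows "taylor (\<lambda>z. c * f z) n = c * taylor f n"
  using fps_expansion_eqI[OF has_fps_expansion_cmult_left[OF has_taylor_expansion[OF assms]]] by simp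

lemma taylor_bound:
  assumes "f holomorphic_on \<D>" "0 < s" "s < 1" "\<And>w. norm w = s \<Longrightarrow> norm (f w) \<le> B"
  shows "norm (taylor f n) \<le> B / s ^ n"
proof -
  have "norm ((deriv ^^ n) f 0) \<le> fact n * B / s ^ n"
  proof (rule Cauchy_inequality)
    show "f holomorphic_on ball 0 s" using assms by (auto intro: holomorphic_on_subset)
    show "continuous_on (cball 0 s) f"
      using assms by (intro holomorphic_on_imp_continuous_on holomorphic_on_subset[OF assms(1)]) auto
  qed (use assms in auto)
  then have "norm ((deriv ^^ n) f 0) / fact n \<le> (fact n * B / s ^ n) / fact n"
    by (rule divide_right_mono) simp
  then show ?thesis by (simp add: fps_expansion_def norm_divide)
qed

lemma holomorphic_bounded_on_circle:
  assumes "f holomorphic_on \<D>" "s < 1"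
  obtains B where "\<And>w. norm w = s \<Longrightarrow> norm (f w) \<le> B"
proof -
  have "continuous_on (sphere 0 s) f"
    using assms by (intro holomorphic_on_imp_continuous_on holomorphic_on_subset[OF assms(1)]) auto
  then have "bounded (f ` sphere 0 s)"
    by (intro compact_imp_bounded compact_continuous_image) auto
  then show ?thesis using that by (auto simp: bounded_iff) (metis dist_0_norm mem_sphere)
qed

lemma conv_norm_summable:
  assumes "\<phi> holomorphic_on \<D>" "f holomorphic_on \<D>" "norm z < 1"
  shows "summable (\<lambda>n. norm (taylor \<phi> n * taylor f n * z ^ n))"
proof -
  obtain s where s: "norm z < s" "s < 1" using dense assms(3) by blast
  then have s0: "s > 0" using norm_ge_zero[of z] by linarith
  obtain B where B: "\<And>w. norm w = s \<Longrightarrow> norm (f w) \<le> B"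
    using holomorphic_bounded_on_circle[OF assms(2) s(2)] by metis
  have sm: "summable (\<lambda>n. norm (taylor \<phi> n) * norm (z / of_real s) ^ n * B)"
    using s s0 by (intro summable_mult2 taylor_norm_summable[where R = 1] assms) (simp add: norm_divide)
  show ?thesis
  proof (rule summable_comparison_test'[OF sm])
    fix n assume "n \<ge> (0::nat)"
    have "norm (taylor f n) * norm z ^ n \<le> (B / s ^ n) * norm z ^ n"
      by (intro mult_right_mono taylor_bound assms s0 s B) auto
    then have "norm (taylor \<phi> n) * (norm (taylor f n) * norm z ^ n)
        \<le> norm (taylor \<phi> n) * ((B / s ^ n) * norm z ^ n)"
      by (rule mult_left_mono) simp
    then show "norm (norm (taylor \<phi> n * taylor f n * z ^ n)) \<le> norm (taylor \<phi> n) * norm (z / of_real s) ^ n * B"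
      using s0 by (simp add: norm_mult norm_power norm_divide power_divide mult_ac)
  qed
qed

lemma conv_sums:
  assumes "\<phi> holomorphic_on \<D>" "f holomorphic_on \<D>" "norm z < 1"
  shows "(\<lambda>n. taylor \<phi> n * taylor f n * z ^ n) sums (\<phi> \<star> f) z"
  unfolding conv_def
  by (rule summable_sums, rule summable_norm_cancel, rule conv_norm_summable) fact+

lemma taylor_conv:
  assumes "\<phi> holomorphic_on \<D>" "f holomorphic_on \<D>"
  shows "taylor (\<phi> \<star> f) n = taylor \<phi> n * taylor f n"
  using conv_sums[OF assms] by (intro taylor_eqI) auto

lemma holomorphic_conv [holomorphic_intros]:
  assumes "\<phi> holomorphic_on \<D>" "f holomorphic_on \<D>"
  shows "(\<phi> \<star> f) holomorphic_on \<D>"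
  using conv_sums[OF assms] by (intro taylor_eq_imp_holomorphic) auto

lemma conv_commute: "(\<phi> \<star> f) = (f \<star> \<phi>)"
  by (simp add: conv_def fun_eq_iff mult_ac)

lemma conv_cong:
  assumes "\<And>z. z \<in> \<D> \<Longrightarrow> f z = g z"
  shows "(\<phi> \<star> f) = (\<phi> \<star> g)"
proof -
  have "taylor f = taylor g" using taylor_cong[of f g] assms by blast
  then show ?thesis unfolding conv_def by metis
qed

text \<open>
  By the Cauchy estimates for the coefficients of \<open>f\<close>.  Evaluation of a convolution at \<open>z\<close> is thus
  continuous for uniform convergence on a single circle, which replaces the usual integral
  representation of the convolution.
\<close>

lemma conv_bounded_functional:
  assumes \<phi>: "\<phi> holomorphic_on \<D>" and s: "norm z < s" "s < 1"
  obtains C where "C \<ge> 0" "\<And>f B. f holomorphic_on \<D> \<Longrightarrow> (\<And>w. norm w = s \<Longrightarrow> norm (f w) \<le> B)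
    \<Longrightarrow> norm ((\<phi> \<star> f) z) \<le> C * B"
proof
  have s0: "s > 0" using s norm_ge_zero[of z] by linarith
  let ?C = "\<Sum>n. norm (taylor \<phi> n) * norm (z / of_real s) ^ n"
  have sm: "summable (\<lambda>n. norm (taylor \<phi> n) * norm (z / of_real s) ^ n)"
    using s s0 by (intro taylor_norm_summable[where R = 1] assms) (simp add: norm_divide)
  show "?C \<ge> 0" by (rule suminf_nonneg[OF sm]) simp
  fix f B assume f: "f holomorphic_on \<D>" "\<And>w. norm w = s \<Longrightarrow> norm (f w) \<le> B"
  have z: "norm z < 1" using s by simp
  have "norm ((\<phi> \<star> f) z) \<le> (\<Sum>n. norm (taylor \<phi> n * taylor f n * z ^ n))"
    unfolding conv_def by (rule summable_norm[OF conv_norm_summable[OF \<phi> f(1) z]])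
  also have "\<dots> \<le> (\<Sum>n. norm (taylor \<phi> n) * norm (z / of_real s) ^ n * B)"
  proof (intro suminf_le conv_norm_summable \<phi> f(1) z summable_mult2 sm)
    fix n
    have "norm (taylor f n) * norm z ^ n \<le> (B / s ^ n) * norm z ^ n"
      by (intro mult_right_mono taylor_bound f s0 s) auto
    then have "norm (taylor \<phi> n) * (norm (taylor f n) * norm z ^ n)
        \<le> norm (taylor \<phi> n) * ((B / s ^ n) * norm z ^ n)"
      by (rule mult_left_mono) simp
    then show "norm (taylor \<phi> n * taylor f n * z ^ n) \<le> norm (taylor \<phi> n) * norm (z / of_real s) ^ n * B"
      using s0 by (simp add: norm_mult norm_power norm_divide power_divide mult_ac)
  qed
  also have "\<dots> = ?C * B" by (rule suminf_mult2[OF sm, symmetric])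
  finally show "norm ((\<phi> \<star> f) z) \<le> ?C * B" .
qed

lemma conv_add:
  assumes "\<phi> holomorphic_on \<D>" "f holomorphic_on \<D>" "g holomorphic_on \<D>" "norm z < 1"
  shows "(\<phi> \<star> (\<lambda>w. f w + g w)) z = (\<phi> \<star> f) z + (\<phi> \<star> g) z"
  using sums_add[OF conv_sums[OF assms(1,2,4)] conv_sums[OF assms(1,3,4)]] 
  by (simp add: conv_def taylor_add[OF assms(2,3)] sums_iff algebra_simps)

lemma conv_diff:
  assumes "\<phi> holomorphic_on \<D>" "f holomorphic_on \<D>" "g holomorphic_on \<D>" "norm z < 1"
  shows "(\<phi> \<star> (\<lambda>w. f w - g w)) z = (\<phi> \<star> f) z - (\<phi> \<star> g) z"
  using sums_diff[OF conv_sums[OF assms(1,2,4)] conv_sums[OF assms(1,3,4)]] 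
  by (simp add: conv_def taylor_diff[OF assms(2,3)] sums_iff algebra_simps)

lemma conv_cmult:
  assumes "\<phi> holomorphic_on \<D>" "f holomorphic_on \<D>" "norm z < 1"
  shows "(\<phi> \<star> (\<lambda>w. c * f w)) z = c * (\<phi> \<star> f) z"
  using sums_mult[OF conv_sums[OF assms], of c]
  by (simp add: conv_def taylor_cmult[OF assms(2)] sums_iff mult_ac)

lemma conv_sum:
  assumes "\<phi> holomorphic_on \<D>" "\<And>i. i \<in> I \<Longrightarrow> f i holomorphic_on \<D>" "norm z < 1"
  shows "(\<phi> \<star> (\<lambda>w. \<Sum>i\<in>I. f i w)) z = (\<Sum>i\<in>I. (\<phi> \<star> f i) z)"
  using assms(2)
proof (induction I rule: infinite_finite_induct)
  case (insert i I)
  have "(\<phi> \<star> (\<lambda>w. f i w + (\<Sum>i\<in>I. f i w))) z = (\<phi> \<star> f i) z + (\<phi> \<star> (\<lambda>w. \<Sum>i\<in>I. f i w)) z"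
    by (intro conv_add assms(1,3) holomorphic_intros) (use insert.prems in auto)
  with insert show ?case by simp
qed (use conv_cmult[OF assms(1) holomorphic_on_const assms(3), of 0] in auto)

text \<open>
  The kernel \<open>1 / (1 - x w)\<close> has the coefficients \<open>x ^ n\<close>, so it turns convolution into evaluation.
\<close>

lemma conv_geometric:
  assumes "\<phi> holomorphic_on \<D>" "norm x \<le> 1" "norm z < 1"
  shows "(\<phi> \<star> (\<lambda>w. 1 / (1 - x * w))) z = \<phi> (x * z)"
proof -
  have "norm (x * w) < 1" if "norm w < 1" for w
    using mult_right_mono[OF assms(2), of "norm w"] that by (simp add: norm_mult)
  then have *: "taylor (\<lambda>w. 1 / (1 - x * w)) n = x ^ n" for n
    using geometric_sums[of "x * _"] by (intro taylor_eqI) (auto simp: power_mult_distrib)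
  have "norm (x * z) < 1"
    using mult_right_mono[OF assms(2), of "norm z"] assms by (simp add: norm_mult)
  then show ?thesis
    using taylor_sums[OF assms(1), of "x * z"] unfolding conv_def * by (simp add: sums_iff power_mult_distrib mult_ac)
qed

lemma conv_dilate:
  assumes "\<phi> holomorphic_on \<D>" "f holomorphic_on \<D>" "norm r \<le> 1" "norm z < 1"
  shows "(\<phi> \<star> (\<lambda>w. f (r * w))) z = (\<phi> \<star> f) (r * z)"
proof -
  have in_disc: "norm (r * w) < 1" if "norm w < 1" for w
    using mult_right_mono[OF assms(3), of "norm w"] that by (simp add: norm_mult)
  have "taylor (\<lambda>w. f (r * w)) n = taylor f n * r ^ n" for n
    using taylor_sums[OF assms(2) in_disc] by (intro taylor_eqI) (auto simp: power_mult_distrib mult_ac)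
  then show ?thesis by (simp add: conv_def power_mult_distrib mult_ac)
qed

lemma conv_times_deriv:
  assumes "\<phi> holomorphic_on \<D>" "f holomorphic_on \<D>" "norm z < 1"
  shows "z * deriv (\<phi> \<star> f) z = (\<phi> \<star> (\<lambda>w. w * deriv f w)) z"
proof -
  have *: "fps_expansion (\<lambda>w. w * deriv g w) 0 = fps_X * fps_deriv (fps_expansion g 0)"
    if "g holomorphic_on \<D>" for g
    by (intro fps_expansion_eqI fps_expansion_intros has_taylor_expansion that)
  have "(\<lambda>n. taylor (\<lambda>w. w * deriv (\<phi> \<star> f) w) n * z ^ n) sums (z * deriv (\<phi> \<star> f) z)"
    using assms by (intro taylor_sums[where R = 1] holomorphic_intros) auto
  also have "taylor (\<lambda>w. w * deriv (\<phi> \<star> f) w) = (\<lambda>n. taylor \<phi> n * taylor (\<lambda>w. w * deriv f w) n)"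
    by (rule ext, unfold *[OF assms(2)] *[OF holomorphic_conv[OF assms(1,2)]])
      (simp add: taylor_conv[OF assms(1,2)])
  finally show ?thesis unfolding conv_def by (simp add: sums_iff)
qed

text \<open>
  The partial sums of the Taylor series of \<open>p\<close> converge uniformly on the circle that controls the
  functional of \<open>conv_bounded_functional\<close>.
\<close>

lemma conv_expand:
  assumes \<phi>: "\<phi> holomorphic_on \<D>" and q: "q holomorphic_on \<D>" and p: "p holomorphic_on \<D>" and z: "norm z < 1"
  shows "(\<lambda>n. taylor p n * (\<phi> \<star> (\<lambda>w. q w * w ^ n)) z) sums (\<phi> \<star> (\<lambda>w. q w * p w)) z"
proof -
  obtain s where s: "norm z < s" "s < 1" using dense z by blast
  then have s0: "s > 0" using norm_ge_zero[of z] by linarith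
  obtain C where C: "C \<ge> 0" "\<And>f B. f holomorphic_on \<D> \<Longrightarrow> (\<And>w. norm w = s \<Longrightarrow> norm (f w) \<le> B)
    \<Longrightarrow> norm ((\<phi> \<star> f) z) \<le> C * B" using conv_bounded_functional[OF \<phi> s] by metis
  obtain K where K: "\<And>w. norm w = s \<Longrightarrow> norm (q w) \<le> K"
    using holomorphic_bounded_on_circle[OF q s(2)] by metis
  have "K \<ge> 0" using K[of "of_real s"] s0 norm_ge_zero order_trans by (metis abs_of_pos norm_of_real)
  define tail where "tail N = (\<Sum>n. norm (taylor p (n + N)) * s ^ (n + N))" for N
  have sm: "summable (\<lambda>n. norm (taylor p n) * s ^ n)"
    using taylor_norm_summable[OF p, of "of_real s"] s s0 by simp
  have tail: "tail \<longlonglongrightarrow> 0" unfolding tail_def by (rule suminf_exist_split2[OF sm])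
  have diff: "norm ((\<phi> \<star> (\<lambda>w. q w * p w)) z - (\<Sum>n<N. taylor p n * (\<phi> \<star> (\<lambda>w. q w * w ^ n)) z))
     \<le> C * (K * tail N)" for N
  proof -
    have hol: "(\<lambda>w. q w * w ^ n) holomorphic_on \<D>" for n by (intro holomorphic_intros q)
    have "(\<Sum>n<N. taylor p n * (\<phi> \<star> (\<lambda>w. q w * w ^ n)) z) = (\<Sum>n<N. (\<phi> \<star> (\<lambda>w. taylor p n * (q w * w ^ n))) z)"
      by (simp add: conv_cmult[OF \<phi> hol z])
    also have "\<dots> = (\<phi> \<star> (\<lambda>w. \<Sum>n<N. taylor p n * (q w * w ^ n))) z"
      by (rule conv_sum[symmetric]) (intro \<phi> z holomorphic_intros q)+
    finally have "(\<phi> \<star> (\<lambda>w. q w * p w)) z - (\<Sum>n<N. taylor p n * (\<phi> \<star> (\<lambda>w. q w * w ^ n)) z)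
      = (\<phi> \<star> (\<lambda>w. q w * p w - (\<Sum>n<N. taylor p n * (q w * w ^ n)))) z"
      by (subst conv_diff) (auto intro!: holomorphic_intros \<phi> q p z)
    also have "norm \<dots> \<le> C * (K * tail N)"
    proof (rule C(2))
      show "(\<lambda>w. q w * p w - (\<Sum>n<N. taylor p n * (q w * w ^ n))) holomorphic_on \<D>"
        by (intro holomorphic_intros q p)
      fix w :: complex assume w: "norm w = s"
      have sp: "(\<lambda>n. taylor p n * w ^ n) sums p w" using taylor_sums[OF p] w s by simp
      have "p w - (\<Sum>n<N. taylor p n * w ^ n) = (\<Sum>n. taylor p (n + N) * w ^ (n + N))"
        using suminf_minus_initial_segment[OF sums_summable[OF sp], of N] sums_unique[OF sp] by simp
      also have "norm \<dots> \<le> tail N"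
        unfolding tail_def
        using summable_norm[of "\<lambda>n. taylor p (n + N) * w ^ (n + N)"] summable_ignore_initial_segment[OF sm, of N] w
        by (simp add: norm_mult norm_power)
      finally have t: "norm (p w - (\<Sum>n<N. taylor p n * w ^ n)) \<le> tail N" .
      have "q w * p w - (\<Sum>n<N. taylor p n * (q w * w ^ n)) = q w * (p w - (\<Sum>n<N. taylor p n * w ^ n))"
        by (simp add: sum_distrib_left algebra_simps)
      then show "norm (q w * p w - (\<Sum>n<N. taylor p n * (q w * w ^ n))) \<le> K * tail N"
        using mult_mono[OF K[OF w] t] \<open>K \<ge> 0\<close> by (simp add: norm_mult)
    qed
    finally show ?thesis .
  qed
  have "(\<lambda>N. C * (K * tail N)) \<longlonglongrightarrow> 0" by (intro tendsto_mult_right_zero tail)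
  then have "(\<lambda>N. (\<phi> \<star> (\<lambda>w. q w * p w)) z - (\<Sum>n<N. taylor p n * (\<phi> \<star> (\<lambda>w. q w * w ^ n)) z)) \<longlonglongrightarrow> 0"
    by (rule Lim_null_comparison[rotated]) (use diff in auto)
  from tendsto_diff[OF tendsto_const[of "(\<phi> \<star> (\<lambda>w. q w * p w)) z"] this]
  show ?thesis by (simp add: sums_def)
qed

lemma conv_monomial_summable:
  assumes \<phi>: "\<phi> holomorphic_on \<D>" and q: "q holomorphic_on \<D>" and z: "norm z < 1"
  shows "summable (\<lambda>n. norm ((\<phi> \<star> (\<lambda>w. q w * w ^ n)) z))"
proof -
  obtain s where s: "norm z < s" "s < 1" using dense z by blast
  then have s0: "s > 0" using norm_ge_zero[of z] by linarith
  obtain C where C: "C \<ge> 0" "\<And>f B. f holomorphic_on \<D> \<Longrightarrow> (\<And>w. norm w = s \<Longrightarrow> norm (f w) \<le> B)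
    \<Longrightarrow> norm ((\<phi> \<star> f) z) \<le> C * B" using conv_bounded_functional[OF \<phi> s] by metis
  obtain K where K: "\<And>w. norm w = s \<Longrightarrow> norm (q w) \<le> K"
    using holomorphic_bounded_on_circle[OF q s(2)] by metis
  have "summable (\<lambda>n. C * (K * s ^ n))"
    using s s0 by (intro summable_mult) auto
  then show ?thesis
  proof (rule summable_comparison_test')
    fix n
    have "norm ((\<phi> \<star> (\<lambda>w. q w * w ^ n)) z) \<le> C * (K * s ^ n)"
      by (rule C(2)) (auto intro!: holomorphic_intros q mult_right_mono K simp: norm_mult norm_power s0 less_imp_le)
    then show "norm (norm ((\<phi> \<star> (\<lambda>w. q w * w ^ n)) z)) \<le> C * (K * s ^ n)" by simp
  qed
qed

section \<open>Pairing of functions with positive real part\<close>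

lemma integral_character_circle:
  fixes k :: int
  shows "((\<lambda>t. cis (of_int k * t)) has_integral (if k = 0 then 2 * pi else 0)) {0..2 * pi}"
proof (cases "k = 0")
  case True
  have "((\<lambda>t. 1 :: complex) has_integral measure lborel {0..2 * pi} *\<^sub>R 1) {0..2 * pi}"
    by (rule has_integral_const_real)
  moreover have "measure lborel {0..2 * pi} *\<^sub>R 1 = (of_real (2 * pi) :: complex)"
    by (simp add: of_real_def)
  ultimately have "((\<lambda>t. 1 :: complex) has_integral of_real (2 * pi)) {0..2 * pi}"
    by (simp only:)
  then show ?thesis using True by simp
next
  case False
  define F where "F z = exp (\<i> * of_int k * z) / (\<i> * of_int k)" for z :: complex
  have "((\<lambda>t. exp (\<i> * of_int k * of_real t)) has_integral F (of_real (2 * pi)) - F (of_real 0)) {0..2 * pi}"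
  proof (rule fundamental_theorem_of_calculus)
    fix t assume "t \<in> {0..2 * pi}"
    show "((\<lambda>t. F (of_real t)) has_vector_derivative exp (\<i> * of_int k * of_real t)) (at t within {0..2 * pi})"
      by (rule has_vector_derivative_real_field) (auto simp: F_def False intro!: derivative_eq_intros)
  qed simp
  moreover have "F (of_real (2 * pi)) = F (of_real 0)"
    using exp_plus_2pin[of 0 k] by (simp add: F_def mult_ac)
  ultimately show ?thesis using False by (simp add: cis_conv_exp mult_ac)
qed

text \<open>
  Times \<open>\<pi>\<close>, the real part is the integral over the circle of the product of the two nonnegative
  functions \<open>Re A (cnj \<zeta>)\<close> and \<open>Re B \<zeta>\<close>: half of \<open>A B + cnj A B\<close> has that product as its real
  part, and orthogonality of the characters leaves only the diagonal of \<open>A B\<close> and the constant term of \<open>cnj A B\<close>.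
\<close>

lemma positive_polynomial_pairing:
  fixes a b :: "nat \<Rightarrow> complex"
  assumes a: "\<And>\<zeta>. norm \<zeta> = 1 \<Longrightarrow> Re (\<Sum>n<N. a n * \<zeta> ^ n) \<ge> 0"
    and b: "\<And>\<zeta>. norm \<zeta> = 1 \<Longrightarrow> Re (\<Sum>n<N. b n * \<zeta> ^ n) \<ge> 0" and N: "N > 0"
  shows "Re ((\<Sum>n<N. a n * b n) + cnj (a 0) * b 0) \<ge> 0"
proof -
  define A where "A t = (\<Sum>n<N. a n * cis (- t) ^ n)" for t
  define B where "B t = (\<Sum>n<N. b n * cis t ^ n)" for t
  let ?I = "\<lambda>k::int. (if k = 0 then 2 * pi else 0) :: real"
  have char: "((\<lambda>t. c * cis (of_int k * t)) has_integral c * of_real (?I k)) {0..2 * pi}" for c k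
    using has_integral_mult_right[OF integral_character_circle[of k], of c] by (auto split: if_splits)
  have char_mult1: "cis (- t) ^ n * cis t ^ m = cis (of_int (int m - int n) * t)" for t n m
  proof -
    have "cis (- t) ^ n * cis t ^ m = cis (real n * (- t)) * cis (real m * t)" by (simp only: Complex.DeMoivre)
    also have "\<dots> = cis (real n * (- t) + real m * t)" by (rule cis_mult)
    also have "real n * (- t) + real m * t = of_int (int m - int n) * t" by (simp add: algebra_simps)
    finally show ?thesis .
  qed
  have char_mult2: "cis t ^ n * cis t ^ m = cis (of_int (int m + int n) * t)" for t n m
    unfolding Complex.DeMoivre cis_mult by (rule arg_cong[of _ _ cis]) (simp add: algebra_simps)
  have AB: "A t * B t = (\<Sum>n<N. \<Sum>m<N. (a n * b m) * cis (of_int (int m - int n) * t))" for t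
  proof -
    have "a n * cis (- t) ^ n * (b m * cis t ^ m) = (a n * b m) * (cis (- t) ^ n * cis t ^ m)" for n m
      by (simp only: mult_ac)
    then show ?thesis unfolding A_def B_def sum_product char_mult1 by (simp only:)
  qed
  have "(\<Sum>n<N. \<Sum>m<N. (a n * b m) * of_real (?I (int m - int n))) = (\<Sum>n<N. \<Sum>m<N. if m = n then a n * b n * of_real (2 * pi) else 0)"
    by (intro sum.cong refl) auto
  then have v1: "(\<Sum>n<N. \<Sum>m<N. (a n * b m) * of_real (?I (int m - int n))) = of_real (2 * pi) * (\<Sum>n<N. a n * b n)"
    by (simp add: sum_distrib_left mult_ac)
  have i1: "((\<lambda>t. A t * B t) has_integral of_real (2 * pi) * (\<Sum>n<N. a n * b n)) {0..2 * pi}"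
    unfolding AB v1[symmetric] by (intro has_integral_sum char) auto
  have cAB: "cnj (A t) * B t = (\<Sum>n<N. \<Sum>m<N. (cnj (a n) * b m) * cis (of_int (int m + int n) * t))" for t
  proof -
    have "cnj (A t) = (\<Sum>n<N. cnj (a n) * cis t ^ n)" by (simp add: A_def cis_cnj)
    then have "cnj (A t) * B t = (\<Sum>n<N. \<Sum>m<N. cnj (a n) * cis t ^ n * (b m * cis t ^ m))"
      by (simp only: B_def sum_product)
    also have "\<dots> = (\<Sum>n<N. \<Sum>m<N. (cnj (a n) * b m) * cis (of_int (int m + int n) * t))"
    proof (intro sum.cong refl)
      fix n m
      have "cnj (a n) * cis t ^ n * (b m * cis t ^ m) = (cnj (a n) * b m) * (cis t ^ n * cis t ^ m)"
        by (simp only: mult_ac)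
      also have "cis t ^ n * cis t ^ m = cis (of_int (int m + int n) * t)" by (rule char_mult2)
      finally show "cnj (a n) * cis t ^ n * (b m * cis t ^ m) = (cnj (a n) * b m) * cis (of_int (int m + int n) * t)" .
    qed
    finally show ?thesis .
  qed
  have "(\<Sum>n<N. \<Sum>m<N. (cnj (a n) * b m) * of_real (?I (int m + int n))) = (\<Sum>n<N. \<Sum>m<N. if m = 0 then (if n = 0 then cnj (a 0) * b 0 * of_real (2 * pi) else 0) else 0)"
    by (intro sum.cong refl) auto
  then have v2: "(\<Sum>n<N. \<Sum>m<N. (cnj (a n) * b m) * of_real (?I (int m + int n))) = of_real (2 * pi) * (cnj (a 0) * b 0)"
    using N by (simp add: mult_ac)
  have i2: "((\<lambda>t. cnj (A t) * B t) has_integral of_real (2 * pi) * (cnj (a 0) * b 0)) {0..2 * pi}"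
    unfolding cAB v2[symmetric] by (intro has_integral_sum char) auto
  have "((\<lambda>t. A t * B t + cnj (A t) * B t) has_integral of_real (2 * pi) * ((\<Sum>n<N. a n * b n) + cnj (a 0) * b 0)) {0..2 * pi}"
    using has_integral_add[OF i1 i2] by (simp add: distrib_left)
  from has_integral_Re[OF this]
  have int: "((\<lambda>t. Re (A t * B t + cnj (A t) * B t)) has_integral 2 * pi * Re ((\<Sum>n<N. a n * b n) + cnj (a 0) * b 0)) {0..2 * pi}"
    by (simp add: algebra_simps)
  have "Re (A t) \<ge> 0" "Re (B t) \<ge> 0" for t
    unfolding A_def B_def by (intro a b; simp)+
  moreover have "Re (u * v + cnj u * v) = 2 * Re u * Re v" for u v :: complex
    by (simp add: algebra_simps)
  ultimately have "Re (A t * B t + cnj (A t) * B t) \<ge> 0" for t by (metis mult_nonneg_nonneg zero_le_numeral)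
  then have "2 * pi * Re ((\<Sum>n<N. a n * b n) + cnj (a 0) * b 0) \<ge> 0"
    by (rule has_integral_nonneg[OF int])
  then show ?thesis using pi_gt_zero by (simp add: zero_le_mult_iff)
qed

text \<open>
  Truncating a series changes it on the unit circle by at most the tail of the norms.  Adding this tail
  to the constant coefficient makes the truncation a polynomial with nonnegative real part.
\<close>

lemma positive_series_pairing:
  fixes a b :: "nat \<Rightarrow> complex"
  assumes sa: "summable (\<lambda>n. norm (a n))" and sb: "summable (\<lambda>n. norm (b n))"
    and a: "\<And>\<zeta>. norm \<zeta> = 1 \<Longrightarrow> Re (\<Sum>n. a n * \<zeta> ^ n) \<ge> 0"
    and b: "\<And>\<zeta>. norm \<zeta> = 1 \<Longrightarrow> Re (\<Sum>n. b n * \<zeta> ^ n) \<ge> 0"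
  shows "Re ((\<Sum>n. a n * b n) + cnj (a 0) * b 0) \<ge> 0"
proof -
  define tail where "tail c N = (\<Sum>n. norm (c (n + N)))" for c :: "nat \<Rightarrow> complex" and N
  have trunc: "Re (\<Sum>n<N. (c(0 := c 0 + of_real (tail c N))) n * \<zeta> ^ n) \<ge> 0"
    if s: "summable (\<lambda>n. norm (c n))" and c: "Re (\<Sum>n. c n * \<zeta> ^ n) \<ge> 0"
      and \<zeta>: "norm \<zeta> = 1" and N: "N > 0" for c N \<zeta>
  proof -
    have s': "summable (\<lambda>n. norm (c n * \<zeta> ^ n))" using s \<zeta> by (simp add: norm_mult norm_power)
    have "(\<Sum>n. c n * \<zeta> ^ n) - (\<Sum>n<N. c n * \<zeta> ^ n) = (\<Sum>n. c (n + N) * \<zeta> ^ (n + N))"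
      using suminf_minus_initial_segment[OF summable_norm_cancel[OF s'], of N] by simp
    also have "norm \<dots> \<le> tail c N"
      using summable_norm[OF summable_ignore_initial_segment[OF s', of N]] \<zeta>
      by (simp add: tail_def norm_mult norm_power)
    finally have "Re ((\<Sum>n. c n * \<zeta> ^ n) - (\<Sum>n<N. c n * \<zeta> ^ n)) \<le> tail c N"
      using complex_Re_le_cmod order_trans by blast
    then have "Re (\<Sum>n<N. c n * \<zeta> ^ n) + tail c N \<ge> 0" using c by simp
    moreover have "(\<Sum>n<N. (c(0 := c 0 + of_real (tail c N))) n * \<zeta> ^ n)
        = (\<Sum>n<N. c n * \<zeta> ^ n + (if n = 0 then of_real (tail c N) else 0))"
      by (intro sum.cong refl) auto
    moreover have "\<dots> = (\<Sum>n<N. c n * \<zeta> ^ n) + of_real (tail c N)"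
      using N by (simp add: sum.distrib)
    ultimately show ?thesis by simp
  qed
  let ?a = "\<lambda>N. a 0 + of_real (tail a N)" and ?b = "\<lambda>N. b 0 + of_real (tail b N)"
  have ineq: "Re ((\<Sum>n<N. a n * b n) - a 0 * b 0 + ?a N * ?b N + cnj (?a N) * ?b N) \<ge> 0" if N: "N > 0" for N
  proof -
    have "(\<Sum>n<N. (a(0 := ?a N)) n * (b(0 := ?b N)) n)
        = (\<Sum>n<N. a n * b n + (if n = 0 then ?a N * ?b N - a 0 * b 0 else 0))"
      by (intro sum.cong refl) auto
    also have "\<dots> = (\<Sum>n<N. a n * b n) + (?a N * ?b N - a 0 * b 0)"
      using N by (simp add: sum.distrib)
    finally have eq: "(\<Sum>n<N. (a(0 := ?a N)) n * (b(0 := ?b N)) n) + cnj ((a(0 := ?a N)) 0) * (b(0 := ?b N)) 0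
      = (\<Sum>n<N. a n * b n) - a 0 * b 0 + ?a N * ?b N + cnj (?a N) * ?b N"
      by simp
    have "Re ((\<Sum>n<N. (a(0 := ?a N)) n * (b(0 := ?b N)) n) + cnj ((a(0 := ?a N)) 0) * (b(0 := ?b N)) 0) \<ge> 0"
      by (intro positive_polynomial_pairing trunc sa sb a b N)
    then show ?thesis unfolding eq .
  qed
  have tails: "(\<lambda>N. of_real (tail a N) :: complex) \<longlonglongrightarrow> of_real 0" "(\<lambda>N. of_real (tail b N) :: complex) \<longlonglongrightarrow> of_real 0"
    unfolding tail_def
    by (rule tendsto_of_real[OF suminf_exist_split2[OF sa]] tendsto_of_real[OF suminf_exist_split2[OF sb]])+
  have "summable (\<lambda>n. a n * b n)"
  proof (rule summable_comparison_test'[of "\<lambda>n. (\<Sum>n. norm (a n)) * norm (b n)"])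
    fix n
    have "norm (a n) \<le> (\<Sum>n. norm (a n))" using sum_le_suminf[OF sa, of "{n}"] by simp
    then show "norm (a n * b n) \<le> (\<Sum>n. norm (a n)) * norm (b n)"
      by (simp add: norm_mult mult_right_mono)
  qed (intro summable_mult sb)
  then have "(\<lambda>N. \<Sum>n<N. a n * b n) \<longlonglongrightarrow> (\<Sum>n. a n * b n)" by (rule summable_LIMSEQ)
  then have "(\<lambda>N. Re ((\<Sum>n<N. a n * b n) - a 0 * b 0 + ?a N * ?b N + cnj (?a N) * ?b N))
     \<longlonglongrightarrow> Re ((\<Sum>n. a n * b n) - a 0 * b 0 + (a 0 + of_real 0) * (b 0 + of_real 0) + cnj (a 0 + of_real 0) * (b 0 + of_real 0))"
    by (intro tendsto_intros tails)
  moreover have "eventually (\<lambda>N. Re ((\<Sum>n<N. a n * b n) - a 0 * b 0 + ?a N * ?b N + cnj (?a N) * ?b N) \<ge> 0) sequentially"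
    using eventually_gt_at_top[of 0] by eventually_elim (rule ineq)
  ultimately have "Re ((\<Sum>n. a n * b n) - a 0 * b 0 + (a 0 + of_real 0) * (b 0 + of_real 0) + cnj (a 0 + of_real 0) * (b 0 + of_real 0)) \<ge> 0"
    by (rule tendsto_lowerbound) (rule sequentially_bot)
  then show ?thesis by simp
qed

lemma norm_times_less_1:
  fixes x w :: complex
  assumes "norm x \<le> 1" "norm w < 1"
  shows "norm (x * w) < 1"
  using mult_right_mono[OF assms(1), of "norm w"] assms(2) by (simp add: norm_mult)

lemma one_minus_times_nonzero:
  fixes x w :: complex
  assumes "norm x \<le> 1" "norm w < 1"
  shows "1 - x * w \<noteq> 0"
  using norm_times_less_1[OF assms] by auto

text \<open>
  A substitute for the Herglotz representation.  In \<open>p\<close> the quantity of interest is a linear functional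
  \<open>\<Sum> p\<^sub>n l\<^sub>n\<close>; the assumption on the half-plane maps says that \<open>l\<^sub>0 + 2 \<Sum> l\<^sub>n \<zeta>\<^sup>n\<close> has nonnegative real part on
  the circle, and the pairing of this series with \<open>p\<close> is twice the functional.  The first term is
  counted correctly because \<open>l\<^sub>0\<close> is real.
\<close>

lemma conv_positive_multiplier:
  assumes \<phi>: "\<phi> holomorphic_on \<D>" and q: "q holomorphic_on \<D>" and z: "norm z < 1"
    and real: "c * (\<phi> \<star> q) z \<in> \<real>"
    and extreme: "\<And>\<zeta>. norm \<zeta> = 1 \<Longrightarrow>
      Re (c * (\<phi> \<star> (\<lambda>w. q w * ((1 + \<zeta> * w) / (1 - \<zeta> * w)))) z) \<ge> 0"
    and p: "p holomorphic_on ball 0 R" "R > 1" "\<And>\<zeta>. norm \<zeta> = 1 \<Longrightarrow> Re (p \<zeta>) \<ge> 0"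
  shows "Re (c * (\<phi> \<star> (\<lambda>w. q w * p w)) z) \<ge> 0"
proof -
  define l where "l n = c * (\<phi> \<star> (\<lambda>w. q w * w ^ n)) z" for n
  define a where "a n = (if n = 0 then 1 else 2) * l n" for n :: nat
  have l: "summable (\<lambda>n. norm (l n))"
    using conv_monomial_summable[OF \<phi> q z, THEN summable_mult, of "norm c"] by (simp add: l_def norm_mult)
  have sa: "summable (\<lambda>n. norm (a n))"
    by (rule summable_comparison_test'[OF summable_mult[OF l, of 2]]) (auto simp: a_def norm_mult)
  have l0: "cnj (l 0) = l 0"
    using real by (simp add: l_def Reals_cnj_iff)
  have expand: "(\<lambda>n. taylor f n * l n) sums (c * (\<phi> \<star> (\<lambda>w. q w * f w)) z)" if "f holomorphic_on \<D>" for f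
    using sums_mult[OF conv_expand[OF \<phi> q that z], of c] by (simp add: l_def mult_ac)
  have A: "Re (\<Sum>n. a n * \<zeta> ^ n) \<ge> 0" if \<zeta>: "norm \<zeta> = 1" for \<zeta>
  proof -
    have nz: "1 - \<zeta> * w \<noteq> 0" if "norm w < 1" for w using one_minus_times_nonzero \<zeta> that by simp
    have "taylor (\<lambda>w. (1 + \<zeta> * w) / (1 - \<zeta> * w)) n = (if n = 0 then 1 else 2) * \<zeta> ^ n" for n
    proof (rule taylor_eqI)
      fix w assume w: "w \<in> \<D>"
      have "(\<lambda>n. 2 * (\<zeta> * w) ^ n - (if n = 0 then 1 else 0)) sums (2 * (1 / (1 - \<zeta> * w)) - 1)"
        using w \<zeta> norm_times_less_1[of \<zeta> w] by (intro sums_diff sums_mult geometric_sums sums_single[of 0 "\<lambda>_. 1", simplified]) auto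
      also have "2 * (1 / (1 - \<zeta> * w)) - 1 = (1 + \<zeta> * w) / (1 - \<zeta> * w)"
        using nz[of w] w by (simp add: divide_simps)
      also have "(\<lambda>n. 2 * (\<zeta> * w) ^ n - (if n = 0 then 1 else 0)) = (\<lambda>n. ((if n = 0 then 1 else 2) * \<zeta> ^ n) * w ^ n)"
        by (auto simp: power_mult_distrib fun_eq_iff)
      finally show "(\<lambda>n. ((if n = 0 then 1 else 2) * \<zeta> ^ n) * w ^ n) sums ((1 + \<zeta> * w) / (1 - \<zeta> * w))" .
    qed
    moreover have "(\<lambda>w. (1 + \<zeta> * w) / (1 - \<zeta> * w)) holomorphic_on \<D>"
      by (intro holomorphic_intros) (use nz in auto)
    ultimately have "(\<lambda>n. a n * \<zeta> ^ n) sums (c * (\<phi> \<star> (\<lambda>w. q w * ((1 + \<zeta> * w) / (1 - \<zeta> * w)))) z)"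
      using expand[of "\<lambda>w. (1 + \<zeta> * w) / (1 - \<zeta> * w)"] by (simp add: a_def mult_ac)
    then show ?thesis using extreme[OF \<zeta>] by (simp add: sums_iff)
  qed
  have B: "Re (\<Sum>n. taylor p n * \<zeta> ^ n) \<ge> 0" if "norm \<zeta> = 1" for \<zeta>
    using taylor_sums[OF p(1), of \<zeta>] p that by (simp add: sums_iff)
  have sb: "summable (\<lambda>n. norm (taylor p n))"
    using taylor_norm_summable[OF p(1), of 1] p(2) by simp
  have "p holomorphic_on \<D>" using p by (auto intro: holomorphic_on_subset)
  from expand[OF this] have s: "(\<lambda>n. taylor p n * l n) sums (c * (\<phi> \<star> (\<lambda>w. q w * p w)) z)" .
  have "(\<lambda>n. 2 * (taylor p n * l n) - (if n = 0 then l 0 * taylor p 0 else 0)) sums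
    (2 * (c * (\<phi> \<star> (\<lambda>w. q w * p w)) z) - l 0 * taylor p 0)"
    by (intro sums_diff sums_mult s sums_single[of 0 "\<lambda>_. l 0 * taylor p 0", simplified])
  also have "(\<lambda>n. 2 * (taylor p n * l n) - (if n = 0 then l 0 * taylor p 0 else 0)) = (\<lambda>n. a n * taylor p n)"
    by (auto simp: a_def fun_eq_iff)
  finally have "(\<Sum>n. a n * taylor p n) + cnj (a 0) * taylor p 0 = 2 * (c * (\<phi> \<star> (\<lambda>w. q w * p w)) z)"
    using l0 by (simp add: sums_iff a_def)
  with positive_series_pairing[OF sa sb A B] show ?thesis by simp
qed

section \<open>Convolution of a convex function with a two-pole kernel\<close>

text \<open>
  A quotient that tends to \<open>1\<close> at the origin and never becomes imaginary cannot leave the right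
  half-plane, as the disc is connected.
\<close>

lemma Re_quotient_positive:
  assumes N: "N1 holomorphic_on \<D>" "N2 holomorphic_on \<D>" "N1 0 = 0" "N2 0 = 0"
    and d: "deriv N1 0 = deriv N2 0" "deriv N2 0 \<noteq> 0"
    and nz: "\<And>z. z \<in> \<D> \<Longrightarrow> z \<noteq> 0 \<Longrightarrow> N2 z \<noteq> 0"
    and imag: "\<And>z \<tau>. z \<in> \<D> \<Longrightarrow> z \<noteq> 0 \<Longrightarrow> N1 z \<noteq> \<i> * of_real \<tau> * N2 z"
    and z: "z \<in> \<D>" "z \<noteq> 0"
  shows "Re (N1 z / N2 z) > 0"
proof -
  define Q where "Q w = (if w = 0 then 1 else N1 w / N2 w)" for w
  have lim: "((\<lambda>w. N w / w) \<longlongrightarrow> deriv N 0) (at 0)" if "N holomorphic_on \<D>" "N 0 = 0" for N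
    using holomorphic_derivI[OF that(1), of 0] that(2) by (simp add: has_field_derivative_iff)
  have "((\<lambda>w. (N1 w / w) / (N2 w / w)) \<longlongrightarrow> deriv N1 0 / deriv N2 0) (at 0)"
    by (intro tendsto_divide lim N d)
  moreover have "eventually (\<lambda>w. (N1 w / w) / (N2 w / w) = Q w) (at 0)"
    by (auto simp: eventually_at_filter Q_def)
  ultimately have "(Q \<longlongrightarrow> 1) (at 0)"
    using d by (auto elim: Lim_transform_eventually)
  then have c0: "isCont Q 0" by (simp add: isCont_def Q_def)
  have c1: "isCont Q w" if "w \<in> \<D>" "w \<noteq> 0" for w
  proof -
    have "isCont N1 w" "isCont N2 w"
      using that N(1,2)[THEN holomorphic_on_imp_continuous_on] continuous_on_eq_continuous_at[OF open_ball]
      by blast+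
    then have "isCont (\<lambda>w. N1 w / N2 w) w"
      using that nz by (intro continuous_intros) auto
    moreover have "eventually (\<lambda>w. N1 w / N2 w = Q w) (nhds w)"
      using t1_space_nhds[OF that(2)] by eventually_elim (simp add: Q_def)
    ultimately show ?thesis using isCont_cong by fastforce
  qed
  have "continuous_on \<D> Q"
    by (intro continuous_at_imp_continuous_on ballI) (metis c0 c1)
  then have "connected ((\<lambda>w. Re (Q w)) ` \<D>)"
    by (intro connected_continuous_image continuous_intros) auto
  then have int: "is_interval ((\<lambda>w. Re (Q w)) ` \<D>)" by (simp add: is_interval_connected_1)
  have ne: "Re (Q w) \<noteq> 0" if "w \<in> \<D>" for w
  proof
    assume 0: "Re (Q w) = 0"
    then have "w \<noteq> 0" by (auto simp: Q_def)
    then have "Q w = N1 w / N2 w" by (simp add: Q_def)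
    moreover have "Q w = \<i> * of_real (Im (Q w))" using 0 by (simp add: complex_eq_iff)
    ultimately have "N1 w = \<i> * of_real (Im (Q w)) * N2 w"
      using nz[OF that \<open>w \<noteq> 0\<close>] by (metis nonzero_divide_eq_eq)
    then show False using imag[OF that \<open>w \<noteq> 0\<close>] by blast
  qed
  have "Re (Q z) > 0"
  proof (rule ccontr)
    assume "\<not> Re (Q z) > 0"
    then have "Re (Q z) \<le> 0" "0 \<le> Re (Q 0)" by (simp_all add: Q_def)
    moreover have "Re (Q z) \<in> (\<lambda>w. Re (Q w)) ` \<D>" by (rule imageI[OF z(1)])
    moreover have "Re (Q 0) \<in> (\<lambda>w. Re (Q w)) ` \<D>" by (rule imageI) simp
    ultimately have "0 \<in> (\<lambda>w. Re (Q w)) ` \<D>"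
      using int[unfolded is_interval_1] by blast
    then show False using ne by auto
  qed
  then show ?thesis using z by (simp add: Q_def)
qed

text \<open>
  The open mapping theorem: an open set inside the closed right half-plane avoids its boundary.
\<close>

lemma Re_nonneg_attains_0_imp_constant:
  assumes f: "f holomorphic_on S" and S: "open S" "connected S"
    and nonneg: "\<And>z. z \<in> S \<Longrightarrow> Re (f z) \<ge> 0" and z: "z \<in> S" "Re (f z) = 0"
  shows "f constant_on S"
proof (rule ccontr)
  assume "\<not> f constant_on S"
  then have "open (f ` S)" using open_mapping_thm[OF f S S(1)] by simp
  then obtain e where e: "e > 0" "ball (f z) e \<subseteq> f ` S"
    using z(1) by (meson imageI openE)
  then have "f z - of_real (e / 2) \<in> f ` S"
    by (intro subsetD[OF e(2)]) (simp add: dist_norm)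
  then obtain w where "w \<in> S" "f w = f z - of_real (e / 2)" by (metis imageE)
  then show False using nonneg[of w] z(2) e(1) by simp
qed

lemma conv_factor_X:
  assumes \<phi>: "\<phi> holomorphic_on \<D>" and m: "m holomorphic_on \<D>"
  shows "(\<phi> \<star> (\<lambda>w. w * m w)) 0 = 0" "deriv (\<phi> \<star> (\<lambda>w. w * m w)) 0 = deriv \<phi> 0 * m 0"
proof -
  have hol: "(\<lambda>w. w * m w) holomorphic_on \<D>" by (intro holomorphic_intros m)
  have *: "fps_expansion (\<lambda>w. w * m w) 0 = fps_X * fps_expansion m 0"
    by (intro fps_expansion_eqI fps_expansion_intros has_taylor_expansion m)
  have t0: "taylor f 0 = f 0" and t1: "taylor f 1 = deriv f 0" for f
    by (simp_all add: fps_expansion_def)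
  show "(\<phi> \<star> (\<lambda>w. w * m w)) 0 = 0"
    using taylor_conv[OF \<phi> hol, of 0] unfolding * t0 by simp
  show "deriv (\<phi> \<star> (\<lambda>w. w * m w)) 0 = deriv \<phi> 0 * m 0"
    using taylor_conv[OF \<phi> hol, of 1] unfolding t1 * by (simp add: t0)
qed

lemma Cayley_imaginary:
  assumes "norm x = 1" "norm \<zeta> = 1" "x \<noteq> (\<zeta> :: complex)"
  obtains k where "(x + \<zeta>) / (x - \<zeta>) = \<i> * of_real k"
proof -
  have "cnj x = 1 / x" "cnj \<zeta> = 1 / \<zeta>" "x \<noteq> 0" "\<zeta> \<noteq> 0"
    using assms by (auto simp: divide_conv_cnj)
  then have "cnj ((x + \<zeta>) / (x - \<zeta>)) = - ((x + \<zeta>) / (x - \<zeta>))"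
    using assms(3) by (simp add: divide_simps) (simp add: algebra_simps)
  moreover have "Re c = 0" if "cnj c = - c" for c using arg_cong[OF that, of Re] by simp
  ultimately have "Re ((x + \<zeta>) / (x - \<zeta>)) = 0" by blast
  then have "(x + \<zeta>) / (x - \<zeta>) = \<i> * of_real (Im ((x + \<zeta>) / (x - \<zeta>)))"
    by (simp add: complex_eq_iff)
  then show ?thesis using that by blast
qed

lemma cnj_times_conv_divide: "cnj S * N = of_real ((norm S)\<^sup>2) * (N / S)"
proof (cases "S = 0")
  case False
  then have "N / S * (S * cnj S) = cnj S * N" by simp
  then show ?thesis by (metis complex_norm_square mult.commute of_real_power)
qed simp

definition two_pole :: "complex \<Rightarrow> complex \<Rightarrow> complex \<Rightarrow> complex" where
  "two_pole x y w = w / ((1 - x * w) * (1 - y * w))"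

definition half_plane_map :: "complex \<Rightarrow> complex \<Rightarrow> complex" where
  "half_plane_map \<zeta> w = (1 + \<zeta> * w) / (1 - \<zeta> * w)"

lemma holomorphic_two_pole:
  assumes "norm x \<le> 1" "norm y \<le> 1" shows "two_pole x y holomorphic_on \<D>"
  unfolding two_pole_def
  by (intro holomorphic_intros) (use one_minus_times_nonzero assms in auto)

lemma holomorphic_half_plane_map:
  assumes "norm \<zeta> \<le> 1" shows "half_plane_map \<zeta> holomorphic_on \<D>"
  unfolding half_plane_map_def
  by (intro holomorphic_intros) (use one_minus_times_nonzero assms in auto)

lemma holomorphic_geometric:
  assumes "norm \<zeta> \<le> 1" shows "(\<lambda>w. 1 / (1 - \<zeta> * w)) holomorphic_on \<D>"
  by (intro holomorphic_intros) (use one_minus_times_nonzero assms in auto)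

lemma conv_two_pole:
  assumes \<phi>: "\<phi> holomorphic_on \<D>" and n: "norm x \<le> 1" "norm y \<le> 1" "x \<noteq> y" and z: "norm z < 1"
  shows "(\<phi> \<star> two_pole x y) z = (\<phi> (x * z) - \<phi> (y * z)) / (x - y)"
proof -
  have "two_pole x y w = 1 / (x - y) * (1 / (1 - x * w) - 1 / (1 - y * w))" if "w \<in> \<D>" for w
    using one_minus_times_nonzero[of x w] one_minus_times_nonzero[of y w] that n
    unfolding two_pole_def by (simp add: divide_simps) (simp add: algebra_simps)
  then have "(\<phi> \<star> two_pole x y) z = (\<phi> \<star> (\<lambda>w. 1 / (x - y) * (1 / (1 - x * w) - 1 / (1 - y * w)))) z"
    by (subst conv_cong) auto
  also have "\<dots> = 1 / (x - y) * ((\<phi> \<star> (\<lambda>w. 1 / (1 - x * w))) z - (\<phi> \<star> (\<lambda>w. 1 / (1 - y * w))) z)"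
    using conv_cmult[OF \<phi> holomorphic_on_diff[OF holomorphic_geometric[OF n(1)] holomorphic_geometric[OF n(2)]] z, of "1 / (x - y)"]
      conv_diff[OF \<phi> holomorphic_geometric[OF n(1)] holomorphic_geometric[OF n(2)] z] by simp
  finally show ?thesis using conv_geometric[OF \<phi>] n z by simp
qed

text \<open>
  Partial fractions: every summand is a geometric kernel, so the convolution is a combination of the
  values of \<open>\<phi>\<close> at three points of one circle.
\<close>

lemma conv_two_pole_half_plane:
  assumes \<phi>: "\<phi> holomorphic_on \<D>" and n: "norm x = 1" "norm y = 1" "norm \<zeta> = 1"
    and ne: "x \<noteq> y" "x \<noteq> \<zeta>" "y \<noteq> \<zeta>" and z: "norm z < 1"
  shows "(\<phi> \<star> (\<lambda>w. two_pole x y w * half_plane_map \<zeta> w)) z =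
    ((x + \<zeta>) / (x - \<zeta>) * (\<phi> (x * z) - \<phi> (\<zeta> * z)) - (y + \<zeta>) / (y - \<zeta>) * (\<phi> (y * z) - \<phi> (\<zeta> * z))) / (x - y)"
proof -
  define \<kappa> where "\<kappa> v = (v + \<zeta>) / (v - \<zeta>)" for v
  define A B C where "A = \<kappa> x / (x - y)" and "B = - \<kappa> y / (x - y)" and "C = (\<kappa> y - \<kappa> x) / (x - y)"
  have ABC: "C = - (A + B)"
    unfolding A_def B_def C_def by (simp add: add_divide_distrib[symmetric] diff_divide_distrib)
  have nz: "1 - v * w \<noteq> 0" if "norm v = 1" "w \<in> \<D>" for v w
    using one_minus_times_nonzero[of v w] that by auto
  have one: "1 / (1 - v * w) * half_plane_map \<zeta> w = \<kappa> v * (1 / (1 - v * w)) - (\<kappa> v - 1) * (1 / (1 - \<zeta> * w))"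
    if "norm v = 1" "v \<noteq> \<zeta>" "w \<in> \<D>" for v w
  proof -
    have "\<kappa> v - 1 = 2 * \<zeta> / (v - \<zeta>)" using that(2) by (simp add: \<kappa>_def divide_simps)
    then show ?thesis
      using nz[OF that(1,3)] nz[OF n(3) that(3)] that(2)
      unfolding half_plane_map_def by (simp add: \<kappa>_def divide_simps) (simp add: algebra_simps)
  qed
  have eq: "two_pole x y w * half_plane_map \<zeta> w = A * (1 / (1 - x * w)) + B * (1 / (1 - y * w)) + C * (1 / (1 - \<zeta> * w))" if "w \<in> \<D>" for w
  proof -
    have "two_pole x y w = 1 / (x - y) * (1 / (1 - x * w) - 1 / (1 - y * w))"
      using nz[OF n(1) that] nz[OF n(2) that] ne
      unfolding two_pole_def by (simp add: divide_simps) (simp add: algebra_simps)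
    then have "two_pole x y w * half_plane_map \<zeta> w
      = 1 / (x - y) * (1 / (1 - x * w) * half_plane_map \<zeta> w - 1 / (1 - y * w) * half_plane_map \<zeta> w)"
      by (simp only: mult.assoc left_diff_distrib)
    also have "\<dots> = 1 / (x - y) * (\<kappa> x * (1 / (1 - x * w)) - (\<kappa> x - 1) * (1 / (1 - \<zeta> * w))
       - (\<kappa> y * (1 / (1 - y * w)) - (\<kappa> y - 1) * (1 / (1 - \<zeta> * w))))"
      by (simp only: one[OF n(1) ne(2) that] one[OF n(2) ne(3) that])
    also have "\<dots> = A * (1 / (1 - x * w)) + B * (1 / (1 - y * w)) + C * (1 / (1 - \<zeta> * w))"
      unfolding A_def B_def C_def by (simp add: algebra_simps diff_divide_distrib)
    finally show ?thesis .
  qed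
  have "(\<phi> \<star> (\<lambda>w. two_pole x y w * half_plane_map \<zeta> w)) z
     = (\<phi> \<star> (\<lambda>w. A * (1 / (1 - x * w)) + B * (1 / (1 - y * w)) + C * (1 / (1 - \<zeta> * w)))) z"
    by (subst conv_cong[OF eq]) auto
  also have "\<dots> = A * \<phi> (x * z) + B * \<phi> (y * z) + C * \<phi> (\<zeta> * z)"
  proof -
    have h: "(\<lambda>w. c * (1 / (1 - u * w))) holomorphic_on \<D>" if "norm u = 1" for c u
      by (intro holomorphic_intros holomorphic_geometric) (use that in auto)
    have "(\<phi> \<star> (\<lambda>w. c * (1 / (1 - u * w)))) z = c * \<phi> (u * z)" if "norm u = 1" for c u
      using conv_cmult[OF \<phi> holomorphic_geometric z, of u c] conv_geometric[OF \<phi> _ z, of u] that by simp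
    then show ?thesis
      using conv_add[OF \<phi> holomorphic_on_add[OF h h] h z, of x y \<zeta> A B C] conv_add[OF \<phi> h h z, of x y A B] n by simp
  qed
  also have "\<dots> = A * (\<phi> (x * z) - \<phi> (\<zeta> * z)) + B * (\<phi> (y * z) - \<phi> (\<zeta> * z))"
    by (simp add: ABC algebra_simps)
  also have "\<dots> = ((x + \<zeta>) / (x - \<zeta>) * (\<phi> (x * z) - \<phi> (\<zeta> * z)) - (y + \<zeta>) / (y - \<zeta>) * (\<phi> (y * z) - \<phi> (\<zeta> * z))) / (x - y)"
    unfolding A_def B_def \<kappa>_def by (simp add: diff_divide_distrib)
  finally show ?thesis .
qed

text \<open>
  If the quotient were imaginary, then by \<open>Cayley_imaginary\<close> the differences \<open>\<phi> (x z) - \<phi> (\<zeta> z)\<close> and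
  \<open>\<phi> (y z) - \<phi> (\<zeta> z)\<close> would be real multiples of one another, so three points of a circle would be mapped to a
  line.
\<close>

lemma Re_two_pole_half_plane_distinct:
  assumes \<phi>: "\<phi> \<in> \<K>" and n: "norm x = 1" "norm y = 1" "norm \<zeta> = 1"
    and ne: "x \<noteq> y" "x \<noteq> \<zeta>" "y \<noteq> \<zeta>" and z: "z \<in> \<D>" "z \<noteq> 0"
  shows "Re ((\<phi> \<star> (\<lambda>w. two_pole x y w * half_plane_map \<zeta> w)) z / (\<phi> \<star> two_pole x y) z) > 0"
proof -
  have K: "\<phi> holomorphic_on \<D>" "inj_on \<phi> \<D>" "deriv \<phi> 0 = 1" using \<phi> by (auto simp: class_K_def)
  have hol: "two_pole x y holomorphic_on \<D>" "half_plane_map \<zeta> holomorphic_on \<D>"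
    using holomorphic_two_pole holomorphic_half_plane_map n by auto
  have h: "(\<lambda>w. 1 / ((1 - x * w) * (1 - y * w))) holomorphic_on \<D>"
    by (intro holomorphic_intros) (use one_minus_times_nonzero n in auto)
  have e1: "two_pole x y = (\<lambda>w. w * (1 / ((1 - x * w) * (1 - y * w))))"
    by (simp add: two_pole_def fun_eq_iff)
  have e2: "(\<lambda>w. two_pole x y w * half_plane_map \<zeta> w) = (\<lambda>w. w * (1 / ((1 - x * w) * (1 - y * w)) * half_plane_map \<zeta> w))"
    by (simp add: two_pole_def fun_eq_iff)
  have base: "(\<phi> \<star> (\<lambda>w. two_pole x y w * half_plane_map \<zeta> w)) 0 = 0" "(\<phi> \<star> two_pole x y) 0 = 0"
    "deriv (\<phi> \<star> (\<lambda>w. two_pole x y w * half_plane_map \<zeta> w)) 0 = deriv (\<phi> \<star> two_pole x y) 0"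
    "deriv (\<phi> \<star> two_pole x y) 0 \<noteq> 0"
    unfolding e2 unfolding e1
    using conv_factor_X[OF K(1) h] conv_factor_X[OF K(1) holomorphic_on_mult[OF h hol(2)]] K(3)
    by (simp_all add: half_plane_map_def)
  have neq: "\<phi> (a * z) \<noteq> \<phi> (b * z)" if "norm a = 1" "norm b = 1" "a \<noteq> b" "z \<in> \<D>" "z \<noteq> 0" for a b z
  proof
    assume "\<phi> (a * z) = \<phi> (b * z)"
    then have "a * z = b * z" by (rule inj_onD[OF K(2)]) (use that in \<open>auto simp: norm_mult\<close>)
    then show False using that by simp
  qed
  have S_nz: "(\<phi> \<star> two_pole x y) z \<noteq> 0" if "z \<in> \<D>" "z \<noteq> 0" for z
    using conv_two_pole[OF K(1) _ _ ne(1), of z] neq[OF n(1,2) ne(1) that] n ne that by simp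
  have not_imag: "(\<phi> \<star> (\<lambda>w. two_pole x y w * half_plane_map \<zeta> w)) z \<noteq> \<i> * of_real \<tau> * (\<phi> \<star> two_pole x y) z"
    if z: "z \<in> \<D>" "z \<noteq> 0" for z and \<tau> :: real
  proof
    have z1: "norm z < 1" using z by simp
    assume eq: "(\<phi> \<star> (\<lambda>w. two_pole x y w * half_plane_map \<zeta> w)) z = \<i> * of_real \<tau> * (\<phi> \<star> two_pole x y) z"
    define u v where "u = \<phi> (x * z) - \<phi> (\<zeta> * z)" and "v = \<phi> (y * z) - \<phi> (\<zeta> * z)"
    obtain k1 k2 where k: "(x + \<zeta>) / (x - \<zeta>) = \<i> * of_real k1" "(y + \<zeta>) / (y - \<zeta>) = \<i> * of_real k2"
      using Cayley_imaginary n ne by metis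
    have "(x + \<zeta>) / (x - \<zeta>) \<noteq> (y + \<zeta>) / (y - \<zeta>)"
      using ne n by (auto simp: divide_simps) (auto simp: algebra_simps)
    then have "k1 \<noteq> k2" using k by auto
    have "(\<i> * of_real k1 * u - \<i> * of_real k2 * v) / (x - y) = \<i> * of_real \<tau> * ((u - v) / (x - y))"
      using eq unfolding conv_two_pole_half_plane[OF K(1) n ne z1] k u_def v_def
      using conv_two_pole[OF K(1) _ _ ne(1) z1] n by simp
    then have "\<i> * of_real k1 * u - \<i> * of_real k2 * v = \<i> * of_real \<tau> * (u - v)"
      using ne(1) by (simp add: divide_simps)
    then have "\<i> * (of_real k1 * u - of_real k2 * v) = \<i> * (of_real \<tau> * (u - v))"
      by (simp only: right_diff_distrib mult.assoc)
    then have "of_real k1 * u - of_real k2 * v = of_real \<tau> * (u - v)" by simp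
    then have uv: "of_real (k1 - \<tau>) * u = of_real (k2 - \<tau>) * v" by (simp add: algebra_simps)
    have v0: "v \<noteq> 0" using neq[OF n(2,3) ne(3) z] by (simp add: v_def)
    have "k1 \<noteq> \<tau>" using uv v0 \<open>k1 \<noteq> k2\<close> by auto
    then have us: "u = of_real ((k2 - \<tau>) / (k1 - \<tau>)) * v"
      using uv by (simp add: field_simps)
    have "Re (\<i> / v * u) = 0" "Re (\<i> / v * v) = 0" using v0 unfolding us by auto
    then have "Re (\<i> / v * \<phi> (x * z)) = Re (\<i> / v * \<phi> (\<zeta> * z))"
      "Re (\<i> / v * \<phi> (\<zeta> * z)) = Re (\<i> / v * \<phi> (y * z))"
      unfolding u_def v_def by (simp_all add: right_diff_distrib del: times_complex.sel)
    then show False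
      using circle_image_no_three_on_line[OF \<phi>, of "\<i> / v" "x * z" "norm z" "\<zeta> * z" "y * z"]
        n ne z v0 by (auto simp: norm_mult)
  qed
  show ?thesis
    by (rule Re_quotient_positive[OF _ _ base S_nz not_imag z])
      (intro holomorphic_intros K hol)+
qed

lemma continuous_on_conv_geometric:
  assumes \<phi>: "\<phi> holomorphic_on \<D>" and q: "q holomorphic_on \<D>" and z: "norm z < 1"
  shows "continuous_on (sphere 0 1) (\<lambda>x. (\<phi> \<star> (\<lambda>w. q w * (1 / (1 - x * w)))) z)"
proof -
  define l where "l n = (\<phi> \<star> (\<lambda>w. q w * w ^ n)) z" for n
  have l: "summable (\<lambda>n. norm (l n))" unfolding l_def by (rule conv_monomial_summable[OF \<phi> q z])
  have t: "taylor (\<lambda>w. 1 / (1 - x * w)) n = x ^ n" if "norm x = 1" for x n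
    using norm_times_less_1[of x] geometric_sums[of "x * _"] that
    by (intro taylor_eqI) (auto simp: power_mult_distrib)
  have eq: "(\<phi> \<star> (\<lambda>w. q w * (1 / (1 - x * w)))) z = (\<Sum>n. x ^ n * l n)" if "norm x = 1" for x
    using conv_expand[OF \<phi> q holomorphic_geometric z, of x] that t[OF that] by (simp add: l_def sums_iff)
  have "uniform_limit (sphere 0 1) (\<lambda>N x. \<Sum>n<N. x ^ n * l n) (\<lambda>x. \<Sum>n. x ^ n * l n) sequentially"
    by (rule Weierstrass_m_test[OF _ l]) (simp add: norm_mult norm_power)
  moreover have "eventually (\<lambda>N. continuous_on (sphere 0 1) (\<lambda>x. \<Sum>n<N. x ^ n * l n)) sequentially"
    by (intro always_eventually allI continuous_intros)
  ultimately have "continuous_on (sphere 0 1) (\<lambda>x. \<Sum>n. x ^ n * l n)"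
    using uniform_limit_theorem[where f = "\<lambda>N x. \<Sum>n<N. x ^ n * l n" and F = sequentially] by simp
  then show ?thesis by (rule continuous_on_eq) (metis eq dist_0_norm mem_sphere)
qed

lemma circle_nonneg_off_finite:
  fixes f :: "complex \<Rightarrow> real"
  assumes c: "continuous_on (sphere 0 1) f" and F: "finite F"
    and nonneg: "\<And>\<zeta>. norm \<zeta> = 1 \<Longrightarrow> \<zeta> \<notin> F \<Longrightarrow> f \<zeta> \<ge> 0" and \<zeta>: "norm \<zeta> = 1"
  shows "f \<zeta> \<ge> 0"
proof -
  define s where "s n = \<zeta> * cis (1 / real (Suc n))" for n
  have s1: "norm (s n) = 1" for n using \<zeta> by (simp add: s_def norm_mult)
  have inj: "inj s"
  proof (rule injI)
    fix m n assume "s m = s n"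
    then have "cis (1 / real (Suc m)) = cis (1 / real (Suc n))" using \<zeta> by (auto simp: s_def)
    then have "sin (1 / real (Suc m)) = sin (1 / real (Suc n))" by (metis cis.sel(2))
    moreover have "1 / real (Suc k) \<le> pi / 2" for k
      using pi_gt3 mult_mono[of 3 pi 1 "1 + real k"] by (auto simp: divide_simps)
    moreover have "- (pi / 2) \<le> 1 / real (Suc k)" for k
      by (rule order_trans[of _ 0]) simp_all
    ultimately have "1 / real (Suc m) = 1 / real (Suc n)" by (metis sin_inj_pi)
    then show "m = n" by simp
  qed
  have "s \<longlonglongrightarrow> \<zeta> * cis 0"
    unfolding s_def by (intro tendsto_intros LIMSEQ_Suc[where f = "\<lambda>n. 1 / real n"] lim_1_over_n)
  then have "s \<longlonglongrightarrow> \<zeta>" by simp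
  then have "(\<lambda>n. f (s n)) \<longlonglongrightarrow> f \<zeta>"
    using c \<zeta> s1 by (intro continuous_on_tendsto_compose[OF c]) (auto intro!: always_eventually)
  moreover have "eventually (\<lambda>n. s n \<notin> F) sequentially"
    using finite_vimageI[OF F inj] by (auto simp: eventually_cofinite[symmetric] cofinite_eq_sequentially[symmetric] vimage_def eventually_cofinite)
  then have "eventually (\<lambda>n. f (s n) \<ge> 0) sequentially"
    by eventually_elim (use nonneg s1 in auto)
  ultimately show ?thesis by (rule tendsto_lowerbound) simp
qed

text \<open>
  Coincidences among \<open>x\<close>, \<open>y\<close>, \<open>\<zeta>\<close> are reached by continuity, first in \<open>\<zeta>\<close> and then in \<open>y\<close>.  Multiplying by
  the conjugate of the denominator instead of dividing by it keeps the expression continuous.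
\<close>

lemma Re_two_pole_half_plane:
  assumes \<phi>: "\<phi> \<in> \<K>" and n: "norm x = 1" "norm y = 1" "norm \<zeta> = 1" and z: "z \<in> \<D>"
  shows "Re (cnj ((\<phi> \<star> two_pole x y) z) * (\<phi> \<star> (\<lambda>w. two_pole x y w * half_plane_map \<zeta> w)) z) \<ge> 0"
proof (cases "z = 0")
  case True
  have hol: "\<phi> holomorphic_on \<D>" using \<phi> by (simp add: class_K_def)
  have h: "(\<lambda>w. 1 / ((1 - x * w) * (1 - y * w))) holomorphic_on \<D>"
    by (intro holomorphic_intros) (use one_minus_times_nonzero n in auto)
  have "two_pole x y = (\<lambda>w. w * (1 / ((1 - x * w) * (1 - y * w))))"
    by (simp add: two_pole_def fun_eq_iff)
  then have "(\<phi> \<star> two_pole x y) 0 = 0" using conv_factor_X(1)[OF hol h] by (simp only:)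
  then show ?thesis using True by simp
next
  case False
  have z1: "norm z < 1" using z by simp
  have hol: "\<phi> holomorphic_on \<D>" using \<phi> by (auto simp: class_K_def)
  define T where "T y \<zeta> = Re (cnj ((\<phi> \<star> two_pole x y) z) * (\<phi> \<star> (\<lambda>w. two_pole x y w * half_plane_map \<zeta> w)) z)" for y \<zeta>
  have nz: "1 - a * w \<noteq> 0" if "norm a = 1" "norm w < 1" for a w :: complex
    using one_minus_times_nonzero that by simp
  have distinct: "T y \<zeta> \<ge> 0" if "norm y = 1" "norm \<zeta> = 1" "x \<noteq> y" "\<zeta> \<notin> {x, y}" for y \<zeta>
  proof -
    define N S where "N = (\<phi> \<star> (\<lambda>w. two_pole x y w * half_plane_map \<zeta> w)) z" and "S = (\<phi> \<star> two_pole x y) z"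
    have "Re (N / S) > 0"
      unfolding N_def S_def using Re_two_pole_half_plane_distinct[OF \<phi> n(1) that(1,2)] that z False by auto
    moreover have "Re (cnj S * N) = (norm S)\<^sup>2 * Re (N / S)"
      by (simp only: cnj_times_conv_divide Re_of_real_times)
    ultimately show ?thesis by (simp add: T_def N_def S_def)
  qed
  have x_ne_y: "T y \<zeta> \<ge> 0" if "norm y = 1" "norm \<zeta> = 1" "x \<noteq> y" for y \<zeta>
  proof (rule circle_nonneg_off_finite[of "\<lambda>\<zeta>. T y \<zeta>" "{x, y}"])
    have tp: "two_pole x y holomorphic_on \<D>" using holomorphic_two_pole n that by simp
    have "(\<phi> \<star> (\<lambda>w. two_pole x y w * half_plane_map \<zeta> w)) z
      = 2 * (\<phi> \<star> (\<lambda>w. two_pole x y w * (1 / (1 - \<zeta> * w)))) z - (\<phi> \<star> two_pole x y) z" if "norm \<zeta> = 1" for \<zeta>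
    proof -
      have h: "(\<lambda>w. two_pole x y w * (1 / (1 - \<zeta> * w))) holomorphic_on \<D>"
        by (intro holomorphic_intros tp) (use nz that in auto)
      have "two_pole x y w * half_plane_map \<zeta> w = 2 * (two_pole x y w * (1 / (1 - \<zeta> * w))) - two_pole x y w" if "w \<in> \<D>" for w
        using nz[of \<zeta> w] that \<open>norm \<zeta> = 1\<close> by (simp add: half_plane_map_def divide_simps) (simp add: algebra_simps)
      then have "(\<phi> \<star> (\<lambda>w. two_pole x y w * half_plane_map \<zeta> w)) z
         = (\<phi> \<star> (\<lambda>w. 2 * (two_pole x y w * (1 / (1 - \<zeta> * w))) - two_pole x y w)) z"
        by (subst conv_cong) auto
      then show ?thesis
        using conv_diff[OF hol holomorphic_on_mult[OF holomorphic_on_const h] tp z1, of 2] conv_cmult[OF hol h z1, of 2] by simp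
    qed
    note Neq = this
    have "continuous_on (sphere 0 1) (\<lambda>\<zeta>. Re (cnj ((\<phi> \<star> two_pole x y) z) *
      (2 * (\<phi> \<star> (\<lambda>w. two_pole x y w * (1 / (1 - \<zeta> * w)))) z - (\<phi> \<star> two_pole x y) z)))"
      by (intro continuous_intros continuous_on_conv_geometric hol tp z1)
    then show "continuous_on (sphere 0 1) (\<lambda>\<zeta>. T y \<zeta>)"
    proof (rule continuous_on_eq)
      fix \<zeta> :: complex assume "\<zeta> \<in> sphere 0 1"
      then have "norm \<zeta> = 1" by simp
      show "Re (cnj ((\<phi> \<star> two_pole x y) z) *
        (2 * (\<phi> \<star> (\<lambda>w. two_pole x y w * (1 / (1 - \<zeta> * w)))) z - (\<phi> \<star> two_pole x y) z)) = T y \<zeta>"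
        unfolding T_def Neq[OF \<open>norm \<zeta> = 1\<close>] ..
    qed
  qed (use that distinct in auto)
  have "T y \<zeta> \<ge> 0"
  proof (rule circle_nonneg_off_finite[of "\<lambda>y. T y \<zeta>" "{x}"])
    have hx: "(\<lambda>w. w / (1 - x * w)) holomorphic_on \<D>"
      by (intro holomorphic_intros) (use nz n in auto)
    have h2: "(\<lambda>w. w / (1 - x * w) * half_plane_map \<zeta> w) holomorphic_on \<D>"
      by (intro holomorphic_intros hx holomorphic_half_plane_map) (use n in auto)
    have f1: "two_pole x y = (\<lambda>w. w / (1 - x * w) * (1 / (1 - y * w)))"
      and f2: "(\<lambda>w. two_pole x y w * half_plane_map \<zeta> w) = (\<lambda>w. w / (1 - x * w) * half_plane_map \<zeta> w * (1 / (1 - y * w)))" for y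
      by (simp_all add: two_pole_def fun_eq_iff)
    have "T y \<zeta> = Re (cnj ((\<phi> \<star> (\<lambda>w. w / (1 - x * w) * (1 / (1 - y * w)))) z) *
      (\<phi> \<star> (\<lambda>w. w / (1 - x * w) * half_plane_map \<zeta> w * (1 / (1 - y * w)))) z)" for y
      by (simp only: T_def f2) (simp only: f1)
    then show "continuous_on (sphere 0 1) (\<lambda>y. T y \<zeta>)"
      by (simp only:) (intro continuous_intros continuous_on_conv_geometric hol hx h2 z1)
  qed (use n x_ne_y in auto)
  then show ?thesis by (simp add: T_def)
qed

lemma Re_conv_two_pole_multiplier:
  assumes \<phi>: "\<phi> \<in> \<K>" and n: "norm x = 1" "norm y = 1" and z: "z \<in> \<D>"
    and p: "p holomorphic_on ball 0 R" "R > 1" "\<And>\<zeta>. norm \<zeta> = 1 \<Longrightarrow> Re (p \<zeta>) \<ge> 0"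
  shows "Re (cnj ((\<phi> \<star> two_pole x y) z) * (\<phi> \<star> (\<lambda>w. two_pole x y w * p w)) z) \<ge> 0"
proof (rule conv_positive_multiplier[OF _ _ _ _ _ p])
  show "Re (cnj ((\<phi> \<star> two_pole x y) z) * (\<phi> \<star> (\<lambda>w. two_pole x y w * ((1 + \<zeta> * w) / (1 - \<zeta> * w)))) z) \<ge> 0"
    if "norm \<zeta> = 1" for \<zeta>
    using Re_two_pole_half_plane[OF \<phi> n that z] by (simp add: half_plane_map_def)
  show "cnj ((\<phi> \<star> two_pole x y) z) * (\<phi> \<star> two_pole x y) z \<in> \<real>"
    by (metis Reals_of_real complex_norm_square mult.commute of_real_power)
qed (use \<phi> z n holomorphic_two_pole in \<open>auto simp: class_K_def\<close>)

section \<open>The derivative of a convex function on a circle\<close>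

text \<open>
  If monotonicity failed on one side of a maximum, a value between the two offending ones would be
  taken three times, by the intermediate value theorem.
\<close>

lemma unimodal_if_values_taken_at_most_twice:
  fixes y :: "real \<Rightarrow> real"
  assumes c: "continuous_on {0..T} y" and T: "T > 0" and end_eq: "y T = y 0"
    and min: "\<And>t. t \<in> {0..T} \<Longrightarrow> y 0 \<le> y t"
    and thrice: "\<And>a b c. 0 \<le> a \<Longrightarrow> a < b \<Longrightarrow> b < c \<Longrightarrow> c < T \<Longrightarrow> y a = y b \<Longrightarrow> y b = y c \<Longrightarrow> False"
  obtains s where "s \<in> {0..T}" "mono_on {0..s} y" "antimono_on {s..T} y"
proof -
  obtain s where s: "s \<in> {0..T}" "\<And>t. t \<in> {0..T} \<Longrightarrow> y t \<le> y s"
    using continuous_attains_sup[OF compact_Icc _ c] T by auto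
  have cont: "continuous_on {a..b} y" if "0 \<le> a" "b \<le> T" for a b
    using that by (intro continuous_on_subset[OF c]) auto
  have "mono_on {0..s} y"
  proof (rule mono_onI, rule ccontr)
    fix a b assume ab: "a \<in> {0..s}" "b \<in> {0..s}" "a \<le> b" and "\<not> y a \<le> y b"
    then obtain v where v: "y b < v" "v < y a" using dense by (metis not_le)
    have "y 0 \<le> y b" "y a \<le> y s" using min[of b] s(2)[of a] ab s(1) by auto
    obtain p1 where p1: "0 \<le> p1" "p1 \<le> a" "y p1 = v"
      using IVT'[of y 0 v a] cont[of 0 a] ab s v \<open>y 0 \<le> y b\<close> by force
    obtain p2 where p2: "a \<le> p2" "p2 \<le> b" "y p2 = v"
      using IVT2'[of y b v a] cont[of a b] ab s v by force
    obtain p3 where p3: "b \<le> p3" "p3 \<le> s" "y p3 = v"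
      using IVT'[of y b v s] cont[of b s] ab s v \<open>y a \<le> y s\<close> by force
    have "p1 \<noteq> a" "p2 \<noteq> a" "p2 \<noteq> b" "p3 \<noteq> b" "p3 \<noteq> T"
      using p1 p2 p3 v end_eq \<open>y 0 \<le> y b\<close> by auto
    then show False using thrice[of p1 p2 p3] p1 p2 p3 s(1) by auto
  qed
  moreover have "antimono_on {s..T} y"
  proof (rule monotone_onI, rule ccontr)
    fix a b assume ab: "a \<in> {s..T}" "b \<in> {s..T}" "a \<le> b" and "\<not> y b \<le> y a"
    then obtain v where v: "y a < v" "v < y b" using dense by (metis not_le)
    have "y T \<le> y a" "y b \<le> y s" using min[of a] s(2)[of b] ab s(1) end_eq by auto
    obtain p1 where p1: "s \<le> p1" "p1 \<le> a" "y p1 = v"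
      using IVT2'[of y a v s] cont[of s a] ab s v \<open>y b \<le> y s\<close> by force
    obtain p2 where p2: "a \<le> p2" "p2 \<le> b" "y p2 = v"
      using IVT'[of y a v b] cont[of a b] ab s v by force
    obtain p3 where p3: "b \<le> p3" "p3 \<le> T" "y p3 = v"
      using IVT2'[of y T v b] cont[of b T] ab s v \<open>y T \<le> y a\<close> by force
    have "p1 \<noteq> a" "p2 \<noteq> a" "p2 \<noteq> b" "p3 \<noteq> b" "p3 \<noteq> T"
      using p1 p2 p3 v \<open>y T \<le> y a\<close> by auto
    then show False using thrice[of p1 p2 p3] p1 p2 p3 s(1) by auto
  qed
  ultimately show ?thesis using that s(1) by blast
qed

lemma one_minus_cis: "1 - cis \<theta> = - 2 * \<i> * of_real (sin (\<theta> / 2)) * cis (\<theta> / 2)"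
proof -
  have "cos \<theta> = 1 - 2 * (sin (\<theta> / 2))\<^sup>2" "sin \<theta> = 2 * sin (\<theta> / 2) * cos (\<theta> / 2)"
    using cos_double_sin[of "\<theta> / 2"] sin_double[of "\<theta> / 2"] by simp_all
  then show ?thesis by (simp add: complex_eq_iff power2_eq_square)
qed

lemma convex_image_support:
  assumes k: "k \<in> \<K>" and r: "0 < r" "r < 1" and w: "norm w = r"
  obtains d where "d \<noteq> 0" "\<And>v. norm v \<le> r \<Longrightarrow> Re (d * k w) \<le> Re (d * k v)"
proof -
  have K: "k holomorphic_on \<D>" "inj_on k \<D>" using k by (auto simp: class_K_def)
  have "k w \<notin> k ` ball 0 r"
    using inj_onD[OF K(2), of w] w r by (force simp: image_iff)
  moreover have "k ` ball 0 r \<noteq> {}" using r by auto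
  moreover have "convex (k ` ball 0 r)" using convex_image_smaller_disc[OF k] r by simp
  ultimately obtain a b where a: "a \<noteq> 0" "a \<bullet> k w \<le> b" "\<And>p. p \<in> k ` ball 0 r \<Longrightarrow> b \<le> a \<bullet> p"
    by (metis separating_hyperplane_set_point_inaff)
  have inner: "Re (cnj a * p) = a \<bullet> p" for p by (simp add: inner_complex_def)
  have "Re (cnj a * k w) \<le> Re (cnj a * k v)" if "norm v \<le> r" for v
  proof (rule continuous_ge_on_closure[of "ball 0 r" "\<lambda>v. Re (cnj a * k v)"])
    show "continuous_on (closure (ball 0 r)) (\<lambda>v. Re (cnj a * k v))"
      using r by (intro continuous_intros holomorphic_on_imp_continuous_on holomorphic_on_subset[OF K(1)]) auto
    show "v \<in> closure (ball 0 r)" using that r by simp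
    show "Re (cnj a * k w) \<le> Re (cnj a * k u)" if "u \<in> ball 0 r" for u
      using a(2) a(3)[of "k u"] that unfolding inner by force
  qed
  then show ?thesis using that[of "cnj a"] a(1) by auto
qed

text \<open>
  Take the line that supports the convex curve \<open>t \<mapsto> k (r cis t)\<close> at the point belonging to \<open>cnj c\<close>.
  No line meets the curve more than twice, so the height above this line increases up to some
  parameter and decreases afterwards.  Its derivative is the real part of a constant times
  \<open>\<zeta> k' (r \<zeta>)\<close> and changes sign exactly where the real function
  \<open>(1 - c \<zeta>) (1 - x \<zeta>) / \<zeta>\<close>, normalized by a unimodular constant, does, if \<open>cnj x\<close> is the highest point.
\<close>

lemma Re_convex_deriv_times_quadratic_nonneg:
  assumes k: "k \<in> \<K>" and r: "0 < r" "r < 1" and c: "norm c = 1"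
  obtains x e where "norm x = 1" "e \<noteq> 0"
    "\<And>\<zeta>. norm \<zeta> = 1 \<Longrightarrow> Re (e * deriv k (of_real r * \<zeta>) * ((1 - c * \<zeta>) * (1 - x * \<zeta>))) \<ge> 0"
proof -
  have K: "k holomorphic_on \<D>" "inj_on k \<D>" using k by (auto simp: class_K_def)
  define w where "w t = of_real r * cnj c * cis t" for t
  have nw: "norm (w t) = r" for t using c r by (simp add: w_def norm_mult)
  obtain d where d: "d \<noteq> 0" "\<And>v. norm v \<le> r \<Longrightarrow> Re (d * k (w 0)) \<le> Re (d * k v)"
    using convex_image_support[OF k r nw] by metis
  define y where "y t = Re (d * k (w t))" for t
  define y' where "y' t = Re (d * (deriv k (w t) * (\<i> * w t)))" for t
  have w_deriv: "(w has_vector_derivative \<i> * w t) (at t)" for t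
  proof -
    have "((\<lambda>t. of_real r * cnj c * exp (\<i> * of_real t)) has_vector_derivative of_real r * cnj c * (\<i> * exp (\<i> * of_real t))) (at t)"
      by (rule has_vector_derivative_real_field) (auto intro!: derivative_eq_intros)
    then show ?thesis by (simp add: w_def[abs_def] cis_conv_exp mult_ac)
  qed
  have y_deriv: "(y has_real_derivative y' t) (at t)" for t
  proof -
    have "(k has_field_derivative deriv k (w t)) (at (w t))"
      by (rule holomorphic_derivI[OF K(1)]) (use nw[of t] r in auto)
    from field_vector_diff_chain_at[OF w_deriv this]
    have "((k \<circ> w) has_vector_derivative \<i> * w t * deriv k (w t)) (at t)" .
    then have "((\<lambda>t. d * k (w t)) has_vector_derivative d * (\<i> * w t * deriv k (w t))) (at t)"
      by (intro has_vector_derivative_mult_right) (simp add: o_def)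
    then have "((\<lambda>t. Re (d * k (w t))) has_vector_derivative Re (d * (\<i> * w t * deriv k (w t)))) (at t)"
      by (rule bounded_linear.has_vector_derivative[OF bounded_linear_Re])
    then show ?thesis
      by (simp add: y_def[abs_def] y'_def has_real_derivative_iff_has_vector_derivative mult_ac)
  qed
  have cont: "continuous_on A y" for A
    using y_deriv by (meson DERIV_isCont continuous_at_imp_continuous_on)
  have w_period: "w (2 * pi) = w 0" by (simp add: w_def)
  have inj: "w a \<noteq> w b" if ab: "0 \<le> a" "a < b" "b < 2 * pi" for a b
  proof
    assume "w a = w b"
    then have "cis a = cis b" using c r by (auto simp: w_def)
    then have "cis (b - a) = 1" by (simp add: cis_divide[symmetric])
    then obtain n :: int where "b - a = of_int n * (2 * pi)"
      by (metis cis.simps(1) cos_one_2pi_int one_complex.sel(1) mult.commute mult.left_commute)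
    then have "0 < of_int n * (2 * pi)" "of_int n * (2 * pi) < 1 * (2 * pi)" using ab by linarith+
    note n = this
    have "0 < real_of_int n" by (rule zero_less_mult_pos2[OF n(1)]) simp
    moreover have "real_of_int n < 1" by (rule mult_right_less_imp_less[OF n(2)]) simp
    ultimately show False by simp
  qed
  obtain s where s: "s \<in> {0..2 * pi}" "mono_on {0..s} y" "antimono_on {s..2 * pi} y"
  proof (rule unimodal_if_values_taken_at_most_twice[of "2 * pi" y])
    show "continuous_on {0..2 * pi} y" by (rule cont)
    show "y 0 \<le> y t" for t unfolding y_def by (rule d(2)) (simp add: nw)
    fix a b c assume abc: "0 \<le> a" "a < b" "b < c" "c < 2 * pi" "y a = y b" "y b = y c"
    show False
      by (rule circle_image_no_three_on_line[OF k d(1) nw[of a] nw[of b] nw[of c] r(2)])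
        (use abc inj[of a b] inj[of a c] inj[of b c] in \<open>auto simp: y_def\<close>)
  qed (use w_period in \<open>auto simp: y_def\<close>)
  have rising: "y' t \<ge> 0" if "0 \<le> t" "t < s" for t
  proof (rule ccontr)
    assume "\<not> y' t \<ge> 0"
    then obtain e where e: "e > 0" "\<And>h. 0 < h \<Longrightarrow> h < e \<Longrightarrow> y (t + h) < y t"
      using DERIV_neg_dec_right[OF y_deriv, of t] by auto
    define h where "h = min (e / 2) (s - t)"
    have "0 < h" "h < e" "t + h \<le> s" using e that by (auto simp: h_def)
    then show False using e(2)[of h] mono_onD[OF s(2), of t "t + h"] that by auto
  qed
  have falling: "y' t \<le> 0" if "s \<le> t" "t < 2 * pi" for t
  proof (rule ccontr)
    assume "\<not> y' t \<le> 0"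
    then obtain e where e: "e > 0" "\<And>h. 0 < h \<Longrightarrow> h < e \<Longrightarrow> y t < y (t + h)"
      using DERIV_pos_inc_right[OF y_deriv, of t] by auto
    define h where "h = min (e / 2) (2 * pi - t)"
    have "0 < h" "h < e" "t + h \<le> 2 * pi" using e that by (auto simp: h_def)
    then show False using e(2)[of h] monotone_onD[OF s(3), of t "t + h"] that by auto
  qed
  have cc: "c * cnj c = 1" using c by (metis complex_norm_square mult_1 of_real_1 power2_eq_square)
  show ?thesis
  proof (rule that)
    \<comment> \<open>\<open>x = c cis (- s)\<close> puts the second zero at the highest point of the curve, where the parameter is \<open>s\<close>\<close>
    show "norm (c * cis (- s)) = 1" using c by (simp add: norm_mult)
    show "d * \<i> * cnj c * cis (s / 2) \<noteq> 0" using d c by auto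
    fix \<zeta> :: complex assume \<zeta>: "norm \<zeta> = 1"
    obtain t where t: "0 \<le> t" "t < 2 * pi" "c * \<zeta> = cis t"
    proof -
      have "norm (c * \<zeta>) = 1" using c \<zeta> by (simp add: norm_mult)
      then show ?thesis using complex_unimodular_polar[of "c * \<zeta>"] that by (metis cis.ctr)
    qed
    have "cnj c * (c * \<zeta>) = \<zeta>" using cc by (simp add: mult.assoc[symmetric] mult.commute[of "cnj c"])
    then have \<zeta>_eq: "\<zeta> = cnj c * cis t" using t(3) by simp
    have x\<zeta>: "c * cis (- s) * \<zeta> = cis (t - s)"
    proof -
      have "c * cis (- s) * \<zeta> = (c * \<zeta>) * cis (- s)" by (simp only: mult_ac)
      then show ?thesis using t(3) cis_mult[of t "- s"] by simp
    qed
    \<comment> \<open>\<open>\<sigma> cis (t - s / 2)\<close> is the product of \<open>1 - cis t\<close> and \<open>1 - cis (t - s)\<close>; the constant multiplier below removes the phase \<open>cis (- s / 2)\<close>\<close>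
    define \<sigma> where "\<sigma> = - 4 * sin (t / 2) * sin ((t - s) / 2)"
    have "cis (t / 2) * cis ((t - s) / 2) * cis (s / 2) = cis t"
      by (simp add: cis_mult add_divide_distrib[symmetric] diff_divide_distrib)
    have "(1 - c * \<zeta>) * (1 - c * cis (- s) * \<zeta>) = of_real \<sigma> * (cis (t / 2) * cis ((t - s) / 2))"
      unfolding x\<zeta> t(3) one_minus_cis \<sigma>_def by (simp add: algebra_simps)
    then have "d * \<i> * cnj c * cis (s / 2) * deriv k (of_real r * \<zeta>) * ((1 - c * \<zeta>) * (1 - c * cis (- s) * \<zeta>))
      = of_real \<sigma> * (d * \<i> * cnj c * deriv k (of_real r * \<zeta>) * (cis (t / 2) * cis ((t - s) / 2) * cis (s / 2)))"
      by (simp only: mult_ac)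
    also have "\<dots> = of_real \<sigma> * (d * \<i> * deriv k (of_real r * \<zeta>) * \<zeta>)"
      unfolding \<open>cis (t / 2) * cis ((t - s) / 2) * cis (s / 2) = cis t\<close> using \<zeta>_eq by (simp add: mult_ac)
    also have "\<dots> = of_real (\<sigma> / r) * (d * (deriv k (w t) * (\<i> * w t)))"
      using r by (simp add: w_def \<zeta>_eq mult_ac)
    finally have *: "Re (d * \<i> * cnj c * cis (s / 2) * deriv k (of_real r * \<zeta>) * ((1 - c * \<zeta>) * (1 - c * cis (- s) * \<zeta>))) = \<sigma> / r * y' t"
      unfolding y'_def by (simp only: Re_of_real_times)
    have "\<sigma> * y' t \<ge> 0"
    proof (cases "t < s")
      case True
      have "sin ((s - t) / 2) \<ge> 0" "sin (t / 2) \<ge> 0" using True t s(1) by (auto intro!: sin_ge_zero)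
      moreover have "\<sigma> = 4 * sin (t / 2) * sin ((s - t) / 2)"
        unfolding \<sigma>_def using sin_minus[of "(s - t) / 2"] by (simp add: minus_divide_left)
      ultimately show ?thesis using rising[OF t(1) True] by simp
    next
      case False
      have "sin ((t - s) / 2) \<ge> 0" "sin (t / 2) \<ge> 0" using False t s(1) by (auto intro!: sin_ge_zero)
      then show ?thesis using falling[of t] False t unfolding \<sigma>_def
        by (simp add: mult_nonneg_nonpos)
    qed
    then show "Re (d * \<i> * cnj c * cis (s / 2) * deriv k (of_real r * \<zeta>) * ((1 - c * \<zeta>) * (1 - c * cis (- s) * \<zeta>))) \<ge> 0"
      unfolding * using r by (simp add: zero_le_mult_iff divide_le_0_iff zero_le_divide_iff)
  qed
qed

section \<open>The theorem of Ruscheweyh and Sheil-Small\<close>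

lemma deriv_nonzero_class_K:
  assumes "\<phi> \<in> \<K>" "z \<in> \<D>"
  shows "deriv \<phi> z \<noteq> 0"
  using holomorphic_injective_imp_regular[of \<phi> \<D> z] assms by (auto simp: class_K_def)

text \<open>
  For \<open>x = y\<close> the kernel is a derivative of the geometric kernel, so the convolution is
  \<open>z \<phi>' (x z)\<close> instead of a difference quotient.
\<close>

lemma conv_two_pole_nonzero:
  assumes \<phi>: "\<phi> \<in> \<K>" and n: "norm x = 1" "norm y = 1" and z: "z \<in> \<D>" "z \<noteq> 0"
  shows "(\<phi> \<star> two_pole x y) z \<noteq> 0"
proof (cases "x = y")
  case False
  have K: "\<phi> holomorphic_on \<D>" "inj_on \<phi> \<D>" using \<phi> by (auto simp: class_K_def)
  have "\<phi> (x * z) \<noteq> \<phi> (y * z)"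
  proof
    assume "\<phi> (x * z) = \<phi> (y * z)"
    then have "x * z = y * z" by (rule inj_onD[OF K(2)]) (use n z in \<open>auto simp: norm_mult\<close>)
    then show False using False z by simp
  qed
  then show ?thesis using conv_two_pole[OF K(1) _ _ False, of z] n z False by simp
next
  case True
  have K: "\<phi> holomorphic_on \<D>" using \<phi> by (auto simp: class_K_def)
  have nz: "1 - x * w \<noteq> 0" if "w \<in> \<D>" for w using one_minus_times_nonzero[of x w] n that by auto
  have xz: "x * w \<in> \<D>" if "w \<in> \<D>" for w using n that by (simp add: norm_mult)
  have x0: "x \<noteq> 0" using n by auto
  define G where "G w = 1 / (1 - x * w)" for w
  have G: "G holomorphic_on \<D>" unfolding G_def by (rule holomorphic_geometric) (use n in simp)
  have dG: "deriv G w = x / (1 - x * w)\<^sup>2" if "w \<in> \<D>" for w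
    unfolding G_def using nz[OF that]
    by (intro DERIV_imp_deriv) (auto intro!: derivative_eq_intros simp: power2_eq_square)
  have "w * deriv G w = x * two_pole x y w" if "w \<in> \<D>" for w
    using dG[OF that] True by (simp add: two_pole_def power2_eq_square)
  then have "(\<phi> \<star> (\<lambda>w. w * deriv G w)) z = (\<phi> \<star> (\<lambda>w. x * two_pole x y w)) z"
    by (subst conv_cong) auto
  also have "\<dots> = x * (\<phi> \<star> two_pole x y) z"
    using K z n by (intro conv_cmult holomorphic_two_pole) auto
  finally have "x * (\<phi> \<star> two_pole x y) z = z * deriv (\<phi> \<star> G) z"
    using conv_times_deriv[OF K G, of z] z by simp
  also have "deriv (\<phi> \<star> G) z = deriv (\<lambda>w. \<phi> (x * w)) z"
  proof (rule deriv_cong_ev)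
    show "eventually (\<lambda>w. (\<phi> \<star> G) w = \<phi> (x * w)) (nhds z)"
      using eventually_nhds_in_open[of \<D> z] z
    by (auto elim!: eventually_mono simp: G_def[abs_def] n conv_geometric[OF K])
  qed simp
  also have "deriv (\<lambda>w. \<phi> (x * w)) z = deriv \<phi> (x * z) * x"
  proof (rule DERIV_imp_deriv)
    have "(\<phi> has_field_derivative deriv \<phi> (x * z)) (at (x * z))"
      by (rule holomorphic_derivI[OF K]) (use xz z in auto)
    moreover have "((\<lambda>w. x * w) has_field_derivative x) (at z)"
      by (auto intro!: derivative_eq_intros)
    ultimately show "((\<lambda>w. \<phi> (x * w)) has_field_derivative deriv \<phi> (x * z) * x) (at z)"
      using DERIV_chain2[of \<phi> "deriv \<phi> (x * z)" "\<lambda>w. x * w" z x UNIV] by simp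
  qed
  finally have "(\<phi> \<star> two_pole x y) z = z * deriv \<phi> (x * z)" using x0 by simp
  then show ?thesis using deriv_nonzero_class_K[OF \<phi> xz] z by simp
qed

lemma disc_subset_inverse_ball:
  assumes "0 < r" "r < 1" shows "\<D> \<subseteq> ball 0 (1 / r)"
proof -
  have "1 \<le> 1 / r" using assms by simp
  then show ?thesis by auto
qed

lemma holomorphic_dilate:
  assumes "f holomorphic_on \<D>" "0 < r"
  shows "(\<lambda>w. f (of_real r * w)) holomorphic_on ball 0 (1 / r)"
proof (rule holomorphic_on_compose_gen[OF _ assms(1), unfolded o_def])
  show "(*) (complex_of_real r) ` ball 0 (1 / r) \<subseteq> \<D>"
    using assms(2) by (auto simp: norm_mult field_simps)
qed (intro holomorphic_intros)

text \<open>
  With \<open>x\<close> from \<open>Re_convex_deriv_times_quadratic_nonneg\<close> the kernel \<open>z k' (1 - c z) / (1 - y z)\<close> is, up to a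
  constant, the two-pole kernel times a function \<open>p\<close> of nonnegative real part.  Hence its convolution
  divided by that of the two-pole kernel has nonnegative real part, and a zero would make it vanish
  identically.
\<close>

lemma conv_deriv_times_Moebius_nonzero:
  assumes \<phi>: "\<phi> \<in> \<K>" and k: "k \<in> \<K>" and r: "0 < r" "r < 1" and n: "norm c = 1" "norm y = 1"
    and z: "z \<in> \<D>" "z \<noteq> 0"
  shows "(\<phi> \<star> (\<lambda>w. w * (deriv k (of_real r * w) * ((1 - c * w) / (1 - y * w))))) z \<noteq> 0"
proof
  have K: "\<phi> holomorphic_on \<D>" "deriv \<phi> 0 = 1" "k holomorphic_on \<D>" "deriv k 0 = 1"
    using \<phi> k by (auto simp: class_K_def)
  define m where "m w = deriv k (of_real r * w) * ((1 - c * w) / (1 - y * w))" for w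
  define N where "N = (\<phi> \<star> (\<lambda>w. w * m w))"
  assume 0: "(\<phi> \<star> (\<lambda>w. w * (deriv k (of_real r * w) * ((1 - c * w) / (1 - y * w))))) z = 0"
  obtain x e where xe: "norm x = 1" "e \<noteq> 0"
    "\<And>\<zeta>. norm \<zeta> = 1 \<Longrightarrow> Re (e * deriv k (of_real r * \<zeta>) * ((1 - c * \<zeta>) * (1 - x * \<zeta>))) \<ge> 0"
    using Re_convex_deriv_times_quadratic_nonneg[OF k r n(1)] by metis
  have dk: "(\<lambda>w. deriv k (of_real r * w)) holomorphic_on ball 0 (1 / r)"
    using K(3) r by (intro holomorphic_dilate holomorphic_deriv) auto
  have sub: "\<D> \<subseteq> ball 0 (1 / r)" using r by (rule disc_subset_inverse_ball)
  define p where "p w = e * deriv k (of_real r * w) * ((1 - c * w) * (1 - x * w))" for w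
  have p: "p holomorphic_on ball 0 (1 / r)"
    unfolding p_def by (intro holomorphic_intros dk)
  have m: "m holomorphic_on \<D>"
    unfolding m_def
    by (intro holomorphic_intros holomorphic_on_subset[OF dk sub]) (use one_minus_times_nonzero n in auto)
  have N: "N holomorphic_on \<D>" unfolding N_def by (intro holomorphic_intros K m)
  define S where "S = (\<phi> \<star> two_pole x y)"
  have S: "S holomorphic_on \<D>"
    unfolding S_def using xe n by (intro holomorphic_intros K holomorphic_two_pole) auto
  have S0: "S w \<noteq> 0" if "w \<in> \<D>" "w \<noteq> 0" for w
    unfolding S_def by (rule conv_two_pole_nonzero[OF \<phi> xe(1) n(2) that])
  have pos: "Re (e * N w / S w) \<ge> 0" if w: "w \<in> \<D>" for w
  proof -
    have eq: "two_pole x y v * p v = e * (v * m v)" if "v \<in> \<D>" for v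
      using one_minus_times_nonzero[of x v] one_minus_times_nonzero[of y v] that xe n
      unfolding two_pole_def p_def m_def by simp
    have "(\<phi> \<star> (\<lambda>v. two_pole x y v * p v)) w = (\<phi> \<star> (\<lambda>v. e * (v * m v))) w"
      by (subst conv_cong[OF eq]) auto
    also have "\<dots> = e * N w"
      unfolding N_def using w by (intro conv_cmult holomorphic_intros K m) auto
    finally have eN: "(\<phi> \<star> (\<lambda>v. two_pole x y v * p v)) w = e * N w" .
    have "Re (cnj (S w) * (e * N w)) \<ge> 0"
      unfolding eN[symmetric] S_def
      by (rule Re_conv_two_pole_multiplier[OF \<phi> xe(1) n(2) w p]) (use r xe in \<open>auto simp: p_def\<close>)
    then have "(norm (S w))\<^sup>2 * Re (e * N w / S w) \<ge> 0"
      by (simp only: cnj_times_conv_divide Re_of_real_times)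
    then show ?thesis by (cases "S w = 0") (simp_all add: zero_le_mult_iff)
  qed
  have "(\<lambda>w. e * N w / S w) constant_on (\<D> - {0})"
  proof (rule Re_nonneg_attains_0_imp_constant)
    show "(\<lambda>w. e * N w / S w) holomorphic_on (\<D> - {0})"
      by (intro holomorphic_intros holomorphic_on_subset[OF N] holomorphic_on_subset[OF S]) (use S0 in auto)
    show "connected (\<D> - {0})" by (intro connected_open_delete) auto
    show "z \<in> \<D> - {0}" using z by simp
    show "Re (e * N z / S z) = 0" using 0 by (simp add: N_def m_def)
  qed (use pos in auto)
  then have "e * N w / S w = e * N z / S z" if "w \<in> \<D>" "w \<noteq> 0" for w
    using that z unfolding constant_on_def by (metis DiffI singletonD)
  then have N0: "N w = 0" if "w \<in> \<D>" "w \<noteq> 0" for w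
    using that S0 0 xe(2) by (simp add: N_def m_def)
  have "N 0 = 0" and dN: "deriv N 0 = 1"
    unfolding N_def using conv_factor_X[OF K(1) m] K by (simp_all add: m_def)
  then have "N w = 0" if "w \<in> \<D>" for w using N0[OF that] by (cases "w = 0") auto
  then have "deriv N 0 = deriv (\<lambda>w. 0) 0"
    by (intro deriv_cong_ev) (auto simp: eventually_nhds intro!: exI[of _ \<D>])
  then show False using dN by simp
qed

text \<open>
  Every combination \<open>(1 + \<kappa>) + (1 - \<kappa>) (1 + y z) / (1 - y z)\<close> with unimodular \<open>\<kappa>\<close> is twice
  \<open>(1 - \<kappa> y z) / (1 - y z)\<close>, whose convolution does not vanish.  For the quotient in question this
  excludes precisely the imaginary values.
\<close>

lemma Re_conv_half_plane_multiplier: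
  assumes \<phi>: "\<phi> \<in> \<K>" and k: "k \<in> \<K>" and r: "0 < r" "r < 1" and n: "norm y = 1"
    and z: "z \<in> \<D>" "z \<noteq> 0"
  shows "Re ((\<phi> \<star> (\<lambda>w. w * deriv k (of_real r * w) * half_plane_map y w)) z /
    (\<phi> \<star> (\<lambda>w. w * deriv k (of_real r * w))) z) > 0"
proof -
  have K: "\<phi> holomorphic_on \<D>" "deriv \<phi> 0 = 1" "k holomorphic_on \<D>" "deriv k 0 = 1"
    using \<phi> k by (auto simp: class_K_def)
  have sub: "\<D> \<subseteq> ball 0 (1 / r)" using r by (rule disc_subset_inverse_ball)
  have dk: "(\<lambda>w. deriv k (of_real r * w)) holomorphic_on \<D>"
    using K(3) r by (intro holomorphic_on_subset[OF holomorphic_dilate sub] holomorphic_deriv) auto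
  have hp: "half_plane_map y holomorphic_on \<D>" using holomorphic_half_plane_map n by simp
  define N1 where "N1 = (\<phi> \<star> (\<lambda>w. w * (deriv k (of_real r * w) * half_plane_map y w)))"
  define N2 where "N2 = (\<phi> \<star> (\<lambda>w. w * deriv k (of_real r * w)))"
  have h1: "(\<lambda>w. w * (deriv k (of_real r * w) * half_plane_map y w)) holomorphic_on \<D>"
    and h2: "(\<lambda>w. w * deriv k (of_real r * w)) holomorphic_on \<D>"
    by (intro holomorphic_intros dk hp)+
  have nz: "1 - y * w \<noteq> 0" if "w \<in> \<D>" for w using one_minus_times_nonzero[of y w] n that by auto
  have comb: "(\<phi> \<star> (\<lambda>w. w * (deriv k (of_real r * w) * ((1 - \<kappa> * y * w) / (1 - y * w))))) z
    = 1 / 2 * ((1 + \<kappa>) * N2 z + (1 - \<kappa>) * N1 z)" if "z \<in> \<D>" for z \<kappa>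
  proof -
    have f: "(1 - \<kappa> * y * w) / (1 - y * w) = ((1 + \<kappa>) + (1 - \<kappa>) * half_plane_map y w) / 2" if "w \<in> \<D>" for w
      using nz[OF that] unfolding half_plane_map_def by (simp add: divide_simps) (simp add: algebra_simps)
    have eq: "w * (deriv k (of_real r * w) * ((1 - \<kappa> * y * w) / (1 - y * w))) =
      (1 + \<kappa>) / 2 * (w * deriv k (of_real r * w)) + (1 - \<kappa>) / 2 * (w * (deriv k (of_real r * w) * half_plane_map y w))"
      if "w \<in> \<D>" for w
      unfolding f[OF that] by (simp add: field_simps)
    have z1: "norm z < 1" using that by simp
    have "(\<phi> \<star> (\<lambda>w. w * (deriv k (of_real r * w) * ((1 - \<kappa> * y * w) / (1 - y * w))))) z
      = (\<phi> \<star> (\<lambda>w. (1 + \<kappa>) / 2 * (w * deriv k (of_real r * w)) + (1 - \<kappa>) / 2 * (w * (deriv k (of_real r * w) * half_plane_map y w)))) z"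
      by (subst conv_cong[OF eq]) auto
    also have "\<dots> = (1 + \<kappa>) / 2 * N2 z + (1 - \<kappa>) / 2 * N1 z"
      unfolding N1_def N2_def
      by (simp only: conv_add[OF K(1) holomorphic_on_mult[OF holomorphic_on_const h2] holomorphic_on_mult[OF holomorphic_on_const h1] z1]
        conv_cmult[OF K(1) h1 z1] conv_cmult[OF K(1) h2 z1])
    finally show ?thesis by (simp add: algebra_simps add_divide_distrib diff_divide_distrib)
  qed
  have nonzero: "(1 + \<kappa>) * N2 z + (1 - \<kappa>) * N1 z \<noteq> 0" if "z \<in> \<D>" "z \<noteq> 0" "norm \<kappa> = 1" for z \<kappa>
  proof -
    have "norm (\<kappa> * y) = 1" using n that by (simp add: norm_mult)
    from conv_deriv_times_Moebius_nonzero[OF \<phi> k r this n that(1,2)] show ?thesis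
      unfolding comb[OF that(1)] by auto
  qed
  have "Re (N1 z / N2 z) > 0"
  proof (rule Re_quotient_positive[of N1 N2 z])
    show "N1 holomorphic_on \<D>" "N2 holomorphic_on \<D>"
      unfolding N1_def N2_def by (intro holomorphic_intros K h1 h2)+
    show "N1 0 = 0" "N2 0 = 0" "deriv N1 0 = deriv N2 0" "deriv N2 0 \<noteq> 0"
      unfolding N1_def N2_def
      using conv_factor_X[OF K(1) dk] conv_factor_X[OF K(1) holomorphic_on_mult[OF dk hp]] K
      by (simp_all add: half_plane_map_def)
    show "N2 z \<noteq> 0" if "z \<in> \<D>" "z \<noteq> 0" for z using nonzero[OF that, of 1] by simp
    show "N1 z \<noteq> \<i> * of_real \<tau> * N2 z" if "z \<in> \<D>" "z \<noteq> 0" for z \<tau>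
    proof
      assume eq: "N1 z = \<i> * of_real \<tau> * N2 z"
      \<comment> \<open>the unimodular number for which the combination of \<open>N1\<close> and \<open>N2\<close> would vanish\<close>
      define \<kappa> where "\<kappa> = - (1 + \<i> * of_real \<tau>) / (1 - \<i> * of_real \<tau>)"
      have d: "1 - \<i> * of_real \<tau> \<noteq> 0" by (simp add: complex_eq_iff)
      have "norm (- (1 + \<i> * of_real \<tau>)) = norm (1 - \<i> * of_real \<tau>)"
        unfolding norm_minus_cancel by (simp add: cmod_def)
      then have "norm \<kappa> = 1" using d by (simp only: \<kappa>_def norm_divide) simp
      have "(1 + \<kappa>) * N2 z + (1 - \<kappa>) * N1 z = ((1 + \<kappa>) + (1 - \<kappa>) * (\<i> * of_real \<tau>)) * N2 z"
        unfolding eq by (simp add: algebra_simps)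
      also have "(1 + \<kappa>) + (1 - \<kappa>) * (\<i> * of_real \<tau>) = (1 + \<i> * of_real \<tau>) + \<kappa> * (1 - \<i> * of_real \<tau>)"
        by (simp add: algebra_simps)
      also have "\<kappa> * (1 - \<i> * of_real \<tau>) = - (1 + \<i> * of_real \<tau>)"
        using d by (simp add: \<kappa>_def)
      finally show False using nonzero[OF that \<open>norm \<kappa> = 1\<close>] by simp
    qed
  qed (use z in auto)
  then show ?thesis by (simp add: N1_def N2_def mult.assoc)
qed

text \<open>
  The preceding lemmas need \<open>k'\<close> and \<open>P\<close> beyond the unit circle.  This is no loss: the value at \<open>z\<close> of a
  convolution with \<open>F\<close> is the value at \<open>z / r\<close> of the convolution with \<open>F (r w)\<close>.  Strict positivity follows from
  the limit \<open>P 0\<close> of the quotient at the origin.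
\<close>

theorem Re_conv_multiplier_positive:
  assumes \<phi>: "\<phi> \<in> \<K>" and k: "k \<in> \<K>" and P: "P holomorphic_on \<D>" "\<And>w. w \<in> \<D> \<Longrightarrow> Re (P w) > 0"
    and z: "z \<in> \<D>" "z \<noteq> 0"
  shows "Re ((\<phi> \<star> (\<lambda>w. w * deriv k w * P w)) z / (\<phi> \<star> (\<lambda>w. w * deriv k w)) z) > 0"
proof -
  have K: "\<phi> holomorphic_on \<D>" "deriv \<phi> 0 = 1" "k holomorphic_on \<D>" "deriv k 0 = 1"
    using \<phi> k by (auto simp: class_K_def)
  have dk: "deriv k holomorphic_on \<D>" by (intro holomorphic_deriv K) auto
  define N1 where "N1 = (\<phi> \<star> (\<lambda>w. w * deriv k w * P w))"
  define N2 where "N2 = (\<phi> \<star> (\<lambda>w. w * deriv k w))"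
  have h1: "(\<lambda>w. w * deriv k w * P w) holomorphic_on \<D>" and h2: "(\<lambda>w. w * deriv k w) holomorphic_on \<D>"
    by (intro holomorphic_intros dk P)+
  have N: "N1 holomorphic_on \<D>" "N2 holomorphic_on \<D>"
    unfolding N1_def N2_def by (intro holomorphic_intros K h1 h2)+
  have dilated: "N2 z \<noteq> 0 \<and> Re (N1 z / N2 z) \<ge> 0" if z: "z \<in> \<D>" "z \<noteq> 0" for z
  proof -
    obtain r where r: "norm z < r" "r < 1" using dense[of "norm z" 1] z by auto
    then have r0: "0 < r" using norm_ge_zero[of z] by linarith
    define z' where "z' = z / of_real r"
    have z': "z' \<in> \<D>" "z' \<noteq> 0" and rz: "of_real r * z' = z"
      using z r r0 by (auto simp: z'_def norm_divide)
    have sub: "\<D> \<subseteq> ball 0 (1 / r)" using r0 r(2) by (rule disc_subset_inverse_ball)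
    define q where "q w = w * deriv k (of_real r * w)" for w
    have Pr: "(\<lambda>w. P (of_real r * w)) holomorphic_on ball 0 (1 / r)"
      by (rule holomorphic_dilate[OF P(1) r0])
    have q: "q holomorphic_on \<D>"
      unfolding q_def by (intro holomorphic_intros holomorphic_on_subset[OF holomorphic_dilate sub] dk r0)
    have scale: "(\<phi> \<star> (\<lambda>w. of_real r * F w)) z' = of_real r * (\<phi> \<star> F) z'" if "F holomorphic_on \<D>" for F
      using that z' by (intro conv_cmult K) auto
    have dil: "(\<phi> \<star> (\<lambda>w. F (of_real r * w))) z' = (\<phi> \<star> F) z" if "F holomorphic_on \<D>" for F
      using conv_dilate[OF K(1) that, of "of_real r" z'] r r0 z' rz by simp
    have e2: "N2 z = of_real r * (\<phi> \<star> q) z'"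
      using dil[OF h2] scale[OF q] unfolding N2_def q_def by (simp add: mult.assoc)
    have "(\<lambda>w. q w * P (of_real r * w)) holomorphic_on \<D>"
      by (intro holomorphic_intros q holomorphic_on_subset[OF Pr sub])
    then have e1: "N1 z = of_real r * (\<phi> \<star> (\<lambda>w. q w * P (of_real r * w))) z'"
      using dil[OF h1] scale unfolding N1_def q_def by (simp add: mult.assoc)
    have hp: "Re (1 / (\<phi> \<star> q) z' * (\<phi> \<star> (\<lambda>w. q w * half_plane_map \<zeta> w)) z') > 0" if "norm \<zeta> = 1" for \<zeta>
      using Re_conv_half_plane_multiplier[OF \<phi> k r0 r(2) that z'] unfolding q_def by simp
    have "Re (1 / (\<phi> \<star> q) z' * (\<phi> \<star> (\<lambda>w. q w * half_plane_map 1 w)) z') > 0" by (rule hp) simp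
    then have q0: "(\<phi> \<star> q) z' \<noteq> 0" by auto
    have "Re (1 / (\<phi> \<star> q) z' * (\<phi> \<star> (\<lambda>w. q w * P (of_real r * w))) z') \<ge> 0"
    proof (rule conv_positive_multiplier[OF K(1) q _ _ _ Pr])
      show "Re (P (of_real r * \<zeta>)) \<ge> 0" if "norm \<zeta> = 1" for \<zeta>
        using P(2)[of "of_real r * \<zeta>"] r r0 that by (simp add: norm_mult)
    qed (use z' q0 r r0 hp in \<open>auto simp: half_plane_map_def less_imp_le\<close>)
    then show ?thesis using e1 e2 q0 r0 by simp
  qed
  show ?thesis
  proof (rule ccontr)
    assume "\<not> ?thesis"
    then have z0: "Re (N1 z / N2 z) = 0" using dilated[OF z] by (simp add: N1_def N2_def)
    have "(\<lambda>w. N1 w / N2 w) constant_on (\<D> - {0})"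
    proof (rule Re_nonneg_attains_0_imp_constant)
      show "(\<lambda>w. N1 w / N2 w) holomorphic_on (\<D> - {0})"
        by (intro holomorphic_intros holomorphic_on_subset[OF N(1)] holomorphic_on_subset[OF N(2)]) (use dilated in auto)
      show "connected (\<D> - {0})" by (intro connected_open_delete) auto
      show "z \<in> \<D> - {0}" using z by simp
    qed (use z0 dilated in auto)
    then have const: "N1 w / N2 w = N1 z / N2 z" if "w \<in> \<D>" "w \<noteq> 0" for w
      using that z unfolding constant_on_def by (metis DiffI singletonD)
    have base: "N1 0 = 0" "N2 0 = 0" "deriv N1 0 = P 0" "deriv N2 0 = 1"
      unfolding N1_def N2_def
      using conv_factor_X[OF K(1) dk] conv_factor_X[OF K(1) holomorphic_on_mult[OF dk P(1)]] K
      by (simp_all add: mult.assoc)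
    have "N1 w = N1 z / N2 z * N2 w" if "w \<in> \<D>" for w
      using const[OF that] dilated[OF that] base by (cases "w = 0") (auto simp: field_simps)
    then have "deriv N1 0 = deriv (\<lambda>w. N1 z / N2 z * N2 w) 0"
      by (intro deriv_cong_ev) (auto simp: eventually_nhds intro!: exI[of _ \<D>])
    also have "\<dots> = N1 z / N2 z * deriv N2 0"
      using N(2) by (intro deriv_cmult holomorphic_on_imp_differentiable_at[of _ \<D>]) auto
    finally show False using base z0 P(2)[of 0] by simp
  qed
qed

section \<open>Convolutions of harmonic mappings\<close>

lemma sense_preserving_dilatation:
  assumes f: "harmonic_decomp f h g" and sp: "sense_preserving_on \<D> f" and z: "z \<in> \<D>"
  shows "norm (deriv g z) < norm (deriv h z)"
proof -
  have hg: "h holomorphic_on \<D>" "g holomorphic_on \<D>" "\<And>w. w \<in> \<D> \<Longrightarrow> f w = h w + cnj (g w)"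
    using f by (auto simp: harmonic_decomp_def)
  have "(h has_derivative (\<lambda>v. deriv h z * v)) (at z)" "(g has_derivative (\<lambda>v. deriv g z * v)) (at z)"
    using holomorphic_derivI[OF hg(1) _ z] holomorphic_derivI[OF hg(2) _ z]
    by (auto simp: has_field_derivative_def)
  then have "((\<lambda>w. h w + cnj (g w)) has_derivative (\<lambda>v. deriv h z * v + cnj (deriv g z * v))) (at z)"
    by (intro has_derivative_add bounded_linear.has_derivative[OF bounded_linear_cnj])
  then have "(f has_derivative (\<lambda>v. deriv h z * v + cnj (deriv g z * v))) (at z)"
    by (rule has_derivative_transform_within_open[OF _ open_ball z]) (simp add: hg(3))
  then have "frechet_derivative f (at z) = (\<lambda>v. deriv h z * v + cnj (deriv g z * v))"
    using frechet_derivative_at by metis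
  then have "jacobian f z = Im (cnj (deriv h z + cnj (deriv g z)) * (deriv h z * \<i> + cnj (deriv g z * \<i>)))"
    by (simp add: jacobian_def)
  also have "\<dots> = (norm (deriv h z))\<^sup>2 - (norm (deriv g z))\<^sup>2"
    unfolding cmod_power2 by (simp add: power2_eq_square algebra_simps)
  finally have "(norm (deriv g z))\<^sup>2 < (norm (deriv h z))\<^sup>2"
    using sp z unfolding sense_preserving_on_def by fastforce
  then show ?thesis by (rule power2_less_imp_less) simp
qed

lemma primitive_of_contour_integral:
  assumes f: "f holomorphic_on \<D>" and F: "\<And>z. z \<in> \<D> \<Longrightarrow> F z = contour_integral (linepath 0 z) f"
    and z: "z \<in> \<D>"
  shows "(F has_field_derivative f z) (at z)"
proof -
  obtain Y where Y: "\<And>x. x \<in> \<D> \<Longrightarrow> (Y has_field_derivative f x) (at x within \<D>)"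
    using holomorphic_convex_primitive'[OF convex_ball open_ball f] by blast
  have FY: "Y x - Y 0 = F x" if "x \<in> \<D>" for x
  proof -
    have "closed_segment 0 x \<subseteq> \<D>" using that by (intro closed_segment_subset) auto
    then have "(f has_contour_integral Y (pathfinish (linepath 0 x)) - Y (pathstart (linepath 0 x))) (linepath 0 x)"
      by (intro contour_integral_primitive[OF Y]) auto
    then show ?thesis using F[OF that] contour_integral_unique by fastforce
  qed
  have "(Y has_field_derivative f z) (at z)" using Y[OF z] z by (simp add: at_within_open[OF z open_ball])
  then have "((\<lambda>x. Y x - Y 0) has_field_derivative f z) (at z)"
    using DERIV_diff[OF _ DERIV_const] by fastforce
  then show ?thesis
    by (rule has_field_derivative_transform_within_open[OF _ open_ball z]) (rule FY)
qed

theorem theorem3p3: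
  fixes \<phi> f h g :: "complex \<Rightarrow> complex" and \<mu> \<nu> :: real
  assumes "\<phi> \<in> \<K>"
    and "harmonic_decomp f h g"
    and "locally_univalent_on \<D> f"
    and "sense_preserving_on \<D> f"
    and "(\<lambda>z. h z + exp (- 2 * \<i> * of_real \<mu>) * g z) \<in> \<K>"
    and "\<And>z. z \<in> \<D> \<Longrightarrow>
           ((\<lambda>w. h w + exp (- 2 * \<i> * of_real \<mu>) * g w) \<star> \<phi>) z =
           contour_integral (linepath 0 z)
             (\<lambda>\<xi>. 1 / (1 - 2 * \<xi> * exp (\<i> * of_real \<mu>) * of_real (cos \<nu>)
                        + \<xi>\<^sup>2 * exp (2 * \<i> * of_real \<mu>)))"
  shows "harmonic_conv h g \<phi> \<in> \<K>\<^sub>H"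
proof -
  define E where "E = cis \<mu>"
  define \<epsilon> where "\<epsilon> = exp (- 2 * \<i> * of_real \<mu>)"
  define k where "k z = h z + \<epsilon> * g z" for z
  define l where "l z = h z - \<epsilon> * g z" for z
  have E: "norm E = 1" "E \<noteq> 0" "E * cnj E = 1" "exp (\<i> * of_real \<mu>) = E" "exp (2 * \<i> * of_real \<mu>) = E\<^sup>2" "E * \<epsilon> = cnj E"
  proof -
    show "norm E = 1" "E \<noteq> 0" "E * cnj E = 1" by (simp_all add: E_def cis_cnj cis_mult)
    show *: "exp (\<i> * of_real \<mu>) = E" by (simp add: E_def cis_conv_exp)
    show "exp (2 * \<i> * of_real \<mu>) = E\<^sup>2" unfolding *[symmetric] by (simp add: exp_double[symmetric] mult.assoc)
    have "E * \<epsilon> = exp (- (\<i> * of_real \<mu>))" unfolding *[symmetric] \<epsilon>_def exp_add[symmetric] by simp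
    then show "E * \<epsilon> = cnj E" unfolding *[symmetric] by (simp add: exp_cnj)
  qed
  have \<phi>: "\<phi> holomorphic_on \<D>" "\<phi> 0 = 0" "deriv \<phi> 0 = 1" using assms(1) by (auto simp: class_K_def)
  have hg: "h holomorphic_on \<D>" "g holomorphic_on \<D>" "h 0 = 0" "deriv h 0 = 1" "g 0 = 0"
    using assms(2) by (auto simp: harmonic_decomp_def)
  have kK: "k \<in> \<K>" using assms(5) by (simp add: k_def[abs_def] \<epsilon>_def)
  have kl: "k holomorphic_on \<D>" "l holomorphic_on \<D>"
    unfolding k_def[abs_def] l_def[abs_def] by (intro holomorphic_intros hg)+
  note d = holomorphic_derivI[OF hg(1) open_ball] DERIV_cmult[OF holomorphic_derivI[OF hg(2) open_ball]]
  have dk: "deriv k z = deriv h z + \<epsilon> * deriv g z" and dl: "deriv l z = deriv h z - \<epsilon> * deriv g z" if "z \<in> \<D>" for z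
    unfolding k_def[abs_def] l_def[abs_def]
    by (rule DERIV_imp_deriv[OF DERIV_add[OF d[OF that]]] DERIV_imp_deriv[OF DERIV_diff[OF d[OF that]]])+
  have dk0: "deriv k z \<noteq> 0" if "z \<in> \<D>" for z by (rule deriv_nonzero_class_K[OF kK that])
  define P where "P z = deriv l z / deriv k z" for z
  have P: "P holomorphic_on \<D>"
    unfolding P_def[abs_def] by (intro holomorphic_intros holomorphic_deriv kl dk0) auto
  have ReP: "Re (P z) > 0" if z: "z \<in> \<D>" for z
  proof -
    have "norm (\<epsilon> * deriv g z) < norm (deriv h z)"
      using sense_preserving_dilatation[OF assms(2,4) z] by (simp add: \<epsilon>_def norm_mult)
    moreover have "Re ((a - b) / (a + b)) > 0" if "norm b < norm a" for a b :: complex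
    proof -
      have "a + b \<noteq> 0" using that by (metis add_eq_0_iff less_irrefl norm_minus_cancel)
      moreover have "Re ((a - b) * cnj (a + b)) = (norm a)\<^sup>2 - (norm b)\<^sup>2"
        unfolding cmod_power2 by (simp add: power2_eq_square algebra_simps)
      moreover have "(norm b)\<^sup>2 < (norm a)\<^sup>2" using that by (simp add: power_strict_mono)
      ultimately show ?thesis by (subst complex_div_cnj) (simp add: zero_less_divide_iff del: times_complex.sel complex_cnj_add)
    qed
    ultimately show ?thesis unfolding P_def dk[OF z] dl[OF z] by blast
  qed
  define A B where "A = (\<phi> \<star> k)" and "B = (\<phi> \<star> l)"
  have AB: "A holomorphic_on \<D>" "B holomorphic_on \<D>"
    unfolding A_def B_def by (intro holomorphic_intros \<phi> kl)+
  have ratio: "Re (deriv B z / deriv A z) > 0" if z: "z \<in> \<D>" for z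
  proof (cases "z = 0")
    case True
    have "deriv (\<phi> \<star> m) 0 = deriv m 0" if "m holomorphic_on \<D>" for m
      using taylor_conv[OF \<phi>(1) that, of 1] \<phi>(3) by (simp add: fps_expansion_def)
    then show ?thesis using ReP[OF z] kl True by (simp add: A_def B_def P_def)
  next
    case False
    have z1: "norm z < 1" using z by simp
    have "w * deriv k w * P w = w * deriv l w" if "w \<in> \<D>" for w using dk0[OF that] by (simp add: P_def)
    then have "(\<phi> \<star> (\<lambda>w. w * deriv k w * P w)) z = (\<phi> \<star> (\<lambda>w. w * deriv l w)) z"
      by (subst conv_cong) auto
    then have "Re (z * deriv B z / (z * deriv A z)) > 0"
      using Re_conv_multiplier_positive[OF assms(1) kK P ReP z False]
      unfolding A_def B_def conv_times_deriv[OF \<phi>(1) kl(1) z1] conv_times_deriv[OF \<phi>(1) kl(2) z1] by simp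
    then show ?thesis using False by simp
  qed
  define H G where "H = (h \<star> \<phi>)" and "G = (g \<star> \<phi>)"
  have HG: "A z = H z + \<epsilon> * G z" "B z = H z - \<epsilon> * G z" if z: "z \<in> \<D>" for z
  proof -
    have z1: "norm z < 1" using z by simp
    have h\<epsilon>: "(\<lambda>w. \<epsilon> * g w) holomorphic_on \<D>" by (intro holomorphic_intros hg)
    show "A z = H z + \<epsilon> * G z" "B z = H z - \<epsilon> * G z"
      unfolding A_def B_def H_def G_def k_def[abs_def] l_def[abs_def]
      using conv_add[OF \<phi>(1) hg(1) h\<epsilon> z1] conv_diff[OF \<phi>(1) hg(1) h\<epsilon> z1] conv_cmult[OF \<phi>(1) hg(2) z1]
      by (simp_all add: conv_commute[of _ \<phi>])
  qed
  have dA: "(A has_field_derivative 1 / (1 - 2 * of_real (cos \<nu>) * (E * z) + (E * z)\<^sup>2)) (at z)" if z: "z \<in> \<D>" for z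
  proof (rule primitive_of_contour_integral[OF _ _ z])
    have "E * w \<in> \<D>" if "w \<in> \<D>" for w using that E by (simp add: norm_mult)
    then show "(\<lambda>z. 1 / (1 - 2 * of_real (cos \<nu>) * (E * z) + (E * z)\<^sup>2)) holomorphic_on \<D>"
      by (intro holomorphic_intros quadratic_nonzero)
    fix w assume "w \<in> \<D>"
    have "A w = ((\<lambda>w. h w + \<epsilon> * g w) \<star> \<phi>) w"
      by (simp add: A_def k_def[abs_def] conv_commute[of _ \<phi>])
    also have "\<dots> = contour_integral (linepath 0 w)
             (\<lambda>\<xi>. 1 / (1 - 2 * \<xi> * E * of_real (cos \<nu>) + \<xi>\<^sup>2 * E\<^sup>2))"
      using assms(6)[OF \<open>w \<in> \<D>\<close>] unfolding \<epsilon>_def E(4,5) .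
    also have "(\<lambda>\<xi>. 1 / (1 - 2 * \<xi> * E * of_real (cos \<nu>) + \<xi>\<^sup>2 * E\<^sup>2)) = (\<lambda>z. 1 / (1 - 2 * of_real (cos \<nu>) * (E * z) + (E * z)\<^sup>2))"
      by (simp add: fun_eq_iff power_mult_distrib mult_ac)
    finally show "A w = contour_integral (linepath 0 w) (\<lambda>z. 1 / (1 - 2 * of_real (cos \<nu>) * (E * z) + (E * z)\<^sup>2))" .
  qed
  have rot: "cnj E * z \<in> \<D>" "E * z \<in> \<D>" "E * (cnj E * z) = z" "cnj E * (E * z) = z" if "z \<in> \<D>" for z
    using that E by (simp_all add: norm_mult mult.assoc[symmetric] mult.commute[of "cnj E"])
  \<comment> \<open>rotating the variable as well moves the poles of \<open>X'\<close> to \<open>cis \<nu>\<close> and \<open>cis (- \<nu>)\<close>\<close>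
  define X \<Phi> where "X z = E * A (cnj E * z)" and "\<Phi> z = E * B (cnj E * z)" for z
  have rotate_deriv: "((\<lambda>z. E * m (cnj E * z)) has_field_derivative deriv m (cnj E * z)) (at z)"
    if "m holomorphic_on \<D>" "z \<in> \<D>" for m z
  proof -
    have "(m has_field_derivative deriv m (cnj E * z)) (at (cnj E * z))"
      by (rule holomorphic_derivI[OF that(1) open_ball rot(1)[OF that(2)]])
    moreover have "((\<lambda>z. cnj E * z) has_field_derivative cnj E) (at z)"
      by (auto intro!: derivative_eq_intros)
    ultimately have "((\<lambda>z. m (cnj E * z)) has_field_derivative deriv m (cnj E * z) * cnj E) (at z)"
      using DERIV_chain2[of m "deriv m (cnj E * z)" "\<lambda>z. cnj E * z" z "cnj E" UNIV] by simp
    moreover have "E * (deriv m (cnj E * z) * cnj E) = deriv m (cnj E * z)"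
    proof -
      have "E * (deriv m (cnj E * z) * cnj E) = (E * cnj E) * deriv m (cnj E * z)" by (simp only: mult_ac)
      then show ?thesis using E(3) by simp
    qed
    ultimately show ?thesis
      using DERIV_cmult[of "\<lambda>z. m (cnj E * z)" "deriv m (cnj E * z) * cnj E" z UNIV E] by (simp only:)
  qed
  have dX: "(X has_field_derivative deriv A (cnj E * z)) (at z)" and d\<Phi>: "(\<Phi> has_field_derivative deriv B (cnj E * z)) (at z)"
    if "z \<in> \<D>" for z
    unfolding X_def[abs_def] \<Phi>_def[abs_def] by (intro rotate_deriv AB that)+
  have X': "(X has_field_derivative 1 / (1 - 2 * of_real (cos \<nu>) * z + z\<^sup>2)) (at z)" if "z \<in> \<D>" for z
    using dX[OF that] DERIV_imp_deriv[OF dA[OF rot(1)[OF that]]] rot(3)[OF that] by simp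
  define F where "F z = Complex (Re (X z)) (Im (\<Phi> z))" for z
  have shear: "inj_on F \<D>" "open (F ` \<D>)" "convex (F ` \<D>)"
  proof -
    have hol: "X holomorphic_on \<D>" "\<Phi> holomorphic_on \<D>"
      using dX d\<Phi> by (meson field_differentiable_at_within field_differentiable_def holomorphic_onI)+
    have pos: "Re (deriv \<Phi> z / deriv X z) > 0" if "z \<in> \<D>" for z
      using ratio[OF rot(1)[OF that]] DERIV_imp_deriv[OF dX[OF that]] DERIV_imp_deriv[OF d\<Phi>[OF that]] by simp
    show "inj_on F \<D>" "open (F ` \<D>)" "convex (F ` \<D>)"
      unfolding F_def[abs_def]
      by (intro harmonic_shear_convex[OF hol(1) strip_map_inj[OF X'] hol(2) strip_map_range_vertical_invariant[OF X'] pos]; assumption)+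
  qed
  have conv_eq: "harmonic_conv h g \<phi> z = cnj E * F (E * z)" if z: "z \<in> \<D>" for z
  proof -
    have "X (E * z) = E * H z + cnj E * G z"
      unfolding X_def rot(4)[OF z] HG(1)[OF z] unfolding distrib_left mult.assoc[symmetric] E(6) ..
    moreover have "\<Phi> (E * z) = E * H z - cnj E * G z"
      unfolding \<Phi>_def rot(4)[OF z] HG(2)[OF z] unfolding right_diff_distrib mult.assoc[symmetric] E(6) ..
    ultimately have "F (E * z) = E * H z + cnj (cnj E * G z)"
      by (simp add: F_def complex_eq_iff)
    also have "\<dots> = E * (H z + cnj (G z))" by (simp add: algebra_simps)
    finally show ?thesis using E(3) by (simp add: harmonic_conv_def H_def G_def mult.assoc[symmetric] mult.commute[of "cnj E"])
  qed
  have image: "harmonic_conv h g \<phi> ` \<D> = (\<lambda>w. cnj E * w) ` F ` \<D>"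
  proof -
    have "(\<lambda>z. E * z) ` \<D> = \<D>"
    proof
      show "(\<lambda>z. E * z) ` \<D> \<subseteq> \<D>" using rot(2) by blast
      show "\<D> \<subseteq> (\<lambda>z. E * z) ` \<D>"
      proof
        fix z assume "z \<in> \<D>"
        then show "z \<in> (\<lambda>z. E * z) ` \<D>" by (intro image_eqI[of _ _ "cnj E * z"]) (simp_all only: rot)
      qed
    qed
    then have "(\<lambda>w. cnj E * w) ` F ` \<D> = (\<lambda>w. cnj E * w) ` F ` (\<lambda>z. E * z) ` \<D>" by simp
    also have "\<dots> = harmonic_conv h g \<phi> ` \<D>"
      unfolding image_image using conv_eq by (intro image_cong) auto
    finally show ?thesis ..
  qed
  have "inj_on (harmonic_conv h g \<phi>) \<D>"
  proof (rule inj_onI)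
    fix a b assume ab: "a \<in> \<D>" "b \<in> \<D>" "harmonic_conv h g \<phi> a = harmonic_conv h g \<phi> b"
    then have "F (E * a) = F (E * b)" using E(2) by (simp add: conv_eq)
    then have "E * a = E * b" by (rule inj_onD[OF shear(1)]) (use rot(2) ab in auto)
    then show "a = b" using E(2) by simp
  qed
  moreover have "open (harmonic_conv h g \<phi> ` \<D>)"
    unfolding image using E(2) by (intro open_mapping_thm3[OF _ shear(2)] holomorphic_intros) (auto simp: inj_on_def)
  moreover have "convex (harmonic_conv h g \<phi> ` \<D>)"
    unfolding image by (rule convex_linear_image[OF bounded_linear.linear[OF bounded_linear_mult_right] shear(3)])
  moreover have "harmonic_decomp (harmonic_conv h g \<phi>) H G"
  proof -
    have t0: "taylor m 0 = m 0" and t1: "taylor m 1 = deriv m 0" for m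
      by (simp_all add: fps_expansion_def)
    have "H 0 = h 0 * \<phi> 0" "G 0 = g 0 * \<phi> 0" "deriv H 0 = deriv h 0 * deriv \<phi> 0"
      using taylor_conv[OF hg(1) \<phi>(1), of 0] taylor_conv[OF hg(2) \<phi>(1), of 0] taylor_conv[OF hg(1) \<phi>(1), of 1]
      unfolding t0 t1 H_def G_def by simp_all
    then show ?thesis
      unfolding harmonic_decomp_def using \<phi> hg
      by (auto simp: H_def G_def harmonic_conv_def intro!: holomorphic_conv)
  qed
  ultimately show ?thesis unfolding class_KH_def by blast
qed

end
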